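(* Let $G$ be a finite group of order $n$. For each prime $p$ dividing $n$, let $G_p$ be a Sylow $p$-subgroup of $G$, of order $p^{n_p}$, and put $d_p=d(G_p)$, $\delta_p=d(G_p/Z(G_p))$, $k'_p=d(\gamma_2G_p/\gamma_3G_p)$, $|\gamma_2G_p|=p^{k_p}$; let $r_p,t_p$ be non-negative integers with $\binom{\delta_p}{2}-k'_p=\binom{r_p}{2}+t_p$ and $0\le t_p<r_p$. Then \[|M(G)|\le\prod_{p\mid n}p^{\frac{1}{2}(d_p-1)(n_p+k_p)-k_p(d_p-\delta_p)-\binom{\delta_p}{3}+\binom{r_p}{3}+\binom{t_p}{2}},\] where the product runs over all primes $p$ dividing $n$.
   Context: $d(H)$ denotes the minimal number of generators of a finite group $H$; $Z(H)$ is the center; $\gamma_iH$ is the $i$-th term of the lower central series; $M(G)$ is the Schur multiplier of $G$. Binomial coefficients satisfy $\binom{a}{b}=0$ when $0\le a<b$. *)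

theory Defs
  imports "HOL-Algebra.Algebra" "HOL-Computational_Algebra.Primes" Complex_Main
begin

definition min_gens :: "('a, 'b) monoid_scheme \<Rightarrow> nat" where
  "min_gens H = (LEAST k. \<exists>S. S \<subseteq> carrier H \<and> finite S \<and> card S = k \<and> generate H S = carrier H)"

definition grp_center :: "('a, 'b) monoid_scheme \<Rightarrow> 'a set" where
  "grp_center H = {z \<in> carrier H. \<forall>x \<in> carrier H. z \<otimes>\<^bsub>H\<^esub> x = x \<otimes>\<^bsub>H\<^esub> z}"

definition comm_subgroup :: "('a, 'b) monoid_scheme \<Rightarrow> 'a set \<Rightarrow> 'a set \<Rightarrow> 'a set" where
  "comm_subgroup H A B = generate H
     {a \<otimes>\<^bsub>H\<^esub> b \<otimes>\<^bsub>H\<^esub> inv\<^bsub>H\<^esub> a \<otimes>\<^bsub>H\<^esub> inv\<^bsub>H\<^esub> b | a b. a \<in> A \<and> b \<in> B}"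

fun lower_central :: "('a, 'b) monoid_scheme \<Rightarrow> nat \<Rightarrow> 'a set" where
  "lower_central H 0 = carrier H"
| "lower_central H (Suc 0) = carrier H"
| "lower_central H (Suc (Suc i)) = comm_subgroup H (lower_central H (Suc i)) (carrier H)"

text \<open>Schur multiplier M(G), in Schur's original form H^2(G, C^*) with trivial action
  (isomorphic to H_2(G,Z) for finite G): normalised-outside 2-cocycles modulo coboundaries.\<close>
definition schur_cocycles :: "('a, 'b) monoid_scheme \<Rightarrow> ('a \<times> 'a \<Rightarrow> complex) set" where
  "schur_cocycles G = {f.
     (\<forall>x\<in>carrier G. \<forall>y\<in>carrier G. f (x, y) \<noteq> 0) \<and>
     (\<forall>x\<in>carrier G. \<forall>y\<in>carrier G. \<forall>z\<in>carrier G.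
        f (x, y) * f (x \<otimes>\<^bsub>G\<^esub> y, z) = f (x, y \<otimes>\<^bsub>G\<^esub> z) * f (y, z)) \<and>
     (\<forall>q. q \<notin> carrier G \<times> carrier G \<longrightarrow> f q = 1)}"

definition schur_coboundaries :: "('a, 'b) monoid_scheme \<Rightarrow> ('a \<times> 'a \<Rightarrow> complex) set" where
  "schur_coboundaries G = {f. \<exists>g. (\<forall>x\<in>carrier G. g x \<noteq> 0) \<and>
     (\<forall>x\<in>carrier G. \<forall>y\<in>carrier G. f (x, y) = g x * g y / g (x \<otimes>\<^bsub>G\<^esub> y)) \<and>
     (\<forall>q. q \<notin> carrier G \<times> carrier G \<longrightarrow> f q = 1)}"

definition schur_rel :: "('a, 'b) monoid_scheme \<Rightarrow> (('a \<times> 'a \<Rightarrow> complex) \<times> ('a \<times> 'a \<Rightarrow> complex)) set" where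
  "schur_rel G = {(f, h). f \<in> schur_cocycles G \<and> h \<in> schur_cocycles G \<and>
     (\<lambda>q. f q / h q) \<in> schur_coboundaries G}"

definition schur_multiplier_order :: "('a, 'b) monoid_scheme \<Rightarrow> nat" where
  "schur_multiplier_order G = card (schur_cocycles G // schur_rel G)"

end

theory Submission
  imports Defs
begin

text \<open>By transfer, a cocycle that is trivial on every Sylow subgroup is trivial, so \<open>M(G)\<close> embeds into the product of
  the \<open>M(G\<^sub>p)\<close>. For a \<open>p\<close>-group \<open>P\<close>, let \<open>E\<close> be the extension of \<open>P\<close> by a product of copies of
  \<open>\<complex>\<^sup>*\<close>, one for each cocycle, twisted by all cocycles at once. A character of the kernel that
  vanishes on \<open>\<gamma>\<^sub>2E\<close> extends to \<open>E\<close>, so a cocycle class is determined by a character of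
  the intersection of \<open>\<gamma>\<^sub>2E\<close> with the kernel. Hence \<open>|M(P)| |\<gamma>\<^sub>2P| \<le> |\<gamma>\<^sub>2E|\<close>.

  The factors of the lower central series of any central extension \<open>E\<close> of \<open>P\<close> are bounded in terms
  of \<open>P\<close> alone: \<open>\<gamma>\<^sub>2E/\<gamma>\<^sub>3E\<close> is spanned by the values of an alternating map on \<open>P/\<gamma>\<^sub>2P\<close>, and for
  \<open>i \<ge> 2\<close> commutation with \<open>\<delta>\<close> generators of \<open>P/Z(P)\<close> gives a surjection
  \<open>(\<gamma>\<^sub>iP/\<gamma>\<^bsub>i+1\<^esub>P)\<^sup>\<delta> \<rightarrow> \<gamma>\<^bsub>i+1\<^esub>E/\<gamma>\<^bsub>i+2\<^esub>E\<close>. For \<open>i = 2\<close> its kernel contains the Jacobi elements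
  of all triples of generators. How many of them are independent is a Kruskal-Katona question: the
  triples that are lost are triangles in a graph with \<open>\<delta> choose 2 - k'\<close> edges.\<close>

section \<open>Triangles in graphs with few edges\<close>

text \<open>The multiplier is given by cocycles, so there is no covering group to start from;
  \<open>E\<close> stands in for one. It is infinite, and the finiteness of its derived subgroup
  comes out together with the bounds, because \<open>P\<close> is nilpotent and hence so is
  \<open>E\<close>. Only \<delta> generators matter from \<gamma>2 on: an element of
  \<open>E\<close> lying over the center of \<open>P\<close> need not be central in
  \<open>E\<close>, but it commutes with every commutator. Such a map is determined by unordered
  pairs of generators, which is the origin of the factor 1/2; inequalities are squared to keep
  exponents integral. The bounds for i \<ge> 2 telescope to |\<gamma>2 P|^\<delta>, and |P/\<gamma>2
  P| = p^(n-k). The graph arises because at least k' of the pairs must be kept for their commutators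
  to generate \<gamma>2 P/\<gamma>3 P. The pairs not kept are its edges, and a triple yields a new
  Jacobi element as soon as one of its pairs is kept.\<close>

lemma choose_two_add: "(a + b) choose 2 = (a choose 2) + (b choose 2) + a * b"
  by (induction a) (auto simp: numeral_2_eq_2)

lemma choose_Suc_two: "Suc n choose 2 = n + (n choose 2)" by (simp add: numeral_2_eq_2)

lemma choose_Suc_three: "Suc n choose 3 = (n choose 2) + (n choose 3)"
  by (simp add: numeral_3_eq_3 numeral_2_eq_2)

text \<open>A graph is only its edge set here, with vertex set \<open>\<Union>N\<close>. There are
  thus no isolated vertices, and a vertex of minimal degree has positive degree.\<close>

definition triangles :: "'a set set \<Rightarrow> 'a set set" where
  "triangles N = {T. card T = 3 \<and> (\<forall>e. e \<subseteq> T \<and> card e = 2 \<longrightarrow> e \<in> N)}"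

lemma finite_of_card_2: "card e = 2 \<Longrightarrow> finite e" by (metis card.infinite zero_neq_numeral)

lemma triangle_subset_Union:
  assumes "T \<in> triangles N" shows "T \<subseteq> \<Union>N"
proof
  fix x assume x: "x \<in> T"
  have c: "card T = 3" using assms by (simp add: triangles_def)
  then have "card (T - {x}) = 2" using x by simp
  then obtain y where "y \<in> T" "y \<noteq> x" by (metis Diff_iff card_2_iff' insertI1)
  then have "{x,y} \<in> N" using assms x by (simp add: triangles_def)
  then show "x \<in> \<Union>N" by blast
qed

lemma finite_triangles:
  assumes "finite N" "\<And>e. e \<in> N \<Longrightarrow> card e = 2"
  shows "finite (triangles N)"
proof -
  have "finite (\<Union>N)" using assms finite_of_card_2 by blast
  then show ?thesis by (meson PowI finite_Pow_iff finite_subset subsetI triangle_subset_Union)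
qed

lemma double_counting_degrees:
  assumes "finite N" "\<And>e. e \<in> N \<Longrightarrow> card e = 2"
  shows "(\<Sum>v\<in>\<Union>N. card {e \<in> N. v \<in> e}) = 2 * card N"
proof -
  have fin: "finite (\<Union>N)" using assms finite_of_card_2 by blast
  have "(\<Sum>v\<in>\<Union>N. card {e \<in> N. v \<in> e}) = (\<Sum>v\<in>\<Union>N. \<Sum>e\<in>N. if v \<in> e then 1 else 0)"
    using assms(1) by (intro sum.cong refl) (simp add: sum.If_cases Int_def)
  also have "\<dots> = (\<Sum>e\<in>N. \<Sum>v\<in>\<Union>N. if v \<in> e then 1 else 0)" by (rule sum.swap)
  also have "\<dots> = (\<Sum>e\<in>N. card e)"
  proof (intro sum.cong refl)
    fix e assume e: "e \<in> N"
    have "(\<Sum>v\<in>\<Union>N. if v \<in> e then 1 else 0) = card (\<Union>N \<inter> e)" using fin by (simp add: sum.If_cases Int_def)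
    also have "\<Union>N \<inter> e = e" using e by blast
    finally show "(\<Sum>v\<in>\<Union>N. if v \<in> e then 1 else 0) = card e" .
  qed
  also have "\<dots> = 2 * card N" using assms(2) by simp
  finally show ?thesis .
qed

lemma incident_edges:
  assumes "\<And>e. e \<in> N \<Longrightarrow> card e = 2"
  shows "{e \<in> N. v \<in> e} = (\<lambda>w. {v,w}) ` {w. w \<noteq> v \<and> {v,w} \<in> N}"
proof (intro equalityI subsetI)
  fix e assume e: "e \<in> {e \<in> N. v \<in> e}"
  then obtain a b where "e = {a,b}" "a \<noteq> b" using assms[of e] by (auto simp: card_2_iff)
  with e show "e \<in> (\<lambda>w. {v,w}) ` {w. w \<noteq> v \<and> {v,w} \<in> N}" by (auto simp: insert_commute)
qed auto

text \<open>Deleting \<open>v\<close> from a triangle leaves a pair of neighbours of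
  \<open>v\<close>, and the triangle is recovered by adding \<open>v\<close> back.\<close>

lemma triangles_through_vertex:
  assumes "finite N" "\<And>e. e \<in> N \<Longrightarrow> card e = 2"
  shows "card {T \<in> triangles N. v \<in> T} \<le> card {e \<in> N. v \<in> e} choose 2"
proof -
  define nb where "nb = {w. w \<noteq> v \<and> {v,w} \<in> N}"
  have eq: "{e \<in> N. v \<in> e} = (\<lambda>w. {v,w}) ` nb" unfolding nb_def by (rule incident_edges) (rule assms(2))
  have inj: "inj_on (\<lambda>w. {v,w}) nb" by (auto simp: inj_on_def nb_def doubleton_eq_iff)
  have "finite ((\<lambda>w. {v,w}) ` nb)" unfolding eq[symmetric] using assms(1) by simp
  then have fnb: "finite nb" using inj by (rule finite_imageD)
  have cnb: "card {e \<in> N. v \<in> e} = card nb" using eq inj by (simp add: card_image)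
  have "card {T \<in> triangles N. v \<in> T} \<le> card {e. e \<subseteq> nb \<and> card e = 2}"
  proof (rule card_inj_on_le[where f="\<lambda>T. T - {v}"])
    show "inj_on (\<lambda>T. T - {v}) {T \<in> triangles N. v \<in> T}" by (auto simp: inj_on_def)
    show "(\<lambda>T. T - {v}) ` {T \<in> triangles N. v \<in> T} \<subseteq> {e. e \<subseteq> nb \<and> card e = 2}"
      by (auto simp: triangles_def nb_def)
    show "finite {e. e \<subseteq> nb \<and> card e = 2}" using fnb by simp
  qed
  also have "\<dots> = card nb choose 2" using fnb by (rule n_subsets)
  finally show ?thesis using cnb by simp
qed

text \<open>This is Kruskal-Katona for edges and triangles. Removing a vertex of minimal degree
  \<open>s\<close> destroys at most \<open>s choose 2\<close> triangles, and induction applies to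
  the remaining edges. Minimality forces s < r; the bound for the remaining edges keeps
  \<open>r\<close> when s \<le> t and drops to r - 1 otherwise.\<close>

lemma card_triangles_le:
  fixes N :: "'a set set"
  assumes "finite N" "\<And>e. e \<in> N \<Longrightarrow> card e = 2"
    and "card N \<le> (r choose 2) + t" "t < r"
  shows "card (triangles N) \<le> (r choose 3) + (t choose 2)" using assms
proof (induction "card N" arbitrary: N r t rule: less_induct)
  case less
  show ?case
  proof (cases "N = {}")
    case True
    have "T \<notin> triangles N" for T :: "'a set"
    proof
      assume T: "T \<in> triangles N"
      then have "T \<subseteq> {}" using triangle_subset_Union[OF T] True by simp
      with T show False by (simp add: triangles_def)
    qed
    then have "triangles N = {}" by blast
    then show ?thesis by simp
  next
    case False
    have fin: "finite (\<Union>N)" using less finite_of_card_2 by blast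
    obtain e0 where e0: "e0 \<in> N" using False by blast
    then have "e0 \<noteq> {}" using less.prems(2)[OF e0] by auto
    then have ne: "\<Union>N \<noteq> {}" using e0 by blast
    define deg where "deg v = card {e \<in> N. v \<in> e}" for v
    obtain v where v: "v \<in> \<Union>N" and vmin: "\<And>w. w \<in> \<Union>N \<Longrightarrow> deg v \<le> deg w"
      using ex_is_arg_min_if_finite[OF fin ne, of deg] unfolding is_arg_min_linorder by blast
    define s where "s = deg v"
    define N' where "N' = {e \<in> N. v \<notin> e}"
    have split: "card N = card N' + s"
    proof -
      have "N = N' \<union> {e \<in> N. v \<in> e}" "N' \<inter> {e \<in> N. v \<in> e} = {}" by (auto simp: N'_def)
      then have "card (N' \<union> {e \<in> N. v \<in> e}) = card N' + card {e \<in> N. v \<in> e}"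
        using less.prems(1) by (intro card_Un_disjoint) (auto simp: N'_def)
      with \<open>N = N' \<union> {e \<in> N. v \<in> e}\<close> show ?thesis by (simp add: s_def deg_def)
    qed
    have spos: "0 < s"
    proof -
      have "{e \<in> N. v \<in> e} \<noteq> {}" "finite {e \<in> N. v \<in> e}" using v less.prems(1) by auto
      then show ?thesis unfolding s_def deg_def using card_gt_0_iff by blast
    qed
    \<comment> \<open>A vertex of degree \<open>s\<close> has \<open>s\<close> neighbours, so there
      are at least s + 1 vertices, each of degree at least \<open>s\<close>; the degree sum does the
      rest.\<close>
    have large: "s * Suc s \<le> 2 * card N"
    proof -
      have "Suc s \<le> card (\<Union>N)"
      proof -
        define nb where "nb = {w. w \<noteq> v \<and> {v,w} \<in> N}"
        have sub: "insert v nb \<subseteq> \<Union>N" using v by (auto simp: nb_def)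
        have "{e \<in> N. v \<in> e} = (\<lambda>w. {v,w}) ` nb"
          unfolding nb_def by (rule incident_edges) (rule less.prems(2))
        moreover have fnb: "finite nb" using sub fin by (meson finite_insert finite_subset)
        ultimately have "s \<le> card nb" unfolding s_def deg_def by (simp add: card_image_le)
        moreover have "v \<notin> nb" by (simp add: nb_def)
        ultimately show ?thesis using card_mono[OF fin sub] fnb by simp
      qed
      then have "s * Suc s \<le> (\<Sum>w\<in>\<Union>N. s)" using mult_le_mono2[of "Suc s" "card (\<Union>N)" s] by (simp add: mult.commute)
      also have "\<dots> \<le> (\<Sum>w\<in>\<Union>N. deg w)" using vmin by (intro sum_mono) (simp add: s_def)
      also have "\<dots> = 2 * card N" unfolding deg_def using less.prems by (intro double_counting_degrees) auto
      finally show ?thesis .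
    qed
    have "card (triangles N) \<le> card (triangles N' \<union> {T \<in> triangles N. v \<in> T})"
    proof (rule card_mono)
      show "finite (triangles N' \<union> {T \<in> triangles N. v \<in> T})"
        using less.prems finite_triangles[of N] finite_triangles[of N'] by (auto simp: N'_def)
      show "triangles N \<subseteq> triangles N' \<union> {T \<in> triangles N. v \<in> T}" by (auto simp: triangles_def N'_def)
    qed
    also have "\<dots> \<le> card (triangles N') + (s choose 2)"
      using card_Un_le[of "triangles N'" "{T \<in> triangles N. v \<in> T}"]
        triangles_through_vertex[OF less.prems(1,2), of v] unfolding s_def deg_def by linarith
    finally have step: "card (triangles N) \<le> card (triangles N') + (s choose 2)" .
    have IH: "card (triangles N') \<le> (r' choose 3) + (t' choose 2)"
      if "card N' \<le> (r' choose 2) + t'" "t' < r'" for r' t'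
      using less.hyps[of N' r' t'] that less.prems split spos by (auto simp: N'_def)
    have twor: "2 * (r choose 2) = r * (r - 1)" by (cases r) (simp_all add: choose_two)
    \<comment> \<open>As t < r, there are fewer than \<open>Suc r choose 2\<close> edges, so the
      minimal degree cannot reach \<open>r\<close>.\<close>
    have sr: "s < r"
    proof (rule ccontr)
      assume "\<not> s < r"
      then have "r * Suc r \<le> s * Suc s" by (intro mult_le_mono) auto
      with large less.prems(3,4) twor have "r * Suc r < r * (r - 1) + 2 * r" by linarith
      moreover have "r * (r - 1) + 2 * r = r * Suc r" using less.prems(4) by (cases r) auto
      ultimately show False by simp
    qed
    show ?thesis
    proof (cases "s \<le> t")
      case True
      have "card N' \<le> (r choose 2) + (t - s)" "t - s < r" using split less.prems True by auto
      then have "card (triangles N') \<le> (r choose 3) + ((t - s) choose 2)" by (rule IH)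
      moreover have "t choose 2 = ((t - s) choose 2) + (s choose 2) + (t - s) * s"
        using choose_two_add[of "t - s" s] True by simp
      ultimately show ?thesis using step by linarith
    next
      case False
      \<comment> \<open>With these, r - 1 = x + y + t and s = y + t without subtraction. Passing
        from \<open>r choose 2\<close> to \<open>(r - 1) choose 2\<close> frees r - 1 edges;
        together with \<open>t\<close>, and after the loss of \<open>s\<close>, x + t are left over.
        The final inequality has slack \<open>x * y\<close>.\<close>
      define x y where "x = r - 1 - s" and "y = s - t"
      have r: "r = Suc (x + y + t)" and s: "s = y + t" using False sr by (auto simp: x_def y_def)
      have "card N' \<le> ((x + y + t) choose 2) + (x + t)" "x + t < x + y + t"
        using split less.prems(3) False choose_Suc_two[of "x + y + t"] unfolding r s by auto
      then have "card (triangles N') \<le> ((x + y + t) choose 3) + ((x + t) choose 2)" by (rule IH)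
      then show ?thesis using step unfolding r s choose_Suc_three by (simp add: choose_two_add algebra_simps)
    qed
  qed
qed

section \<open>Generation in commutative groups\<close>

lemma (in group) generate_Un_generate:
  assumes "S \<subseteq> carrier G" "T \<subseteq> carrier G"
  shows "generate G (generate G S \<union> T) = generate G (S \<union> T)"
proof (rule equalityI)
  have "generate G S \<subseteq> generate G (S \<union> T)" by (rule mono_generate) auto
  moreover have "T \<subseteq> generate G (S \<union> T)" by (auto intro: generate.incl)
  ultimately show "generate G (generate G S \<union> T) \<subseteq> generate G (S \<union> T)"
    using assms by (intro generate_subgroup_incl generate_is_subgroup) auto
  show "generate G (S \<union> T) \<subseteq> generate G (generate G S \<union> T)"
    by (rule mono_generate) (auto intro: generate.incl)
qed

lemma (in group) subgroup_nat_pow_closed: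
  "subgroup H G \<Longrightarrow> h \<in> H \<Longrightarrow> h [^] (k::nat) \<in> H"
  using subgroup_int_pow_closed[of H h "int k"] by (simp add: int_pow_int)

lemma (in comm_group) generate_insert_powers:
  assumes H: "subgroup H G" and x: "x \<in> carrier G" and q: "0 < q" "x [^] (q::nat) \<in> H"
  shows "generate G (insert x H) = (\<lambda>(h,i). h \<otimes> x [^] (i::nat)) ` (H \<times> {..<q})"
proof
  interpret H: subgroup H G by fact
  let ?K = "(\<lambda>(h,i). h \<otimes> x [^] (i::nat)) ` (H \<times> {..<q})"
  have red: "h \<otimes> x [^] (i::nat) \<in> ?K" if h: "h \<in> H" for h i
  proof -
    have "x [^] i = x [^] (q * (i div q)) \<otimes> x [^] (i mod q)" using x by (simp add: nat_pow_mult)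
    also have "x [^] (q * (i div q)) = (x [^] q) [^] (i div q)" using x by (simp add: nat_pow_pow)
    finally have eq: "h \<otimes> x [^] i = (h \<otimes> (x [^] q) [^] (i div q)) \<otimes> x [^] (i mod q)"
      using h x by (simp add: m_assoc)
    have "(x [^] q) [^] (i div q) \<in> H" using subgroup_nat_pow_closed[OF H q(2)] .
    then have "h \<otimes> (x [^] q) [^] (i div q) \<in> H" using h by simp
    then show ?thesis unfolding eq using q(1) by (intro image_eqI[of _ _ "(_, i mod q)"]) auto
  qed
  have sub: "subgroup ?K G"
  proof (rule subgroupI)
    show "?K \<subseteq> carrier G" using x by auto
    show "?K \<noteq> {}" using q(1) H.one_closed by blast
    show "inv a \<in> ?K" if a: "a \<in> ?K" for a
    proof -
      obtain h i where h: "h \<in> H" "i < q" "a = h \<otimes> x [^] i" using a by auto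
      have "x [^] i \<otimes> x [^] (q - i) = x [^] q" using h(2) x by (simp add: nat_pow_mult)
      then have "inv (x [^] i) = inv (x [^] q) \<otimes> x [^] (q - i)"
        using x by (metis inv_solve_left' m_comm nat_pow_closed inv_closed m_closed)
      then have "inv a = (inv h \<otimes> inv (x [^] q)) \<otimes> x [^] (q - i)" using h x by (simp add: inv_mult m_assoc)
      moreover have "inv h \<otimes> inv (x [^] q) \<in> H" using h q by simp
      ultimately show ?thesis using red by metis
    qed
    show "a \<otimes> b \<in> ?K" if ab: "a \<in> ?K" "b \<in> ?K" for a b
    proof -
      obtain h i where h: "h \<in> H" "a = h \<otimes> x [^] (i::nat)" using ab by auto
      obtain k j where k: "k \<in> H" "b = k \<otimes> x [^] (j::nat)" using ab by auto
      have "a \<otimes> b = (h \<otimes> k) \<otimes> x [^] (i + j)" using h k x by (simp add: nat_pow_mult[symmetric] m_ac)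
      then show ?thesis using red[of "h \<otimes> k" "i + j"] h k by simp
    qed
  qed
  show "generate G (insert x H) \<subseteq> ?K"
  proof (rule generate_subgroup_incl[OF _ sub])
    have "h \<in> ?K" if "h \<in> H" for h using red[OF that, of 0] that by simp
    moreover have "x \<in> ?K" using red[of \<one> 1] x by simp
    ultimately show "insert x H \<subseteq> ?K" by blast
  qed
  have G: "subgroup (generate G (insert x H)) G" using x by (intro generate_is_subgroup) auto
  have "x [^] (i::nat) \<in> generate G (insert x H)" for i
  proof (induction i)
    case 0 show ?case by (simp add: generate.one)
  next
    case (Suc i) then show ?case by (simp add: generate.eng generate.incl)
  qed
  then show "?K \<subseteq> generate G (insert x H)" by (auto intro!: generate.eng intro: generate.incl)
qed

lemma (in comm_group) card_generate_insert_le: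
  assumes H: "subgroup H G" "finite H" and x: "x \<in> carrier G" and q: "0 < q" "x [^] (q::nat) \<in> H"
  shows "finite (generate G (insert x H)) \<and> card (generate G (insert x H)) \<le> q * card H"
proof -
  have "card ((\<lambda>(h,i). h \<otimes> x [^] (i::nat)) ` (H \<times> {..<q})) \<le> card (H \<times> {..<q})"
    using H by (intro card_image_le) auto
  then show ?thesis using generate_insert_powers[OF H(1) x q] H(2) by (simp add: mult.commute)
qed

text \<open>The order of \<open>x\<close> in the quotient by \<open>H\<close>, expressed through
  powers so that no quotient group is formed. The condition 0 < q excludes the exponent 0, whose
  power lies in every subgroup.\<close>

definition relative_order :: "('a, 'b) monoid_scheme \<Rightarrow> 'a set \<Rightarrow> 'a \<Rightarrow> nat" where
  "relative_order G H x = (LEAST q. 0 < q \<and> x [^]\<^bsub>G\<^esub> q \<in> H)"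

context comm_group
begin

context
  fixes H x and n :: nat
  assumes H: "subgroup H G" and x: "x \<in> carrier G" and n: "0 < n" "x [^] n \<in> H"
begin

lemma relative_order: "0 < relative_order G H x" "x [^] relative_order G H x \<in> H"
proof -
  have "0 < n \<and> x [^] n \<in> H" using n by blast
  then have "0 < relative_order G H x \<and> x [^] relative_order G H x \<in> H"
    unfolding relative_order_def by (rule LeastI)
  then show "0 < relative_order G H x" "x [^] relative_order G H x \<in> H" by auto
qed

lemma relative_order_le: "\<lbrakk>0 < q; x [^] (q::nat) \<in> H\<rbrakk> \<Longrightarrow> relative_order G H x \<le> q"
  unfolding relative_order_def by (rule Least_le) simp

lemma inj_on_mult_powers:
  "inj_on (\<lambda>(h,i). h \<otimes> x [^] (i::nat)) (H \<times> {..<relative_order G H x})"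
proof -
  interpret H: subgroup H G by (rule H)
  let ?q = "relative_order G H x"
  have False if "h \<in> H" "k \<in> H" "i < j" "j < ?q" "h \<otimes> x [^] i = k \<otimes> x [^] j" for h k and i j :: nat
  proof -
    have "x [^] j = x [^] (j - i) \<otimes> x [^] i" using that x by (simp add: nat_pow_mult)
    then have "h \<otimes> x [^] i = (k \<otimes> x [^] (j - i)) \<otimes> x [^] i" using that x by (simp add: m_assoc)
    then have "h = k \<otimes> x [^] (j - i)"
      using right_cancel[of "x [^] i" h "k \<otimes> x [^] (j - i)"] that(1,2) x by simp
    moreover have "inv k \<otimes> (k \<otimes> x [^] (j - i)) = x [^] (j - i)"
      using that(2) x by (simp add: m_assoc[symmetric])
    ultimately have "x [^] (j - i) = inv k \<otimes> h" by simp
    then have "x [^] (j - i) \<in> H" using that(1,2) by simp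
    then have "?q \<le> j - i" using that by (intro relative_order_le) auto
    then show False using that by linarith
  qed
  note no = this
  show ?thesis
  proof (rule inj_onI, clarsimp)
    fix h i k j assume *: "h \<in> H" "i < ?q" "k \<in> H" "j < ?q" "h \<otimes> x [^] i = k \<otimes> x [^] (j::nat)"
    have "\<not> i < j" "\<not> j < i" using no[of h k i j] no[of k h j i] * by auto
    then have "i = j" by simp
    moreover have "h = k" using right_cancel[of "x [^] i" h k] *(5)[folded \<open>i = j\<close>] *(1,3) x by simp
    ultimately show "h = k \<and> i = j" by simp
  qed
qed

lemma card_generate_insert: "card (generate G (insert x H)) = relative_order G H x * card H"
  using generate_insert_powers[OF H x relative_order] inj_on_mult_powers
  by (simp add: card_image card_cartesian_product mult.commute)

end

lemma pow_order_in_subgroup: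
  assumes "finite (carrier G)" "subgroup H G" "x \<in> carrier G"
  shows "0 < order G" "x [^] order G \<in> H"
  using assms pow_order_eq_1 order_gt_0_iff_finite subgroup.one_closed by simp_all

lemma relative_order_antimono:
  assumes "finite (carrier G)" "subgroup H G" "subgroup K G" "H \<subseteq> K" "x \<in> carrier G"
  shows "relative_order G K x \<le> relative_order G H x"
  using assms relative_order[OF assms(2,5) pow_order_in_subgroup[OF assms(1,2,5)]]
  by (intro relative_order_le[OF assms(3,5) pow_order_in_subgroup[OF assms(1,3,5)]]) auto

text \<open>Building up \<open>S\<close> one element at a time multiplies the order by the relative
  order over the elements already present. That is at least the relative order over all the others,
  since enlarging the subgroup lowers relative orders.\<close>

lemma prod_relative_order_le:
  assumes fin: "finite (carrier G)" and S: "finite S" "S \<subseteq> carrier G"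
  shows "(\<Prod>x\<in>S. relative_order G (generate G (S - {x})) x) \<le> card (generate G S)"
proof -
  have "(\<Prod>x\<in>T. relative_order G (generate G (S - {x})) x) \<le> card (generate G T)"
    if "finite T" "T \<subseteq> S" for T using that
  proof (induction T rule: finite_induct)
    case empty
    then show ?case by (simp add: generate_empty)
  next
    case (insert x T)
    have sub: "subgroup (generate G T) G" "subgroup (generate G (S - {x})) G"
      using insert.prems S by (auto intro!: generate_is_subgroup)
    have x: "x \<in> carrier G" using insert.prems S by blast
    have T: "T \<subseteq> carrier G" using insert.prems S by blast
    have "generate G T \<subseteq> generate G (S - {x})" using insert by (intro mono_generate) auto
    then have "relative_order G (generate G (S - {x})) x \<le> relative_order G (generate G T) x"
      using relative_order_antimono fin sub x by blast
    moreover have "(\<Prod>x\<in>T. relative_order G (generate G (S - {x})) x) \<le> card (generate G T)"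
      using insert by auto
    moreover have "card (generate G (insert x T)) = relative_order G (generate G T) x * card (generate G T)"
      using card_generate_insert[OF sub(1) x pow_order_in_subgroup[OF fin sub(1) x]] generate_Un_generate[OF T, of "{x}"] x by simp
    ultimately show ?case using insert by (simp add: mult_le_mono)
  qed
  from this[OF S(1)] show ?thesis by simp
qed

lemma card_generate_Un_le:
  assumes H: "subgroup H G" "finite H" and q: "0 < q"
    and F: "finite F" "F \<subseteq> carrier G" "\<And>c. c \<in> F \<Longrightarrow> c [^] (q::nat) \<in> H"
  shows "finite (generate G (H \<union> F)) \<and> card (generate G (H \<union> F)) \<le> q ^ card F * card H" using F
proof (induction F rule: finite_induct)
  case empty
  have "generate G H = H" using generate_subgroup_incl[OF subset_refl H(1)] by (auto intro: generate.incl)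
  then show ?case using H by simp
next
  case (insert c F)
  have HF: "H \<union> F \<subseteq> carrier G" using H insert subgroup.subset by fastforce
  have IH: "finite (generate G (H \<union> F))" "card (generate G (H \<union> F)) \<le> q ^ card F * card H"
    using insert by auto
  have "c [^] q \<in> generate G (H \<union> F)" using insert.prems by (intro generate.incl) auto
  then have "finite (generate G (insert c (generate G (H \<union> F)))) \<and>
      card (generate G (insert c (generate G (H \<union> F)))) \<le> q * card (generate G (H \<union> F))"
    using insert.prems q IH HF by (intro card_generate_insert_le generate_is_subgroup) auto
  moreover have "generate G (insert c (generate G (H \<union> F))) = generate G (H \<union> insert c F)"
    using generate_Un_generate[OF HF, of "{c}"] insert.prems by simp
  ultimately show ?case using IH insert.hyps by (auto intro: order_trans)
qed

end

text \<open>Induction on the number of generators: the one removed has the smallest relative order \<open>q\<close> over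
  the others, so that \<open>q\<close> to the power \<open>|S|\<close> is at most the order of the group generated by \<open>S\<close>.\<close>
lemma alternating_map_bound:
  fixes B :: "('a, 'c) monoid_scheme" and C :: "('b, 'd) monoid_scheme"
  assumes B: "comm_group B" "finite (carrier B)" and C: "comm_group C"
    and cl: "\<And>x y. \<lbrakk>x \<in> carrier B; y \<in> carrier B\<rbrakk> \<Longrightarrow> \<beta> x y \<in> carrier C"
    and lin: "\<And>x y z. \<lbrakk>x \<in> carrier B; y \<in> carrier B; z \<in> carrier B\<rbrakk> \<Longrightarrow>
        \<beta> z (x \<otimes>\<^bsub>B\<^esub> y) = \<beta> z x \<otimes>\<^bsub>C\<^esub> \<beta> z y"
    and alt: "\<And>x. x \<in> carrier B \<Longrightarrow> \<beta> x x = \<one>\<^bsub>C\<^esub>"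
    and skew: "\<And>x y. \<lbrakk>x \<in> carrier B; y \<in> carrier B\<rbrakk> \<Longrightarrow> \<beta> y x = inv\<^bsub>C\<^esub> (\<beta> x y)"
    and S: "finite S" "S \<subseteq> carrier B"
  shows "finite (generate C {\<beta> x y | x y. x \<in> S \<and> y \<in> S}) \<and>
    card (generate C {\<beta> x y | x y. x \<in> S \<and> y \<in> S}) ^ 2 \<le> card (generate B S) ^ (card S - 1)" using S
proof (induction "card S" arbitrary: S)
  case 0
  interpret C: comm_group C by fact
  from 0 show ?case by (simp add: C.generate_empty)
next
  case (Suc d)
  interpret B: comm_group B by fact
  interpret C: comm_group C by fact
  define q where "q x = relative_order B (generate B (S - {x})) x" for x
  have Sne: "S \<noteq> {}" using Suc by auto
  obtain x where x: "x \<in> S" and xmin: "\<And>y. y \<in> S \<Longrightarrow> q x \<le> q y"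
    using ex_is_arg_min_if_finite[OF Suc.prems(1) Sne, of q] unfolding is_arg_min_linorder by blast
  let ?S = "S - {x}"
  have subB: "subgroup (generate B ?S) B" using Suc.prems by (intro B.generate_is_subgroup) auto
  have xB: "x \<in> carrier B" using x Suc.prems by blast
  have SB: "?S \<subseteq> carrier B" using Suc.prems by blast
  have qx: "0 < q x" "x [^]\<^bsub>B\<^esub> q x \<in> generate B ?S"
    unfolding q_def using B.relative_order[OF subB xB B.pow_order_in_subgroup[OF B(2) subB xB]] by auto
  have cS: "card (generate B S) = q x * card (generate B ?S)"
    using B.card_generate_insert[OF subB xB B.pow_order_in_subgroup[OF B(2) subB xB]] B.generate_Un_generate[OF SB, of "{x}"] x xB
    by (simp add: q_def insert_absorb)
  have "q x ^ card S = (\<Prod>y\<in>S. q x)" by simp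
  also have "\<dots> \<le> (\<Prod>y\<in>S. q y)" using xmin by (intro prod_mono) auto
  also have "\<dots> \<le> card (generate B S)"
    unfolding q_def using Suc.prems B by (intro B.prod_relative_order_le) auto
  finally have qd: "q x ^ Suc d \<le> card (generate B S)" using Suc.hyps by simp
  let ?X = "{\<beta> y z | y z. y \<in> ?S \<and> z \<in> ?S}"
  have cd: "d = card ?S" using Suc.hyps x Suc.prems by simp
  have IH: "finite (generate C ?X)" "card (generate C ?X) ^ 2 \<le> card (generate B ?S) ^ (d - 1)"
    using Suc.hyps(1)[OF cd] Suc.prems cd by auto
  have X: "?X \<subseteq> carrier C" using cl SB by blast
  have subC: "subgroup (generate C ?X) C" using X by (rule C.generate_is_subgroup)
  define F where "F = (\<lambda>y. \<beta> y x) ` ?S"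
  have F: "finite F" "F \<subseteq> carrier C" "card F \<le> d"
    using cl SB xB Suc.prems cd card_image_le[of ?S "\<lambda>y. \<beta> y x"] by (auto simp: F_def)
  have hom: "\<beta> y \<in> hom B C" if "y \<in> carrier B" for y using that cl lin by (auto simp: hom_def)
  \<comment> \<open>\<open>\<beta> y\<close> is a homomorphism, so this power of
    \<open>\<beta> y x\<close> is the value of \<open>\<beta> y\<close> at a power of
    \<open>x\<close> that the other generators already produce.\<close>
  have Fq: "c [^]\<^bsub>C\<^esub> q x \<in> generate C ?X" if "c \<in> F" for c
  proof -
    obtain y where y: "y \<in> ?S" "c = \<beta> y x" using \<open>c \<in> F\<close> by (auto simp: F_def)
    interpret b: group_hom B C "\<beta> y" using hom y SB by unfold_locales auto
    have "c [^]\<^bsub>C\<^esub> q x = \<beta> y (x [^]\<^bsub>B\<^esub> q x)" using y xB by (simp add: b.hom_nat_pow)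
    also have "\<dots> \<in> \<beta> y ` generate B ?S" using qx by blast
    also have "\<dots> = generate C (\<beta> y ` ?S)" using SB by (simp add: b.generate_img)
    also have "\<dots> \<subseteq> generate C ?X" using y by (intro C.mono_generate) blast
    finally show ?thesis .
  qed
  have big: "finite (generate C (generate C ?X \<union> F))"
     "card (generate C (generate C ?X \<union> F)) \<le> q x ^ card F * card (generate C ?X)"
    using C.card_generate_Un_le[OF subC IH(1) qx(1) F(1,2) Fq] by auto
  have incl: "generate C {\<beta> y z | y z. y \<in> S \<and> z \<in> S} \<subseteq> generate C (generate C ?X \<union> F)"
  proof (rule C.generate_subgroup_incl)
    show "subgroup (generate C (generate C ?X \<union> F)) C"
      using F X by (intro C.generate_is_subgroup) (auto dest: C.generate_in_carrier[rotated])
    show "{\<beta> y z | y z. y \<in> S \<and> z \<in> S} \<subseteq> generate C (generate C ?X \<union> F)"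
    proof clarify
      fix y z assume yz: "y \<in> S" "z \<in> S"
      consider "y \<noteq> x" "z \<noteq> x" | "y = x" "z = x" | "y \<noteq> x" "z = x" | "y = x" "z \<noteq> x" by blast
      then show "\<beta> y z \<in> generate C (generate C ?X \<union> F)"
      proof cases
        case 1 then show ?thesis using yz by (intro generate.incl UnI1 generate.incl) blast
      next
        case 2 then show ?thesis using alt xB by (simp add: generate.one)
      next
        case 3 then show ?thesis using yz by (intro generate.incl UnI2) (auto simp: F_def)
      next
        case 4
        then have "\<beta> y z = inv\<^bsub>C\<^esub> (\<beta> z x)" using skew[of z x] yz Suc.prems by auto
        then show ?thesis using yz 4 by (auto simp: F_def intro!: generate.inv)
      qed
    qed
  qed
  let ?c = "card (generate C {\<beta> y z | y z. y \<in> S \<and> z \<in> S})"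
  have "?c \<le> q x ^ card F * card (generate C ?X)" using card_mono[OF big(1) incl] big(2) by linarith
  also have "\<dots> \<le> q x ^ d * card (generate C ?X)"
    using F(3) qx(1) by (intro mult_le_mono1 power_increasing) auto
  finally have "?c ^ 2 \<le> (q x ^ d * card (generate C ?X)) ^ 2" by (rule power_mono) simp
  also have "\<dots> \<le> (q x ^ d) ^ 2 * card (generate B ?S) ^ (d - 1)" using IH(2) by (simp add: power_mult_distrib)
  \<comment> \<open>With \<open>m\<close> the order of the group generated by the other generators,
    q^(2d) m^(d-1) = (q m)^(d-1) q^(d+1), and the last factor is at most q m by the minimality of
    \<open>q x\<close>. For d = 0 both sides are 1.\<close>
  also have "\<dots> \<le> card (generate B S) ^ d"
  proof (cases d)
    case (Suc k)
    have "(q x ^ d) ^ 2 * card (generate B ?S) ^ (d - 1) = card (generate B S) ^ k * q x ^ Suc d"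
      unfolding cS Suc by (simp add: power_mult_distrib power2_eq_square power_add[symmetric] ac_simps)
    also have "\<dots> \<le> card (generate B S) ^ k * card (generate B S)" using qd by (rule mult_le_mono2)
    also have "\<dots> = card (generate B S) ^ d" using Suc by simp
    finally show ?thesis .
  qed simp
  finally show ?case using Suc.hyps(2)[symmetric] finite_subset[OF incl big(1)] by simp
qed

section \<open>Counting Jacobi elements\<close>

text \<open>The first isomorphism theorem with the codomain cut down to the image, followed by
  Lagrange. It covers infinite groups, whose \<open>card\<close> is 0, and so can later serve to
  derive finiteness.\<close>

lemma (in group_hom) card_eq_image_times_kernel:
  "card (carrier G) = card (h ` carrier G) * card (kernel G H h)"
proof -
  let ?H = "H\<lparr>carrier := h ` carrier G\<rparr>"
  have k: "kernel G ?H h = kernel G H h" by (simp add: kernel_def)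
  interpret H': group ?H by (rule H.subgroup_imp_group[OF img_is_subgroup])
  have "h \<in> hom G ?H" by (rule homI) simp_all
  then have "group_hom G ?H h"
    using G.is_group H'.is_group unfolding group_hom_def group_hom_axioms_def by blast
  then interpret h': group_hom G ?H h .
  have "bij_betw (\<lambda>Y. the_elem (h ` Y)) (carrier (G Mod kernel G H h)) (h ` carrier G)"
    using h'.FactGroup_iso_set unfolding k by (auto simp: iso_def)
  then have "card (rcosets kernel G H h) = card (h ` carrier G)"
    by (simp add: bij_betw_same_card FactGroup_def)
  then show ?thesis using G.lagrange[OF subgroup_kernel] by (simp add: order_def)
qed

text \<open>Every new element strictly enlarges the subgroup generated so far. Subgroup orders are
  powers of \<open>p\<close>, so each enlargement is by a factor of at least
  \<open>p\<close>.\<close>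

lemma (in group) card_generate_chain:
  assumes fin: "finite (carrier G)" and ord: "card (carrier G) = p ^ m" and p: "Factorial_Ring.prime p"
    and I: "finite I" "J ` I \<subseteq> carrier G" and inj: "inj_on \<kappa> I"
    and new: "\<And>i. i \<in> I \<Longrightarrow> J i \<notin> generate G (J ` {j \<in> I. \<kappa> j < (\<kappa> i :: nat)})"
  shows "p ^ card I \<le> card (generate G (J ` I))" using I inj new
proof (induction rule: finite_ranking_induct[where f = \<kappa>])
  case empty
  then show ?case by (simp add: generate_empty)
next
  case (insert i I)
  show ?case
  proof (cases "i \<in> I")
    case True
    then show ?thesis using insert by (simp add: insert_absorb)
  next
    case False
    let ?H = "generate G (J ` I)" and ?K = "generate G (J ` insert i I)"
    have less: "\<kappa> j < \<kappa> i" if "j \<in> I" for j using insert.hyps(2)[OF that] insert.prems(2) that False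
      by (metis inj_on_eq_iff insert_iff order_le_neq_trans)
    have "{j \<in> insert i I. \<kappa> j < \<kappa> i} = I" using less by auto
    then have notin: "J i \<notin> ?H" using insert.prems(3)[of i] by simp
    have IH: "p ^ card I \<le> card ?H"
    proof (rule insert.IH)
      show "J k \<notin> generate G (J ` {j \<in> I. \<kappa> j < \<kappa> k})" if "k \<in> I" for k
      proof -
        have "{j \<in> insert i I. \<kappa> j < \<kappa> k} = {j \<in> I. \<kappa> j < \<kappa> k}" using less[OF that] by auto
        then show ?thesis using insert.prems(3)[of k] that by simp
      qed
    qed (use insert.prems in \<open>auto simp: inj_on_def\<close>)
    have sub: "subgroup ?H G" "subgroup ?K G" using insert.prems by (auto intro!: generate_is_subgroup)
    have "card ?H dvd p ^ m" "card ?K dvd p ^ m"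
      using lagrange[OF sub(1)] lagrange[OF sub(2)] ord unfolding order_def by (metis dvd_triv_right)+
    then obtain a b where ab: "card ?H = p ^ a" "card ?K = p ^ b" using divides_primepow_nat[OF p] by meson
    have "?H \<subseteq> ?K" by (rule mono_generate) auto
    moreover have "J i \<in> ?K" by (intro generate.incl) auto
    ultimately have "?H \<subset> ?K" using notin by blast
    moreover have "finite ?K" using sub fin by (meson finite_subset subgroup.subset)
    ultimately have "card ?H < card ?K" using psubset_card_mono by blast
    then have "a < b" using ab prime_gt_1_nat[OF p] by simp
    then have "p ^ Suc a \<le> p ^ b" using prime_gt_0_nat[OF p] by (intro power_increasing) auto
    then have "p * card ?H \<le> card ?K" using ab by simp
    moreover have "p * p ^ card I \<le> p * card ?H" using IH by simp
    ultimately have "p * p ^ card I \<le> card ?K" by linarith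
    then show ?thesis using insert.hyps False by simp
  qed
qed

lemma card_3_sorted:
  fixes T :: "nat set"
  assumes "card T = 3" obtains i j k where "i < j" "j < k" "T = {i,j,k}"
proof -
  obtain a b c where T: "T = {a,b,c}" "a \<noteq> b" "a \<noteq> c" "b \<noteq> c" using assms by (auto simp: card_3_iff)
  then show ?thesis using that by (metis (no_types, lifting) insert_commute linorder_neqE_nat)
qed

text \<open>The homomorphisms assemble to a single one on a direct power of \<open>U\<close>. Its
  image contains that of each \<open>b j\<close>, by tuples supported at one coordinate, and
  therefore all that these images generate.\<close>

lemma hom_product_group_finprod:
  fixes U :: "('a, 'c) monoid_scheme" and C :: "('b, 'd) monoid_scheme"
  assumes U: "comm_group U" and C: "comm_group C"
    and b: "\<And>j. j < (\<delta>::nat) \<Longrightarrow> b j \<in> hom U C"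
    and genC: "generate C (\<Union>j<\<delta>. b j ` carrier U) = carrier C"
  defines "D \<equiv> product_group {..<\<delta>} (\<lambda>_. U)" and "\<Phi> \<equiv> (\<lambda>f. finprod C (\<lambda>j. b j (f j)) {..<\<delta>})"
  shows "group_hom D C \<Phi>" "\<Phi> ` carrier D = carrier C"
proof -
  interpret U: comm_group U by fact
  interpret C: comm_group C by fact
  interpret D: group D unfolding D_def by (rule product_group) (rule U.is_group)
  have carD: "carrier D = {..<\<delta>} \<rightarrow>\<^sub>E carrier U" by (simp add: D_def)
  have multD: "f \<otimes>\<^bsub>D\<^esub> g = (\<lambda>i\<in>{..<\<delta>}. f i \<otimes>\<^bsub>U\<^esub> g i)" for f g by (simp add: D_def)
  have bcl: "b j x \<in> carrier C" if "j < \<delta>" "x \<in> carrier U" for j x using b that by (auto simp: hom_def)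
  have "\<Phi> \<in> hom D C"
  proof (rule homI)
    fix f g assume f: "f \<in> carrier D" and g: "g \<in> carrier D"
    show "\<Phi> f \<in> carrier C" unfolding \<Phi>_def using f bcl by (intro C.finprod_closed) (auto simp: carD)
    have "\<Phi> (f \<otimes>\<^bsub>D\<^esub> g) = finprod C (\<lambda>j. b j (f j) \<otimes>\<^bsub>C\<^esub> b j (g j)) {..<\<delta>}" unfolding \<Phi>_def
    proof (rule C.finprod_cong')
      show "(\<lambda>j. b j (f j) \<otimes>\<^bsub>C\<^esub> b j (g j)) \<in> {..<\<delta>} \<rightarrow> carrier C"
        using f g unfolding carD by (intro Pi_I C.m_closed bcl) (auto dest: PiE_mem)
      show "b j ((f \<otimes>\<^bsub>D\<^esub> g) j) = b j (f j) \<otimes>\<^bsub>C\<^esub> b j (g j)" if "j \<in> {..<\<delta>}" for j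
        using that f g hom_mult[OF b, of j "f j" "g j"] by (auto simp: multD carD)
    qed simp
    also have "\<dots> = \<Phi> f \<otimes>\<^bsub>C\<^esub> \<Phi> g" unfolding \<Phi>_def using f g bcl by (intro C.finprod_multf) (auto simp: carD)
    finally show "\<Phi> (f \<otimes>\<^bsub>D\<^esub> g) = \<Phi> f \<otimes>\<^bsub>C\<^esub> \<Phi> g" .
  qed
  then show hom: "group_hom D C \<Phi>" by unfold_locales
  interpret \<Phi>: group_hom D C \<Phi> by (rule hom)
  have b1: "b j \<one>\<^bsub>U\<^esub> = \<one>\<^bsub>C\<^esub>" if "j < \<delta>" for j using hom_one[OF b[OF that]] U.is_group C.is_group by blast
  show "\<Phi> ` carrier D = carrier C"
  proof
    show "\<Phi> ` carrier D \<subseteq> carrier C" by auto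
    have "(\<Union>j<\<delta>. b j ` carrier U) \<subseteq> \<Phi> ` carrier D"
    proof clarify
      fix j x assume jx: "j < \<delta>" "x \<in> carrier U"
      define f where "f = (\<lambda>i\<in>{..<\<delta>}. if i = j then x else \<one>\<^bsub>U\<^esub>)"
      have f: "f \<in> carrier D" using jx by (auto simp: carD f_def)
      have "\<Phi> f = finprod C (\<lambda>i. if j = i then b i x else \<one>\<^bsub>C\<^esub>) {..<\<delta>}"
        unfolding \<Phi>_def using jx bcl by (intro C.finprod_cong') (auto simp: f_def b1)
      also have "\<dots> = b j x" using jx bcl by (intro C.finprod_singleton) auto
      finally show "b j x \<in> \<Phi> ` carrier D" using f by (metis image_eqI)
    qed
    then have "generate C (\<Union>j<\<delta>. b j ` carrier U) \<subseteq> \<Phi> ` carrier D"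
      using \<Phi>.img_is_subgroup by (intro C.generate_subgroup_incl)
    then show "carrier C \<subseteq> \<Phi> ` carrier D" using genC by simp
  qed
qed

lemma card_generated_by_homs_le:
  fixes U :: "('a, 'c) monoid_scheme" and C :: "('b, 'd) monoid_scheme"
  assumes U: "comm_group U" "finite (carrier U)" and C: "comm_group C"
    and b: "\<And>j. j < (\<delta>::nat) \<Longrightarrow> b j \<in> hom U C"
    and genC: "generate C (\<Union>j<\<delta>. b j ` carrier U) = carrier C"
  shows "finite (carrier C) \<and> card (carrier C) \<le> card (carrier U) ^ \<delta>"
proof -
  have "finite ({..<\<delta>} \<rightarrow>\<^sub>E carrier U)" "card ({..<\<delta>} \<rightarrow>\<^sub>E carrier U) = card (carrier U) ^ \<delta>"
    using U(2) by (simp_all add: finite_PiE card_PiE)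
  moreover have "(\<lambda>f. finprod C (\<lambda>j. b j (f j)) {..<\<delta>}) ` ({..<\<delta>} \<rightarrow>\<^sub>E carrier U) = carrier C"
    using hom_product_group_finprod(2)[OF U(1) C b genC] by simp
  ultimately show ?thesis
    using card_image_le[of "{..<\<delta>} \<rightarrow>\<^sub>E carrier U" "\<lambda>f. finprod C (\<lambda>j. b j (f j)) {..<\<delta>}"]
      finite_imageI[of "{..<\<delta>} \<rightarrow>\<^sub>E carrier U" "\<lambda>f. finprod C (\<lambda>j. b j (f j)) {..<\<delta>}"] by simp
qed

text \<open>The kernel of the map \<open>U\<^sup>\<delta> \<rightarrow> C\<close> given by the \<open>b j\<close> contains a Jacobi element for each triple.
  Ordering finite sets by their binary encoding is compatible with deleting a common vertex. Hence,
  if some edge \<open>e\<close> of a triple is not generated by the smaller edges, then the coordinate at the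
  vertex opposite to \<open>e\<close> shows that the Jacobi element is not generated by the smaller ones.
  The other triples are the triangles of a graph with few edges.\<close>
lemma jacobi_bound:
  fixes U :: "('a, 'c) monoid_scheme" and C :: "('b, 'd) monoid_scheme"
  assumes U: "comm_group U" "finite (carrier U)" and cardU: "card (carrier U) = p ^ m"
    and p: "Factorial_Ring.prime p" and C: "comm_group C"
    and b: "\<And>j. j < \<delta> \<Longrightarrow> b j \<in> hom U C"
    and genC: "generate C (\<Union>j<\<delta>. b j ` carrier U) = carrier C"
    and u: "\<And>e. \<lbrakk>e \<subseteq> {..<\<delta>}; card e = 2\<rbrakk> \<Longrightarrow> u e \<in> carrier U"
    and genU: "generate U (u ` {e. e \<subseteq> {..<\<delta>} \<and> card e = 2}) = carrier U"
    and jac: "\<And>i j k. \<lbrakk>i < j; j < k; k < \<delta>\<rbrakk> \<Longrightarrow>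
        b k (u {i,j}) \<otimes>\<^bsub>C\<^esub> b i (u {j,k}) \<otimes>\<^bsub>C\<^esub> inv\<^bsub>C\<^esub> (b j (u {i,k})) = \<one>\<^bsub>C\<^esub>"
    and rt: "\<delta> choose 2 \<le> min_gens U + (r choose 2) + t" "t < r"
  shows "finite (carrier C) \<and>
    card (carrier C) * p ^ (\<delta> choose 3) \<le> card (carrier U) ^ \<delta> * p ^ ((r choose 3) + (t choose 2))"
proof -
  interpret U: comm_group U by fact
  interpret C: comm_group C by fact
  define D where "D = product_group {..<\<delta>} (\<lambda>_. U)"
  interpret D: group D unfolding D_def by (rule product_group) (rule U.is_group)
  have carD: "carrier D = {..<\<delta>} \<rightarrow>\<^sub>E carrier U" by (simp add: D_def)
  have multD: "f \<otimes>\<^bsub>D\<^esub> g = (\<lambda>i\<in>{..<\<delta>}. f i \<otimes>\<^bsub>U\<^esub> g i)" for f g by (simp add: D_def)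
  have oneD: "\<one>\<^bsub>D\<^esub> = (\<lambda>i\<in>{..<\<delta>}. \<one>\<^bsub>U\<^esub>)" by (simp add: D_def)
  have invD: "inv\<^bsub>D\<^esub> f = (\<lambda>i\<in>{..<\<delta>}. inv\<^bsub>U\<^esub> f i)" if "f \<in> carrier D" for f
    using that unfolding D_def by (subst inv_product_group) auto
  have finD: "finite (carrier D)" using U(2) by (simp add: carD finite_PiE)
  have cardD: "card (carrier D) = card (carrier U) ^ \<delta>" by (simp add: carD card_PiE)
  have bcl: "b j x \<in> carrier C" if "j < \<delta>" "x \<in> carrier U" for j x using b that by (auto simp: hom_def)
  define \<Phi> where "\<Phi> = (\<lambda>f. finprod C (\<lambda>j. b j (f j)) {..<\<delta>})"
  interpret \<Phi>: group_hom D C \<Phi> unfolding D_def \<Phi>_def using U(1) C b genC by (rule hom_product_group_finprod)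
  have surj: "\<Phi> ` carrier D = carrier C"
    unfolding D_def \<Phi>_def using U(1) C b genC by (rule hom_product_group_finprod)
  have b1: "b j \<one>\<^bsub>U\<^esub> = \<one>\<^bsub>C\<^esub>" if "j < \<delta>" for j using hom_one[OF b[OF that]] U.is_group C.is_group by blast
  have finC: "finite (carrier C)" using surj finD by (metis finite_imageI)
  define ker where "ker = kernel D C \<Phi>"
  have cardC: "card (carrier U) ^ \<delta> = card (carrier C) * card ker"
    using \<Phi>.card_eq_image_times_kernel surj cardD by (simp add: ker_def)
  define E where "E = {e. e \<subseteq> {..<\<delta>} \<and> card e = 2}"
  have finE: "finite E" by (simp add: E_def)
  \<comment> \<open>A greedy choice in the binary order: an edge is kept if the smaller edges do not
    generate its value. The kept edges still generate \<open>U\<close>, so there are at least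
    \<open>min_gens U\<close> of them.\<close>
  define P where "P = {e \<in> E. u e \<notin> generate U (u ` {f \<in> E. set_encode f < set_encode e})}"
  have finP: "finite P" using finE by (simp add: P_def)
  have uE: "u ` E \<subseteq> carrier U" using u by (auto simp: E_def)
  have inP: "u e \<in> generate U (u ` P)" if "e \<in> E" for e using that
  proof (induction "set_encode e" arbitrary: e rule: less_induct)
    case less
    show ?case
    proof (cases "e \<in> P")
      case True
      then show ?thesis by (intro generate.incl) auto
    next
      case False
      then have "u e \<in> generate U (u ` {f \<in> E. set_encode f < set_encode e})"
        using less.prems by (simp add: P_def)
      moreover have "generate U (u ` {f \<in> E. set_encode f < set_encode e}) \<subseteq> generate U (u ` P)"
        using less.hyps uE by (intro U.generate_subgroup_incl U.generate_is_subgroup) (auto simp: P_def)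
      ultimately show ?thesis by blast
    qed
  qed
  have "generate U (u ` P) = carrier U"
  proof
    show "generate U (u ` P) \<subseteq> carrier U" using uE by (intro U.generate_incl) (auto simp: P_def)
    have "generate U (u ` E) \<subseteq> generate U (u ` P)"
      using inP uE by (intro U.generate_subgroup_incl U.generate_is_subgroup) (auto simp: P_def)
    then show "carrier U \<subseteq> generate U (u ` P)" using genU by (simp add: E_def)
  qed
  then have "min_gens U \<le> card (u ` P)"
    unfolding min_gens_def using uE finP by (intro Least_le exI[of _ "u ` P"]) (auto simp: P_def)
  also have "\<dots> \<le> card P" using finP by (rule card_image_le)
  finally have cardP: "min_gens U \<le> card P" .
  have cardE: "card E = \<delta> choose 2" unfolding E_def by (subst n_subsets) auto
  define N where "N = E - P"
  have "card N = card E - card P" unfolding N_def using finP by (intro card_Diff_subset) (auto simp: P_def)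
  then have cardN: "card N \<le> (r choose 2) + t" using cardE cardP rt(1) by linarith
  have tri: "card (triangles N) \<le> (r choose 3) + (t choose 2)"
    using finE cardN rt(2) by (intro card_triangles_le) (auto simp: N_def E_def)
  have fintri: "finite (triangles N)" using finE by (intro finite_triangles) (auto simp: N_def E_def)
  define I where "I = {T. T \<subseteq> {..<\<delta>} \<and> card T = 3} - triangles N"
  have fin3: "finite {T. T \<subseteq> {..<\<delta>} \<and> card T = 3}" by simp
  have finI: "finite I" by (simp add: I_def)
  have "card {T. T \<subseteq> {..<\<delta>} \<and> card T = 3} \<le> card (I \<union> triangles N)"
    using finI fintri by (intro card_mono) (auto simp: I_def)
  also have "\<dots> \<le> card I + card (triangles N)" by (rule card_Un_le)
  finally have cardI: "\<delta> choose 3 \<le> card I + ((r choose 3) + (t choose 2))"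
    using tri n_subsets[of "{..<\<delta>}" 3] by simp
  \<comment> \<open>The coordinate of the Jacobi element at a vertex holds the value of the opposite
    edge. The middle vertex takes the inverse, matching the sign pattern in
    \<open>jac\<close>.\<close>
  define J where "J T = (\<lambda>v\<in>{..<\<delta>}. if v \<notin> T then \<one>\<^bsub>U\<^esub>
      else if v = Min T \<or> v = Max T then u (T - {v}) else inv\<^bsub>U\<^esub> (u (T - {v})))" for T
  have uT: "u (T - {v}) \<in> carrier U" if "T \<in> I" "v \<in> T" for T v
  proof -
    have "card (T - {v}) = 2" "T - {v} \<subseteq> {..<\<delta>}" using that by (auto simp: I_def)
    then show ?thesis by (intro u)
  qed
  have Jcl: "J T \<in> carrier D" if "T \<in> I" for T using uT[OF that] by (auto simp: J_def carD)
  have Jker: "\<Phi> (J T) = \<one>\<^bsub>C\<^esub>" if TI: "T \<in> I" for T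
  proof -
    obtain i j k where T: "i < j" "j < k" "T = {i,j,k}" using card_3_sorted[of T] TI unfolding I_def by blast
    have k: "k < \<delta>" using TI T by (auto simp: I_def)
    have pairs: "T - {i} = {j,k}" "T - {j} = {i,k}" "T - {k} = {i,j}" using T by auto
    have cl: "u {j,k} \<in> carrier U" "u {i,k} \<in> carrier U" "u {i,j} \<in> carrier U"
      using uT[OF that, of i] uT[OF that, of j] uT[OF that, of k] pairs T by auto
    have mm: "Min T = i" "Max T = k" using T by auto
    have J: "J T i = u {j,k}" "J T j = inv\<^bsub>U\<^esub> (u {i,k})" "J T k = u {i,j}"
      using T k mm pairs by (auto simp: J_def)
    have bj: "b j (inv\<^bsub>U\<^esub> (u {i,k})) = inv\<^bsub>C\<^esub> (b j (u {i,k}))"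
      using group_hom.hom_inv[of U C "b j" "u {i,k}"] b[of j] T k cl
      by (simp add: group_hom_def group_hom_axioms_def)
    have cl': "b k (u {i,j}) \<in> carrier C" "b i (u {j,k}) \<in> carrier C" "b j (u {i,k}) \<in> carrier C"
      using bcl cl T k by auto
    have "\<Phi> (J T) = finprod C (\<lambda>v. b v (J T v)) T" unfolding \<Phi>_def
    proof (rule C.finprod_mono_neutral_cong_right)
      show "T \<subseteq> {..<\<delta>}" using that by (auto simp: I_def)
      show "b v (J T v) = \<one>\<^bsub>C\<^esub>" if "v \<in> {..<\<delta>} - T" for v using that b1 by (simp add: J_def)
      show "(\<lambda>v. b v (J T v)) \<in> {..<\<delta>} \<rightarrow> carrier C" using Jcl[OF that] bcl by (auto simp: carD)
    qed auto
    also have "\<dots> = finprod C (\<lambda>v. b v (J T v)) {i,j,k}" by (simp only: T(3)[symmetric])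
    also have "\<dots> = b i (u {j,k}) \<otimes>\<^bsub>C\<^esub> (inv\<^bsub>C\<^esub> (b j (u {i,k})) \<otimes>\<^bsub>C\<^esub> b k (u {i,j}))"
      using T(1,2) cl' by (simp add: J bj)
    also have "\<dots> = b k (u {i,j}) \<otimes>\<^bsub>C\<^esub> b i (u {j,k}) \<otimes>\<^bsub>C\<^esub> inv\<^bsub>C\<^esub> (b j (u {i,k}))"
      using cl' by (simp add: C.m_ac)
    also have "\<dots> = \<one>\<^bsub>C\<^esub>" using jac T k by blast
    finally show ?thesis .
  qed
  have new: "J T \<notin> generate D (J ` {T' \<in> I. set_encode T' < set_encode T})" if T: "T \<in> I" for T
  proof
    assume mem: "J T \<in> generate D (J ` {T' \<in> I. set_encode T' < set_encode T})"
    have cT: "card T = 3" "T \<subseteq> {..<\<delta>}" "T \<notin> triangles N" using T by (auto simp: I_def)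
    \<comment> \<open>\<open>T\<close> is not a triangle of \<open>N\<close>, so one of its edges
      was kept; the coordinate at the vertex opposite to it is the one to inspect.\<close>
    then obtain e where e: "e \<subseteq> T" "card e = 2" "e \<notin> N" by (auto simp: triangles_def)
    then have eP: "e \<in> P" using cT by (auto simp: N_def E_def)
    have finT: "finite T" using cT finite_subset by blast
    have "card (T - e) = 1" using e cT finT by (simp add: card_Diff_subset finite_subset)
    then obtain v where v: "T - e = {v}" by (auto simp: card_1_singleton_iff)
    then have vT: "v \<in> T" "v \<notin> e" "T - {v} = e" using e by auto
    let ?X = "generate U (u ` {f \<in> E. set_encode f < set_encode e})"
    have subX: "subgroup ?X U" using uE by (intro U.generate_is_subgroup) auto
    interpret X: subgroup ?X U by fact
    have vlt: "v < \<delta>" using vT cT by auto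
    \<comment> \<open>The tuples whose coordinate at \<open>v\<close> comes from edges smaller than
      \<open>e\<close>. Jacobi elements of smaller triples lie here: either \<open>v\<close> is
      absent and the coordinate is 1, or subtracting 2^v from both encodings compares the opposite
      edges.\<close>
    define K where "K = {f \<in> carrier D. f v \<in> ?X}"
    have subK: "subgroup K D"
    proof (rule D.subgroupI)
      show "K \<noteq> {}" using X.one_closed vlt D.one_closed by (auto simp: K_def oneD)
      show "inv\<^bsub>D\<^esub> f \<in> K" if "f \<in> K" for f using that vlt D.inv_closed[of f] by (auto simp: K_def invD)
      show "f \<otimes>\<^bsub>D\<^esub> g \<in> K" if "f \<in> K" "g \<in> K" for f g
        using that vlt D.m_closed[of f g] by (auto simp: K_def multD)
    qed (auto simp: K_def)
    have "J T' \<in> K" if T': "T' \<in> I" "set_encode T' < set_encode T" for T'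
    proof -
      have "J T' v \<in> ?X"
      proof (cases "v \<in> T'")
        case False
        then show ?thesis using vlt by (simp add: J_def)
      next
        case True
        have finT': "finite T'" using T' finite_subset by (auto simp: I_def)
        have "set_encode T' = 2 ^ v + set_encode (T' - {v})"
          using set_encode_insert[of "T' - {v}" v] finT' True by (simp add: insert_absorb)
        moreover have "set_encode T = 2 ^ v + set_encode e"
        proof -
          have "T = insert v e" "finite e" using vT finT by auto
          then show ?thesis using vT(2) by simp
        qed
        ultimately have "set_encode (T' - {v}) < set_encode e" using T' vT by simp
        moreover have "T' - {v} \<in> E" using T' True by (auto simp: I_def E_def)
        ultimately have "u (T' - {v}) \<in> ?X" by (intro generate.incl) auto
        then show ?thesis using True vlt by (simp add: J_def)
      qed
      then show ?thesis using Jcl T' by (simp add: K_def)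
    qed
    then have "generate D (J ` {T' \<in> I. set_encode T' < set_encode T}) \<subseteq> K"
      by (intro D.generate_subgroup_incl subK) auto
    then have "J T v \<in> ?X" using mem by (auto simp: K_def)
    then have "u e \<in> ?X \<or> inv\<^bsub>U\<^esub> (u e) \<in> ?X" using vT vlt by (auto simp: J_def split: if_splits)
    moreover have "u e \<in> carrier U" using eP uE by (auto simp: P_def)
    ultimately have "u e \<in> ?X" using X.m_inv_closed by fastforce
    then show False using eP by (simp add: P_def)
  qed
  have "p ^ card I \<le> card (generate D (J ` I))"
  proof (rule D.card_generate_chain[OF finD _ p finI, where \<kappa> = set_encode and m = "m * \<delta>"])
    show "card (carrier D) = p ^ (m * \<delta>)" by (simp add: cardD cardU power_mult)
    show "inj_on set_encode I"
      using inj_on_set_encode by (rule inj_on_subset) (auto simp: I_def intro: finite_subset)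
  qed (use Jcl new in auto)
  also have "\<dots> \<le> card ker"
  proof (rule card_mono)
    show "finite ker" using finD by (simp add: ker_def kernel_def)
    show "generate D (J ` I) \<subseteq> ker"
      unfolding ker_def using Jcl Jker by (intro D.generate_subgroup_incl \<Phi>.subgroup_kernel) (auto simp: kernel_def)
  qed
  finally have "p ^ card I \<le> card ker" .
  have "p ^ (\<delta> choose 3) \<le> p ^ (card I + ((r choose 3) + (t choose 2)))"
    using cardI prime_gt_0_nat[OF p] by (intro power_increasing) auto
  also have "\<dots> \<le> card ker * p ^ ((r choose 3) + (t choose 2))"
    using \<open>p ^ card I \<le> card ker\<close> by (simp add: power_add)
  finally have "card (carrier C) * p ^ (\<delta> choose 3) \<le> card (carrier C) * (card ker * p ^ ((r choose 3) + (t choose 2)))"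
    by (rule mult_le_mono2)
  then show ?thesis using finC cardC by (simp add: mult.assoc)
qed

section \<open>Commutators and the lower central series\<close>

definition commutator :: "('a, 'b) monoid_scheme \<Rightarrow> 'a \<Rightarrow> 'a \<Rightarrow> 'a" where
  "commutator G x y = x \<otimes>\<^bsub>G\<^esub> y \<otimes>\<^bsub>G\<^esub> inv\<^bsub>G\<^esub> x \<otimes>\<^bsub>G\<^esub> inv\<^bsub>G\<^esub> y"

lemma comm_subgroup_commutator:
  "comm_subgroup G A B = generate G {commutator G a b | a b. a \<in> A \<and> b \<in> B}"
  by (simp add: comm_subgroup_def commutator_def)

context group
begin

lemma inv_mult_cancel: "\<lbrakk>x \<in> carrier G; y \<in> carrier G\<rbrakk> \<Longrightarrow> inv x \<otimes> (x \<otimes> y) = y"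
  by (simp add: m_assoc[symmetric])

lemma mult_inv_cancel: "\<lbrakk>x \<in> carrier G; y \<in> carrier G\<rbrakk> \<Longrightarrow> x \<otimes> (inv x \<otimes> y) = y"
  by (simp add: m_assoc[symmetric])

text \<open>Together with the default rules for the unit and inverses, these form the convergent
  rewriting system for groups, so an identity valid in all groups is proved by normalizing both
  sides.\<close>

lemmas word_simps = m_assoc inv_mult_group inv_mult_cancel mult_inv_cancel

lemma commutator_closed [simp]:
  "\<lbrakk>x \<in> carrier G; y \<in> carrier G\<rbrakk> \<Longrightarrow> commutator G x y \<in> carrier G" by (simp add: commutator_def)

lemma commutator_self [simp]: "x \<in> carrier G \<Longrightarrow> commutator G x x = \<one>" by (simp add: commutator_def word_simps)

lemma inv_commutator:
  "\<lbrakk>x \<in> carrier G; y \<in> carrier G\<rbrakk> \<Longrightarrow> inv (commutator G x y) = commutator G y x"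
  by (simp add: commutator_def word_simps)

lemma commutator_mult_left:
  "\<lbrakk>x \<in> carrier G; y \<in> carrier G; z \<in> carrier G\<rbrakk> \<Longrightarrow>
    commutator G (x \<otimes> y) z = x \<otimes> commutator G y z \<otimes> inv x \<otimes> commutator G x z"
  by (simp add: commutator_def word_simps)

lemma commutator_mult_right:
  "\<lbrakk>x \<in> carrier G; y \<in> carrier G; z \<in> carrier G\<rbrakk> \<Longrightarrow>
    commutator G x (y \<otimes> z) = commutator G x y \<otimes> (y \<otimes> commutator G x z \<otimes> inv y)"
  by (simp add: commutator_def word_simps)

lemma commutator_inv_left:
  "\<lbrakk>x \<in> carrier G; y \<in> carrier G\<rbrakk> \<Longrightarrow>
    commutator G (inv x) y = inv x \<otimes> inv (commutator G x y) \<otimes> x" by (simp add: commutator_def word_simps)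

lemma conj_eq_commutator_mult:
  "\<lbrakk>x \<in> carrier G; y \<in> carrier G\<rbrakk> \<Longrightarrow> x \<otimes> y \<otimes> inv x = commutator G x y \<otimes> y"
  by (simp add: commutator_def word_simps)

lemma conj_commutator:
  "\<lbrakk>x \<in> carrier G; y \<in> carrier G; z \<in> carrier G\<rbrakk> \<Longrightarrow>
    z \<otimes> commutator G x y \<otimes> inv z = commutator G (z \<otimes> x \<otimes> inv z) (z \<otimes> y \<otimes> inv z)"
  by (simp add: commutator_def word_simps)

lemma mult_commutator:
  "\<lbrakk>x \<in> carrier G; y \<in> carrier G\<rbrakk> \<Longrightarrow> commutator G x y \<otimes> (y \<otimes> x) = x \<otimes> y"
  by (simp add: commutator_def word_simps)

lemma commutator_eq_one_iff:
  assumes "x \<in> carrier G" "y \<in> carrier G"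
  shows "commutator G x y = \<one> \<longleftrightarrow> x \<otimes> y = y \<otimes> x"
proof
  assume "commutator G x y = \<one>"
  then show "x \<otimes> y = y \<otimes> x" using mult_commutator[OF assms] assms by simp
next
  assume "x \<otimes> y = y \<otimes> x"
  then have "commutator G x y = (y \<otimes> x) \<otimes> inv x \<otimes> inv y" by (simp add: commutator_def)
  then show "commutator G x y = \<one>" using assms by (simp add: word_simps)
qed

lemma grp_center_subset: "grp_center G \<subseteq> carrier G" by (auto simp: grp_center_def)

lemma grp_centerD: "\<lbrakk>z \<in> grp_center G; x \<in> carrier G\<rbrakk> \<Longrightarrow> z \<otimes> x = x \<otimes> z" by (auto simp: grp_center_def)

lemma grp_center_mult_right:
  "\<lbrakk>z \<in> grp_center G; x \<in> carrier G; y \<in> carrier G\<rbrakk> \<Longrightarrow> x \<otimes> (z \<otimes> y) = z \<otimes> (x \<otimes> y)"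
  using grp_centerD[of z x] grp_center_subset by (auto simp: m_assoc[symmetric])

lemma conj_grp_center: "\<lbrakk>z \<in> grp_center G; x \<in> carrier G\<rbrakk> \<Longrightarrow> x \<otimes> z \<otimes> inv x = z"
  using grp_centerD[of z x, symmetric] grp_center_subset by (auto simp: m_assoc)

lemma commutator_grp_center:
  assumes "z \<in> grp_center G" "x \<in> carrier G"
  shows "commutator G z x = \<one>" "commutator G x z = \<one>"
  using assms grp_centerD[OF assms] grp_center_subset commutator_eq_one_iff by auto

lemma subgroup_grp_center: "subgroup (grp_center G) G"
proof (rule subgroupI)
  show "grp_center G \<noteq> {}" by (auto simp: grp_center_def intro!: exI[of _ \<one>])
  fix a assume a: "a \<in> grp_center G"
  have aG: "a \<in> carrier G" using a grp_center_subset by auto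
  have "inv a \<otimes> x = x \<otimes> inv a" if x: "x \<in> carrier G" for x
  proof -
    have "inv a \<otimes> x = inv a \<otimes> (x \<otimes> a) \<otimes> inv a" using aG x by (simp add: word_simps)
    also have "\<dots> = x \<otimes> inv a" using grp_centerD[OF a x, symmetric] aG x by (simp add: word_simps)
    finally show ?thesis .
  qed
  then show "inv a \<in> grp_center G" using aG by (simp add: grp_center_def)
  fix b assume b: "b \<in> grp_center G"
  have bG: "b \<in> carrier G" using b grp_center_subset by auto
  have "a \<otimes> b \<otimes> x = x \<otimes> (a \<otimes> b)" if x: "x \<in> carrier G" for x
    using grp_centerD[OF b x] grp_center_mult_right[OF a x bG] aG bG x by (simp add: m_assoc)
  then show "a \<otimes> b \<in> grp_center G" using aG bG by (simp add: grp_center_def)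
qed (rule grp_center_subset)

lemma normal_grp_center: "grp_center G \<lhd> G" by (simp add: normal_inv_iff subgroup_grp_center conj_grp_center)

lemma commutator_mult_left_central:
  assumes "x \<in> carrier G" "y \<in> carrier G" "z \<in> carrier G" "commutator G y z \<in> grp_center G"
  shows "commutator G (x \<otimes> y) z = commutator G x z \<otimes> commutator G y z"
  using assms by (simp add: commutator_mult_left conj_grp_center grp_centerD)

lemma commutator_mult_right_central:
  assumes "x \<in> carrier G" "y \<in> carrier G" "z \<in> carrier G" "commutator G x z \<in> grp_center G"
  shows "commutator G x (y \<otimes> z) = commutator G x y \<otimes> commutator G x z"
  using assms by (simp add: commutator_mult_right conj_grp_center)

lemma commutator_inv_left_central:
  assumes "x \<in> carrier G" "y \<in> carrier G" "commutator G x y \<in> grp_center G"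
  shows "commutator G (inv x) y = inv (commutator G x y)"
proof -
  have "inv (commutator G x y) \<in> grp_center G"
    using assms subgroup.m_inv_closed[OF subgroup_grp_center] by blast
  then show ?thesis
    using assms conj_grp_center[of "inv (commutator G x y)" "inv x"] by (simp add: commutator_inv_left)
qed

text \<open>Conjugating \<open>[x, y]\<close> by \<open>z\<close> and expanding \<open>[[z, x] x, [z, y] y]\<close> gives the Hall-Witt
  identity in class three.\<close>
lemma jacobi_class_three:
  assumes cent: "\<And>a b c. \<lbrakk>a \<in> carrier G; b \<in> carrier G; c \<in> carrier G\<rbrakk> \<Longrightarrow>
      commutator G (commutator G a b) c \<in> grp_center G"
    and x: "x \<in> carrier G" and y: "y \<in> carrier G" and z: "z \<in> carrier G"
  shows "commutator G (commutator G x y) z \<otimes> commutator G (commutator G y z) x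
     \<otimes> inv (commutator G (commutator G x z) y) = \<one>"
proof -
  note sub = subgroup_grp_center
  have centr: "commutator G c (commutator G a b) \<in> grp_center G"
    if "a \<in> carrier G" "b \<in> carrier G" "c \<in> carrier G" for a b c
    using cent[OF that] subgroup.m_inv_closed[OF sub] inv_commutator that by force
  \<comment> \<open>Commutation with \<open>commutator G a b\<close> is multiplicative with central
    values, hence takes the same value at \<open>c \<otimes> d\<close> and
    \<open>d \<otimes> c\<close>. These differ by the commutator of \<open>c\<close> and
    \<open>d\<close>, which is therefore sent to 1.\<close>
  have kill: "commutator G (commutator G a b) (commutator G c d) = \<one>"
    if "a \<in> carrier G" "b \<in> carrier G" "c \<in> carrier G" "d \<in> carrier G" for a b c d
  proof -
    let ?u = "commutator G a b"
    let ?c = "commutator G ?u c" and ?d = "commutator G ?u d"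
    have cl: "?c \<in> carrier G" "?d \<in> carrier G" using that by auto
    have "commutator G ?u (c \<otimes> d) = commutator G ?u (commutator G c d \<otimes> (d \<otimes> c))"
      using that by (simp add: mult_commutator)
    also have "\<dots> = commutator G ?u (commutator G c d) \<otimes> commutator G ?u (d \<otimes> c)"
      using that cent by (intro commutator_mult_right_central) auto
    finally have "?c \<otimes> ?d = commutator G ?u (commutator G c d) \<otimes> (?d \<otimes> ?c)"
      using that cent by (simp add: commutator_mult_right_central)
    moreover have "?d \<otimes> ?c = ?c \<otimes> ?d" using that cent grp_centerD by auto
    ultimately show ?thesis using that cl by (metis commutator_closed m_closed r_cancel_one')
  qed
  let ?u = "commutator G z x" and ?v = "commutator G z y" and ?w = "commutator G x y"
  let ?p = "commutator G z ?w" and ?q = "commutator G x ?v" and ?r = "commutator G ?u y"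
  have cl [simp]: "?u \<in> carrier G" "?v \<in> carrier G" "?w \<in> carrier G" "?p \<in> carrier G"
    "?q \<in> carrier G" "?r \<in> carrier G" using x y z by auto
  have cq: "?q \<in> grp_center G" and cr: "?r \<in> grp_center G" and cp: "?p \<in> grp_center G"
    using x y z cent centr by auto
  have comm: "?v \<otimes> ?w = ?w \<otimes> ?v" "?u \<otimes> ?w = ?w \<otimes> ?u" using kill x y z commutator_eq_one_iff by auto
  have "?p \<otimes> ?w = z \<otimes> ?w \<otimes> inv z" using z by (simp add: conj_eq_commutator_mult)
  also have "\<dots> = commutator G (?u \<otimes> x) (?v \<otimes> y)"
    using conj_commutator[OF x y z] conj_eq_commutator_mult[OF z x] conj_eq_commutator_mult[OF z y] by simp
  also have "\<dots> = ?u \<otimes> commutator G x (?v \<otimes> y) \<otimes> inv ?u \<otimes> commutator G ?u (?v \<otimes> y)"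
    using x y by (simp add: commutator_mult_left)
  also have "commutator G x (?v \<otimes> y) = ?q \<otimes> (?v \<otimes> ?w \<otimes> inv ?v)" using x y by (simp add: commutator_mult_right)
  also have "?v \<otimes> ?w \<otimes> inv ?v = ?w" using comm(1) by (simp add: m_assoc)
  also have "?u \<otimes> (?q \<otimes> ?w) \<otimes> inv ?u = ?q \<otimes> (?u \<otimes> ?w \<otimes> inv ?u)"
    using grp_center_mult_right[OF cq] by (simp add: m_assoc)
  also have "?u \<otimes> ?w \<otimes> inv ?u = ?w" using comm(2) by (simp add: m_assoc)
  also have "commutator G ?u (?v \<otimes> y) = ?r"
    using commutator_mult_right_central[OF cl(1,2) y cr] kill[OF z x z y] by simp
  finally have "?p \<otimes> ?w = (?q \<otimes> ?r) \<otimes> ?w" using grp_centerD[OF cr, of ?w] by (simp add: m_assoc)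
  then have pqr: "?p = ?q \<otimes> ?r" by simp
  have e1: "commutator G ?w z = inv ?p" using z inv_commutator[of z ?w] by simp
  have "commutator G y z = inv ?v" using y z by (simp add: inv_commutator)
  then have "commutator G (commutator G y z) x = inv (commutator G ?v x)"
    using x y z cent by (simp add: commutator_inv_left_central)
  then have e2: "commutator G (commutator G y z) x = ?q" using x inv_commutator[of ?v x] by simp
  have "commutator G x z = inv ?u" using x z by (simp add: inv_commutator)
  then have e3: "commutator G (commutator G x z) y = inv ?r"
    using x y z cent by (simp add: commutator_inv_left_central)
  show ?thesis unfolding e1 e2 e3 pqr using grp_centerD[OF cr cl(5)] by (simp add: word_simps)
qed

end

lemma (in group_hom) hom_commutator:
  "\<lbrakk>x \<in> carrier G; y \<in> carrier G\<rbrakk> \<Longrightarrow> h (commutator G x y) = commutator H (h x) (h y)"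
  by (simp add: commutator_def)

lemma (in group_hom) comm_subgroup_img:
  assumes "A \<subseteq> carrier G" "B \<subseteq> carrier G"
  shows "h ` comm_subgroup G A B = comm_subgroup H (h ` A) (h ` B)"
proof -
  have "h ` {commutator G a b | a b. a \<in> A \<and> b \<in> B} = {commutator H a b | a b. a \<in> h ` A \<and> b \<in> h ` B}"
    using assms by (force simp: hom_commutator)
  moreover have "{commutator G a b | a b. a \<in> A \<and> b \<in> B} \<subseteq> carrier G" using assms by (auto simp: subset_iff)
  ultimately show ?thesis unfolding comm_subgroup_commutator by (simp add: generate_img[symmetric])
qed

lemma (in normal) group_hom_quotient: "group_hom G (G Mod H) (\<lambda>x. H #> x)"
  using r_coset_hom_Mod factorgroup_is_group is_group unfolding group_hom_def group_hom_axioms_def by blast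

lemma (in normal) r_coset_eq_self_iff: "x \<in> carrier G \<Longrightarrow> H #> x = H \<longleftrightarrow> x \<in> H"
  using rcos_const rcos_self is_subgroup coset_join1 subset by blast

lemma (in group) comm_subgroup_is_subgroup:
  assumes "A \<subseteq> carrier G" "B \<subseteq> carrier G" shows "subgroup (comm_subgroup G A B) G"
  unfolding comm_subgroup_commutator using assms by (intro generate_is_subgroup) (auto simp: subset_iff)

lemma commutator_in_comm_subgroup:
  "a \<in> A \<Longrightarrow> b \<in> B \<Longrightarrow> commutator G a b \<in> comm_subgroup G A B"
  unfolding comm_subgroup_commutator by (blast intro: generate.incl)

lemma (in group) comm_subgroup_subset:
  assumes "subgroup K G" "\<And>a b. \<lbrakk>a \<in> A; b \<in> B\<rbrakk> \<Longrightarrow> commutator G a b \<in> K"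
  shows "comm_subgroup G A B \<subseteq> K"
  unfolding comm_subgroup_commutator using assms by (intro generate_subgroup_incl) auto

section \<open>Normality and descent of the lower central series\<close>

context group
begin

text \<open>For normality no induction over generators is made: g y g^-1 = y [y^-1, g], where y lies
  in \<open>N\<close> by the first claim.\<close>

lemma normal_comm_subgroup:
  assumes "N \<lhd> G"
  shows "comm_subgroup G N (carrier G) \<subseteq> N" "comm_subgroup G N (carrier G) \<lhd> G"
proof -
  interpret N: normal N G by fact
  show sub: "comm_subgroup G N (carrier G) \<subseteq> N"
  proof (rule comm_subgroup_subset[OF N.subgroup_axioms])
    fix a b assume ab: "a \<in> N" "b \<in> carrier G"
    have "b \<otimes> inv a \<otimes> inv b \<in> N" using ab by (simp add: N.inv_op_closed2)
    then have "a \<otimes> (b \<otimes> inv a \<otimes> inv b) \<in> N" using ab by simp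
    then show "commutator G a b \<in> N" using ab by (simp add: commutator_def m_assoc)
  qed
  have S: "subgroup (comm_subgroup G N (carrier G)) G"
    by (rule comm_subgroup_is_subgroup) (auto intro: N.mem_carrier)
  interpret S: subgroup "comm_subgroup G N (carrier G)" G by fact
  have "g \<otimes> y \<otimes> inv g \<in> comm_subgroup G N (carrier G)"
    if g: "g \<in> carrier G" and y: "y \<in> comm_subgroup G N (carrier G)" for g y
  proof -
    have yN: "y \<in> N" using sub y by blast
    then have yG: "y \<in> carrier G" by simp
    have "commutator G (inv y) g \<in> comm_subgroup G N (carrier G)"
      using yN g by (intro commutator_in_comm_subgroup) auto
    then have "y \<otimes> commutator G (inv y) g \<in> comm_subgroup G N (carrier G)" using y by simp
    moreover have "y \<otimes> commutator G (inv y) g = g \<otimes> y \<otimes> inv g"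
      using yG g by (simp add: commutator_def word_simps)
    ultimately show ?thesis by simp
  qed
  then show "comm_subgroup G N (carrier G) \<lhd> G" using S by (simp add: normal_inv_iff)
qed

lemma normal_lower_central: "lower_central G i \<lhd> G"
proof (induction i)
  case (Suc i)
  then show ?case by (cases i) (simp_all add: normal_comm_subgroup(2) normal_self)
qed (simp add: normal_self)

lemma lower_central_subset: "lower_central G i \<subseteq> carrier G"
  using normal_lower_central normal_imp_subgroup subgroup.subset by blast

lemma lower_central_Suc_subset: "lower_central G (Suc i) \<subseteq> lower_central G i"
proof (cases i)
  case (Suc j)
  then show ?thesis using normal_comm_subgroup(1)[OF normal_lower_central[of i]] by simp
qed simp

lemma lower_central_antimono: "i \<le> j \<Longrightarrow> lower_central G j \<subseteq> lower_central G i"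
  by (rule lift_Suc_antimono_le[of "lower_central G"]) (rule lower_central_Suc_subset)

lemma commutator_in_lower_central:
  "\<lbrakk>x \<in> lower_central G (Suc i); y \<in> carrier G\<rbrakk> \<Longrightarrow> commutator G x y \<in> lower_central G (Suc (Suc i))"
  by (simp add: commutator_in_comm_subgroup)

lemma subgroup_lower_central: "subgroup (lower_central G i) G"
  using normal_lower_central normal_imp_subgroup by blast

end

lemma (in group_hom) lower_central_img:
  assumes "h ` carrier G = carrier H"
  shows "h ` lower_central G i = lower_central H i"
proof (induction i)
  case (Suc i)
  then show ?case using assms by (cases i) (simp_all add: comm_subgroup_img G.lower_central_subset)
qed (simp add: assms)

section \<open>Finite p-groups and their nilpotency\<close>

lemma finite_of_card_prime_power:
  "\<lbrakk>Factorial_Ring.prime (p::nat); card A = p ^ m\<rbrakk> \<Longrightarrow> finite A"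
  using prime_gt_0_nat[of p] by (intro card_ge_0_finite) simp

lemma (in group) card_subgroup_prime_power:
  assumes "Factorial_Ring.prime (p::nat)" "card (carrier G) = p ^ m" "subgroup H G"
  obtains a where "card H = p ^ a"
proof -
  have "card H dvd p ^ m" using lagrange[OF assms(3)] assms(2) by (metis dvd_triv_right order_def)
  then show ?thesis using divides_primepow_nat[OF assms(1)] that by blast
qed

text \<open>The class equation: all conjugacy classes outside the center have size divisible by \<open>p\<close>.\<close>
lemma (in group) p_group_center_nontrivial:
  assumes p: "Factorial_Ring.prime p" and ord: "card (carrier G) = p ^ m" and m: "0 < m"
  shows "grp_center G \<noteq> {\<one>}"
proof
  assume Z: "grp_center G = {\<one>}"
  have fin: "finite (carrier G)" using finite_of_card_prime_power[OF p ord] .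
  define \<phi> where "\<phi> = (\<lambda>g. \<lambda>h \<in> carrier G. g \<otimes> h \<otimes> inv g)"
  interpret act: group_action G "carrier G" \<phi> unfolding \<phi>_def by (rule action_by_conjugation)
  let ?O = "orbits G (carrier G) \<phi>"
  have finO: "finite ?O" using fin by (simp add: orbits_def)
  have Rsub: "R \<subseteq> carrier G" if "R \<in> ?O" for R using act.orbits_coverture that by blast
  have sum: "card (carrier G) = (\<Sum>R\<in>?O. card R)"
  proof -
    have "card (\<Union>?O) = (\<Sum>R\<in>?O. card R)"
    proof (rule card_Union_disjoint)
      show "pairwise disjnt ?O" using act.disjoint_union by (auto simp: pairwise_def disjnt_def)
      show "\<And>R. R \<in> ?O \<Longrightarrow> finite R" using Rsub fin finite_subset by blast
    qed
    then show ?thesis by (simp add: act.orbits_coverture)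
  qed
  have one: "orbit G \<phi> \<one> = {\<one>}" by (auto simp: orbit_def \<phi>_def intro!: exI[of _ \<one>])
  then have one_in: "{\<one>} \<in> ?O" by (force simp: orbits_def)
  have "p dvd card R" if R: "R \<in> ?O - {{\<one>}}" for R
  proof -
    obtain x where x: "x \<in> carrier G" "R = orbit G \<phi> x" using R by (auto simp: orbits_def)
    have "card R dvd p ^ m"
      using act.orbit_stabilizer_theorem[OF x(1)] ord x by (metis dvd_triv_left order_def)
    then obtain a where a: "card R = p ^ a" using divides_primepow_nat[OF p] by blast
    show ?thesis
    proof (cases "a = 0")
      case True
      then obtain y where "R = {y}" using a by (auto simp: card_1_singleton_iff)
      then have Rx: "R = {x}" using act.orbit_refl[OF x(1)] x(2) by simp
      have "x \<otimes> g = g \<otimes> x" if g: "g \<in> carrier G" for g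
      proof -
        have "\<phi> g x \<in> R" using g x by (auto simp: orbit_def)
        then have "g \<otimes> x \<otimes> inv g = x" using Rx x by (simp add: \<phi>_def)
        then show ?thesis using g x(1) by (metis inv_solve_right' m_closed)
      qed
      then have "x \<in> grp_center G" using x by (simp add: grp_center_def)
      then show ?thesis using Z Rx R by simp
    next
      case False
      then show ?thesis using a by simp
    qed
  qed
  then have "p dvd (\<Sum>R\<in>?O - {{\<one>}}. card R)" by (rule dvd_sum)
  moreover have "card (carrier G) = (\<Sum>R\<in>?O - {{\<one>}}. card R) + 1"
    unfolding sum using sum.remove[OF finO one_in, of card] by simp
  moreover have "p dvd card (carrier G)" using ord m by simp
  ultimately have "p dvd 1" by (metis dvd_add_right_iff)
  then show False using prime_gt_1_nat[OF p] by simp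
qed

text \<open>For normal \<open>K\<close> this is the preimage of the center of G/K; iterated from the
  trivial subgroup it gives the upper central series.\<close>

definition upper_central_step :: "('a, 'b) monoid_scheme \<Rightarrow> 'a set \<Rightarrow> 'a set" where
  "upper_central_step G K = {x \<in> carrier G. \<forall>g\<in>carrier G. commutator G x g \<in> K}"

lemma (in group) normal_upper_central_step:
  assumes "K \<lhd> G" shows "upper_central_step G K \<lhd> G" "K \<subseteq> upper_central_step G K"
proof -
  interpret K: normal K G by fact
  show sub: "K \<subseteq> upper_central_step G K"
    using normal_comm_subgroup(1)[OF assms] commutator_in_comm_subgroup[of _ K _ "carrier G" G]
    by (auto simp: upper_central_step_def)
  have S: "subgroup (upper_central_step G K) G"
  proof (rule subgroupI)
    show "upper_central_step G K \<noteq> {}" using sub K.one_closed by blast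
    show "inv a \<in> upper_central_step G K" if "a \<in> upper_central_step G K" for a
      using that K.inv_op_closed1[of a] by (auto simp: upper_central_step_def commutator_inv_left)
    show "a \<otimes> b \<in> upper_central_step G K"
      if "a \<in> upper_central_step G K" "b \<in> upper_central_step G K" for a b
      using that K.inv_op_closed2[of a] by (auto simp: upper_central_step_def commutator_mult_left)
  qed (auto simp: upper_central_step_def)
  interpret S: subgroup "upper_central_step G K" G by fact
  have "g \<otimes> x \<otimes> inv g \<in> upper_central_step G K"
    if g: "g \<in> carrier G" and x: "x \<in> upper_central_step G K" for g x
  proof -
    have xG: "x \<in> carrier G" using x by simp
    have "commutator G x g \<in> K" using x g unfolding upper_central_step_def by blast
    then have "inv (commutator G x g) \<in> K" by (rule K.m_inv_closed)
    then have "commutator G g x \<in> upper_central_step G K" using sub xG g by (auto simp: inv_commutator)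
    then show ?thesis using x xG g by (simp add: conj_eq_commutator_mult)
  qed
  then show "upper_central_step G K \<lhd> G" using S by (simp add: normal_inv_iff)
qed

text \<open>The quotient by \<open>K\<close> is a nontrivial \<open>p\<close>-group and has a
  nontrivial central element; a preimage of it lies in the step but not in \<open>K\<close>.\<close>

lemma (in group) p_group_upper_central_step_strict:
  assumes p: "Factorial_Ring.prime p" and ord: "card (carrier G) = p ^ m"
    and K: "K \<lhd> G" "K \<noteq> carrier G"
  shows "K \<subset> upper_central_step G K"
proof -
  interpret K: normal K G by fact
  let ?Q = "G Mod K"
  interpret Q: group ?Q by (rule K.factorgroup_is_group)
  interpret q: group_hom G ?Q "\<lambda>x. K #> x" by (rule K.group_hom_quotient)
  have cQ: "carrier ?Q = (\<lambda>x. K #> x) ` carrier G" by (rule carrier_FactGroup)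
  have fin: "finite (carrier G)" using finite_of_card_prime_power[OF p ord] .
  have lag: "card (carrier ?Q) * card K = p ^ m"
    using lagrange[OF K.subgroup_axioms] ord by (simp add: order_def FactGroup_def)
  then have "card (carrier ?Q) dvd p ^ m" by (metis dvd_triv_left)
  then obtain a where a: "card (carrier ?Q) = p ^ a" using divides_primepow_nat[OF p] by blast
  have "a \<noteq> 0"
  proof
    assume "a = 0"
    then have "card K = card (carrier G)" using lag a ord by simp
    then show False using K fin card_subset_eq[OF fin K.subset] by simp
  qed
  then have "grp_center ?Q \<noteq> {\<one>\<^bsub>?Q\<^esub>}" using Q.p_group_center_nontrivial[OF p a] by simp
  then obtain Y where Y: "Y \<in> grp_center ?Q" "Y \<noteq> K"
    using subgroup.one_closed[OF Q.subgroup_grp_center] by auto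
  then obtain x where x: "x \<in> carrier G" "Y = K #> x" using Q.grp_center_subset cQ by blast
  have "commutator G x g \<in> K" if g: "g \<in> carrier G" for g
  proof -
    have "K #> commutator G x g = commutator ?Q Y (K #> g)" using q.hom_commutator[OF x(1) g] x(2) by simp
    also have "\<dots> = K" using Q.commutator_grp_center(1)[OF Y(1)] q.hom_closed[OF g] by simp
    finally show ?thesis using x g K.r_coset_eq_self_iff by simp
  qed
  then have "x \<in> upper_central_step G K" using x by (simp add: upper_central_step_def)
  moreover have "x \<notin> K" using Y x K.r_coset_eq_self_iff by blast
  ultimately show ?thesis using normal_upper_central_step(2)[OF K(1)] by blast
qed

text \<open>The upper central series grows strictly until it reaches the whole group, hence reaches
  it within |G| steps, and the lower central series descends inside it. The order is a crude bound
  for the class, but only existence matters.\<close>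

lemma (in group) p_group_nilpotent:
  assumes p: "Factorial_Ring.prime p" and ord: "card (carrier G) = p ^ m"
  obtains c where "lower_central G (Suc c) = {\<one>}"
proof -
  have fin: "finite (carrier G)" using finite_of_card_prime_power[OF p ord] .
  define Z where "Z n = (upper_central_step G ^^ n) {\<one>}" for n
  have Z0: "Z 0 = {\<one>}" and ZS: "Z (Suc n) = upper_central_step G (Z n)" for n by (simp_all add: Z_def)
  have nor: "Z n \<lhd> G" for n by (induction n) (simp_all add: Z0 ZS one_is_normal normal_upper_central_step)
  have "Z n = carrier G \<or> n < card (Z n)" for n
  proof (induction n)
    case 0 show ?case by (simp add: Z0)
  next
    case (Suc n)
    show ?case
    proof (cases "Z n = carrier G")
      case True
      then have "carrier G \<subseteq> Z (Suc n)" using normal_upper_central_step(2)[OF nor[of n]] ZS by simp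
      then show ?thesis using nor[of "Suc n"] normal_imp_subgroup subgroup.subset by blast
    next
      case False
      have "Z n \<subset> Z (Suc n)" using p_group_upper_central_step_strict[OF p ord nor False] ZS by simp
      moreover have "finite (Z (Suc n))"
        using fin nor[of "Suc n"] by (meson finite_subset normal_imp_subgroup subgroup.subset)
      ultimately have "card (Z n) < card (Z (Suc n))" using psubset_card_mono by blast
      then show ?thesis using Suc False by linarith
    qed
  qed
  let ?c = "card (carrier G)"
  have "card (Z ?c) \<le> ?c" using fin normal_imp_subgroup[OF nor] by (intro card_mono subgroup.subset)
  with \<open>\<And>n. Z n = carrier G \<or> n < card (Z n)\<close>[of ?c] have c: "Z ?c = carrier G" by auto
  have "lower_central G (Suc i) \<subseteq> Z (?c - i)" if "i \<le> ?c" for i using that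
  proof (induction i)
    case 0 then show ?case using c by simp
  next
    case (Suc i)
    then have IH: "lower_central G (Suc i) \<subseteq> Z (Suc (?c - Suc i))" by (simp add: Suc_diff_Suc)
    have "comm_subgroup G (lower_central G (Suc i)) (carrier G) \<subseteq> Z (?c - Suc i)" using IH
      by (intro comm_subgroup_subset normal_imp_subgroup[OF nor]) (auto simp: ZS upper_central_step_def)
    then show ?case by simp
  qed
  from this[of ?c] have "lower_central G (Suc ?c) \<subseteq> {\<one>}" by (simp add: Z0)
  then have "lower_central G (Suc ?c) = {\<one>}" using subgroup.one_closed[OF subgroup_lower_central] by blast
  then show ?thesis by (rule that)
qed

section \<open>Factors of the lower central series\<close>

declare lower_central.simps(3) [simp del]

text \<open>The factor is placed inside the quotient by the next term, with the operations of that
  quotient, so that commutators are computed there and commutativity follows from centrality. Proper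
  numbering starts at 1: both indices 0 and 1 of \<open>lower_central\<close> are the whole
  group.\<close>

definition lcs_factor :: "('a, 'b) monoid_scheme \<Rightarrow> nat \<Rightarrow> 'a set monoid" where
  "lcs_factor G n = (G Mod lower_central G (Suc n))
     \<lparr>carrier := (\<lambda>x. lower_central G (Suc n) #>\<^bsub>G\<^esub> x) ` lower_central G n\<rparr>"

text \<open>It takes group elements instead of cosets, so that multiplicativity in each argument can
  be shown before any question of well-definedness.\<close>

definition factor_commutator :: "('a, 'b) monoid_scheme \<Rightarrow> nat \<Rightarrow> 'a \<Rightarrow> 'a \<Rightarrow> 'a set" where
  "factor_commutator G n x y = lower_central G (Suc (Suc n)) #>\<^bsub>G\<^esub> commutator G x y"

lemma carrier_lcs_factor:
  "carrier (lcs_factor G n) = (\<lambda>x. lower_central G (Suc n) #>\<^bsub>G\<^esub> x) ` lower_central G n"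
  by (simp add: lcs_factor_def)

lemma one_lcs_factor: "\<one>\<^bsub>lcs_factor G n\<^esub> = lower_central G (Suc n)" by (simp add: lcs_factor_def)

lemma mult_lcs_factor:
  "x \<otimes>\<^bsub>lcs_factor G n\<^esub> y = x \<otimes>\<^bsub>G Mod lower_central G (Suc n)\<^esub> y" by (simp add: lcs_factor_def)

lemma FactGroup_carrier_update:
  "(G\<lparr>carrier := H\<rparr>) Mod N = (G Mod N)\<lparr>carrier := (\<lambda>x. N #>\<^bsub>G\<^esub> x) ` H\<rparr>"
  by (auto simp: FactGroup_def RCOSETS_def r_coset_def set_mult_def fun_eq_iff)

lemma lcs_factor_eq_Mod:
  "(G\<lparr>carrier := lower_central G n\<rparr>) Mod lower_central G (Suc n) = lcs_factor G n"
  by (simp add: FactGroup_carrier_update lcs_factor_def)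

lemma (in group) comm_group_of_subset_center:
  assumes "subgroup H G" "H \<subseteq> grp_center G" shows "comm_group (G\<lparr>carrier := H\<rparr>)"
proof -
  interpret H: group "G\<lparr>carrier := H\<rparr>" by (rule subgroup_imp_group) fact
  show ?thesis
  proof (rule H.group_comm_groupI)
    fix x y assume "x \<in> carrier (G\<lparr>carrier := H\<rparr>)" "y \<in> carrier (G\<lparr>carrier := H\<rparr>)"
    then have "x \<in> grp_center G" "y \<in> carrier G" using assms grp_center_subset by auto
    then show "x \<otimes>\<^bsub>G\<lparr>carrier := H\<rparr>\<^esub> y = y \<otimes>\<^bsub>G\<lparr>carrier := H\<rparr>\<^esub> x" using grp_centerD[of x y] by simp
  qed
qed

lemma (in group_hom) image_generate_subset:
  assumes "S \<subseteq> carrier G" "subgroup W H" "h ` S \<subseteq> W"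
  shows "h ` generate G S \<subseteq> W" using assms by (simp add: generate_img[symmetric] H.generate_subgroup_incl)

lemma (in group_hom) subgroup_eq_carrier:
  assumes K: "subgroup K G" and ker: "kernel G H h \<subseteq> K" and img: "h ` carrier G \<subseteq> h ` K"
  shows "K = carrier G"
proof
  show "K \<subseteq> carrier G" using K by (rule subgroup.subset)
  show "carrier G \<subseteq> K"
  proof
    fix x assume x: "x \<in> carrier G"
    then obtain k where k: "k \<in> K" "h x = h k" using img by blast
    have kG: "k \<in> carrier G" using K k subgroup.subset by blast
    have "h (x \<otimes> inv k) = \<one>\<^bsub>H\<^esub>" using x kG k(2) by simp
    then have "x \<otimes> inv k \<in> K" using ker x kG by (auto simp: kernel_def)
    then have "x \<otimes> inv k \<otimes> k \<in> K" using k(1) subgroup.m_closed[OF K] by blast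
    then show "x \<in> K" using x kG by (simp add: G.m_assoc)
  qed
qed

text \<open>The universal property of a quotient, for an arbitrary surjection \<open>\<rho>\<close>:
  values are taken at chosen preimages, and \<open>ker\<close> makes the choice immaterial. It
  serves both commutator maps and characters.\<close>

lemma hom_factor_through:
  assumes \<rho>: "group_hom A U \<rho>" "\<rho> ` carrier A = carrier U" and b: "group_hom A C b"
    and ker: "\<And>x. \<lbrakk>x \<in> carrier A; \<rho> x = \<one>\<^bsub>U\<^esub>\<rbrakk> \<Longrightarrow> b x = \<one>\<^bsub>C\<^esub>"
  obtains \<beta> where "\<beta> \<in> hom U C" "\<And>x. x \<in> carrier A \<Longrightarrow> \<beta> (\<rho> x) = b x"
proof -
  interpret \<rho>: group_hom A U \<rho> by fact
  interpret b: group_hom A C b by fact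
  define s where "s = inv_into (carrier A) \<rho>"
  have s: "s u \<in> carrier A" "\<rho> (s u) = u" if "u \<in> carrier U" for u
    using that unfolding s_def \<rho>(2)[symmetric] by (rule inv_into_into f_inv_into_f)+
  have wd: "b x = b y" if "x \<in> carrier A" "y \<in> carrier A" "\<rho> x = \<rho> y" for x y
  proof -
    have "\<rho> (x \<otimes>\<^bsub>A\<^esub> inv\<^bsub>A\<^esub> y) = \<one>\<^bsub>U\<^esub>" using that(1,2) by (simp add: that(3))
    then have "b (x \<otimes>\<^bsub>A\<^esub> inv\<^bsub>A\<^esub> y) = \<one>\<^bsub>C\<^esub>" using that(1,2) by (intro ker) simp_all
    then have "b x \<otimes>\<^bsub>C\<^esub> inv\<^bsub>C\<^esub> (b y) = \<one>\<^bsub>C\<^esub>" using that(1,2) by simp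
    then show ?thesis using that(1,2) by (simp add: b.H.inv_solve_right')
  qed
  define \<beta> where "\<beta> u = b (s u)" for u
  have val: "\<beta> (\<rho> x) = b x" if "x \<in> carrier A" for x unfolding \<beta>_def using that s[of "\<rho> x"] by (intro wd) auto
  have "\<beta> \<in> hom U C"
  proof (rule homI)
    fix u v assume u: "u \<in> carrier U" and v: "v \<in> carrier U"
    show "\<beta> u \<in> carrier C" unfolding \<beta>_def using s[OF u] by simp
    have "\<beta> (u \<otimes>\<^bsub>U\<^esub> v) = \<beta> (\<rho> (s u \<otimes>\<^bsub>A\<^esub> s v))" using s u v by simp
    also have "\<dots> = b (s u \<otimes>\<^bsub>A\<^esub> s v)" using s u v by (intro val) auto
    also have "\<dots> = \<beta> u \<otimes>\<^bsub>C\<^esub> \<beta> v" using s u v by (simp add: \<beta>_def)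
    finally show "\<beta> (u \<otimes>\<^bsub>U\<^esub> v) = \<beta> u \<otimes>\<^bsub>C\<^esub> \<beta> v" .
  qed
  then show ?thesis using val that by blast
qed

text \<open>Two passes over the generators: linearity in the second argument settles a generator on
  the left, skew-symmetry exchanges the arguments, and linearity applies again.\<close>

lemma skew_map_in_subgroup:
  assumes A: "group A" and hom: "\<And>x. x \<in> carrier A \<Longrightarrow> group_hom A C (f x)"
    and skew: "\<And>x y. \<lbrakk>x \<in> carrier A; y \<in> carrier A\<rbrakk> \<Longrightarrow> f y x = inv\<^bsub>C\<^esub> (f x y)"
    and S: "S \<subseteq> carrier A" "generate A S = carrier A" and W: "subgroup W C"
    and base: "\<And>x y. \<lbrakk>x \<in> S; y \<in> S\<rbrakk> \<Longrightarrow> f x y \<in> W"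
    and xy: "x \<in> carrier A" "y \<in> carrier A"
  shows "f x y \<in> W"
proof -
  have span: "f x y \<in> W" if "x \<in> carrier A" "y \<in> carrier A" "\<And>s. s \<in> S \<Longrightarrow> f x s \<in> W" for x y
    using group_hom.image_generate_subset[OF hom[OF that(1)] S(1) W] that(2,3) S(2) by blast
  have "f s x \<in> W" if "s \<in> S" for s using span[of s x] base S(1) xy(1) that by blast
  then have "f x s \<in> W" if "s \<in> S" for s
    using skew[of s x] subgroup.m_inv_closed[OF W] S(1) xy(1) that by auto
  then show ?thesis using span xy by blast
qed

context group
begin

lemma quotient_lower_central: "group_hom G (G Mod lower_central G n) (\<lambda>x. lower_central G n #> x)"
  using normal_lower_central by (rule normal.group_hom_quotient)

lemma r_coset_lower_central_eq:
  "x \<in> carrier G \<Longrightarrow> lower_central G n #> x = lower_central G n \<longleftrightarrow> x \<in> lower_central G n"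
  using normal_lower_central by (rule normal.r_coset_eq_self_iff)

lemma factor_subset_center:
  "(\<lambda>x. lower_central G (Suc (Suc n)) #> x) ` lower_central G (Suc n)
     \<subseteq> grp_center (G Mod lower_central G (Suc (Suc n)))"
proof clarify
  fix x assume x: "x \<in> lower_central G (Suc n)"
  let ?N = "lower_central G (Suc (Suc n))"
  interpret q: group_hom G "G Mod ?N" "\<lambda>x. ?N #> x" by (rule quotient_lower_central)
  have xG: "x \<in> carrier G" using x lower_central_subset by blast
  have "(?N #> x) \<otimes>\<^bsub>G Mod ?N\<^esub> Y = Y \<otimes>\<^bsub>G Mod ?N\<^esub> (?N #> x)" if Y: "Y \<in> carrier (G Mod ?N)" for Y
  proof -
    obtain g where g: "g \<in> carrier G" "Y = ?N #> g" using Y carrier_FactGroup[of G ?N] by auto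
    have "?N #> commutator G x g = ?N"
      using commutator_in_lower_central[OF x g(1)] xG g(1) r_coset_lower_central_eq by (simp)
    then have "commutator (G Mod ?N) (?N #> x) Y = \<one>\<^bsub>G Mod ?N\<^esub>"
      using q.hom_commutator[OF xG g(1)] g(2) by simp
    then show ?thesis using q.H.commutator_eq_one_iff[OF q.hom_closed[OF xG] Y] by blast
  qed
  then show "?N #> x \<in> grp_center (G Mod ?N)" using q.hom_closed[OF xG] by (simp add: grp_center_def)
qed

lemma subgroup_factor:
  "subgroup ((\<lambda>x. lower_central G m #> x) ` lower_central G n) (G Mod lower_central G m)"
  using group_hom.subgroup_img_is_subgroup[OF quotient_lower_central subgroup_lower_central] .

lemma comm_group_lcs_factor: "comm_group (lcs_factor G (Suc n))" unfolding lcs_factor_def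
  using group.comm_group_of_subset_center[OF _ subgroup_factor factor_subset_center]
    normal.factorgroup_is_group[OF normal_lower_central] by blast

lemma hom_lcs_factor:
  "group_hom (G\<lparr>carrier := lower_central G (Suc n)\<rparr>) (lcs_factor G (Suc n))
     (\<lambda>x. lower_central G (Suc (Suc n)) #> x)" unfolding lcs_factor_def
  using group_hom.induced_group_hom[OF quotient_lower_central subgroup_lower_central] by blast

lemma factor_commutator_closed:
  assumes "x \<in> lower_central G (Suc n)" "y \<in> carrier G"
  shows "factor_commutator G (Suc n) x y \<in> carrier (lcs_factor G (Suc (Suc n)))"
  unfolding factor_commutator_def carrier_lcs_factor using commutator_in_lower_central[OF assms] by blast

lemma factor_commutator_central:
  assumes "x \<in> lower_central G (Suc n)" "y \<in> carrier G"
  shows "factor_commutator G (Suc n) x y \<in> grp_center (G Mod lower_central G (Suc (Suc (Suc n))))"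
  using factor_commutator_closed[OF assms] factor_subset_center[of "Suc n"]
  unfolding carrier_lcs_factor by blast

lemma factor_commutator_eq_commutator:
  assumes "x \<in> carrier G" "y \<in> carrier G"
  shows "factor_commutator G n x y = commutator (G Mod lower_central G (Suc (Suc n)))
     (lower_central G (Suc (Suc n)) #> x) (lower_central G (Suc (Suc n)) #> y)"
  unfolding factor_commutator_def using group_hom.hom_commutator[OF quotient_lower_central assms] .

lemma factor_commutator_eq_one:
  assumes "commutator G x y = \<one>"
  shows "factor_commutator G n x y = \<one>\<^bsub>lcs_factor G (Suc n)\<^esub>"
  unfolding factor_commutator_def assms one_lcs_factor
  using r_coset_lower_central_eq[OF one_closed] subgroup.one_closed[OF subgroup_lower_central] by blast

text \<open>The values are central modulo the next term of the series, so the conjugation in the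
  expansion of a commutator of a product has no effect.\<close>

lemma factor_commutator_hom_left:
  assumes y: "y \<in> carrier G"
  shows "group_hom (G\<lparr>carrier := lower_central G (Suc n)\<rparr>) (lcs_factor G (Suc (Suc n)))
     (\<lambda>x. factor_commutator G (Suc n) x y)"
proof -
  let ?N = "lower_central G (Suc (Suc (Suc n)))"
  interpret q: group_hom G "G Mod ?N" "\<lambda>x. ?N #> x" by (rule quotient_lower_central)
  have "(\<lambda>x. factor_commutator G (Suc n) x y)
      \<in> hom (G\<lparr>carrier := lower_central G (Suc n)\<rparr>) (lcs_factor G (Suc (Suc n)))"
  proof (rule homI, goal_cases)
    case (1 x) then show ?case using factor_commutator_closed y by simp
  next
    case (2 x x')
    then have x: "x \<in> lower_central G (Suc n)" "x' \<in> lower_central G (Suc n)" by auto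
    then have xG: "x \<in> carrier G" "x' \<in> carrier G" using lower_central_subset by auto
    have "factor_commutator G (Suc n) (x \<otimes> x') y
        = commutator (G Mod ?N) ((?N #> x) \<otimes>\<^bsub>G Mod ?N\<^esub> (?N #> x')) (?N #> y)"
      using xG y q.hom_mult[OF xG] by (simp add: factor_commutator_eq_commutator)
    also have "\<dots> = commutator (G Mod ?N) (?N #> x) (?N #> y) \<otimes>\<^bsub>G Mod ?N\<^esub> commutator (G Mod ?N) (?N #> x') (?N #> y)"
      using q.hom_closed xG y factor_commutator_central[OF x(2) y]
      by (intro q.H.commutator_mult_left_central) (auto simp: factor_commutator_eq_commutator)
    finally show ?case using xG y by (simp add: factor_commutator_eq_commutator mult_lcs_factor)
  qed
  then show ?thesis
    using subgroup_imp_group[OF subgroup_lower_central] comm_group.axioms(2)[OF comm_group_lcs_factor]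
    unfolding group_hom_def group_hom_axioms_def by blast
qed

lemma factor_commutator_hom_right:
  assumes x: "x \<in> lower_central G (Suc n)"
  shows "group_hom G (lcs_factor G (Suc (Suc n))) (factor_commutator G (Suc n) x)"
proof -
  let ?N = "lower_central G (Suc (Suc (Suc n)))"
  interpret q: group_hom G "G Mod ?N" "\<lambda>x. ?N #> x" by (rule quotient_lower_central)
  have xG: "x \<in> carrier G" using x lower_central_subset by auto
  have "factor_commutator G (Suc n) x \<in> hom G (lcs_factor G (Suc (Suc n)))"
  proof (rule homI, goal_cases)
    case (1 y) then show ?case using factor_commutator_closed x by simp
  next
    case (2 y z)
    have "factor_commutator G (Suc n) x (y \<otimes> z)
        = commutator (G Mod ?N) (?N #> x) ((?N #> y) \<otimes>\<^bsub>G Mod ?N\<^esub> (?N #> z))"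
      using xG 2 q.hom_mult[OF 2] by (simp add: factor_commutator_eq_commutator)
    also have "\<dots> = commutator (G Mod ?N) (?N #> x) (?N #> y) \<otimes>\<^bsub>G Mod ?N\<^esub> commutator (G Mod ?N) (?N #> x) (?N #> z)"
      using q.hom_closed xG 2 factor_commutator_central[OF x 2(2)]
      by (intro q.H.commutator_mult_right_central) (auto simp: factor_commutator_eq_commutator)
    finally show ?case using xG 2 by (simp add: factor_commutator_eq_commutator mult_lcs_factor)
  qed
  then show ?thesis using is_group comm_group.axioms(2)[OF comm_group_lcs_factor]
    unfolding group_hom_def group_hom_axioms_def by blast
qed

lemma inv_factor_commutator:
  assumes x: "x \<in> carrier G" and y: "y \<in> carrier G"
  shows "inv\<^bsub>lcs_factor G (Suc (Suc 0))\<^esub> (factor_commutator G (Suc 0) x y)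
    = factor_commutator G (Suc 0) y x"
proof -
  let ?C = "lcs_factor G (Suc (Suc 0))"
  interpret C: comm_group ?C by (rule comm_group_lcs_factor)
  have cl: "factor_commutator G (Suc 0) a b \<in> carrier ?C" if "a \<in> carrier G" "b \<in> carrier G" for a b
    using factor_commutator_closed[of a 0 b] that by simp
  have "commutator G y x \<otimes> commutator G x y = \<one>"
    using inv_commutator[OF x y] x y by (metis commutator_closed l_inv)
  then have "factor_commutator G (Suc 0) y x \<otimes>\<^bsub>?C\<^esub> factor_commutator G (Suc 0) x y = \<one>\<^bsub>?C\<^esub>"
    using group_hom.hom_mult[OF quotient_lower_central, of "commutator G y x" "commutator G x y"]
      group_hom.hom_one[OF quotient_lower_central] x y
    unfolding mult_lcs_factor one_lcs_factor factor_commutator_def by simp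
  then show ?thesis using cl x y by (intro C.inv_equality)
qed

lemma generate_factor_commutators:
  "generate (lcs_factor G (Suc (Suc n)))
     {factor_commutator G (Suc n) x y | x y. x \<in> lower_central G (Suc n) \<and> y \<in> carrier G}
   = carrier (lcs_factor G (Suc (Suc n)))"
proof -
  let ?N = "lower_central G (Suc (Suc (Suc n)))" and ?L = "lower_central G (Suc (Suc n))"
  let ?S = "{commutator G x y | x y. x \<in> lower_central G (Suc n) \<and> y \<in> carrier G}"
  interpret q: group_hom "G\<lparr>carrier := ?L\<rparr>" "lcs_factor G (Suc (Suc n))" "\<lambda>x. ?N #> x"
    by (rule hom_lcs_factor)
  have S: "?S \<subseteq> ?L" using commutator_in_lower_central by blast
  have L: "?L = generate G ?S" by (simp add: comm_subgroup_commutator lower_central.simps(3))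
  also have "\<dots> = generate (G\<lparr>carrier := ?L\<rparr>) ?S"
    using generate_consistent[OF S subgroup_lower_central] by simp
  finally have "carrier (lcs_factor G (Suc (Suc n))) = (\<lambda>x. ?N #> x) ` generate (G\<lparr>carrier := ?L\<rparr>) ?S"
    by (simp only: carrier_lcs_factor)
  also have "\<dots> = generate (lcs_factor G (Suc (Suc n))) ((\<lambda>x. ?N #> x) ` ?S)"
    using S by (intro q.generate_img[symmetric]) simp
  also have "(\<lambda>x. ?N #> x) ` ?S = {factor_commutator G (Suc n) x y | x y. x \<in> lower_central G (Suc n) \<and> y \<in> carrier G}"
    by (auto simp: factor_commutator_def)
  finally show ?thesis by simp
qed

lemma card_lcs_factor:
  "card (lower_central G (Suc n))
   = card (carrier (lcs_factor G (Suc n))) * card (lower_central G (Suc (Suc n)))"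
proof -
  let ?N = "lower_central G (Suc (Suc n))" and ?L = "lower_central G (Suc n)"
  interpret q: group_hom "G\<lparr>carrier := ?L\<rparr>" "lcs_factor G (Suc n)" "\<lambda>x. ?N #> x" by (rule hom_lcs_factor)
  have "kernel (G\<lparr>carrier := ?L\<rparr>) (lcs_factor G (Suc n)) (\<lambda>x. ?N #> x) = ?N"
  proof -
    have "?N #> x = ?N \<longleftrightarrow> x \<in> ?N" if "x \<in> ?L" for x
      using that lower_central_subset r_coset_lower_central_eq by blast
    then show ?thesis using lower_central_Suc_subset[of "Suc n"] unfolding kernel_def one_lcs_factor by auto
  qed
  then show ?thesis using q.card_eq_image_times_kernel by (simp add: carrier_lcs_factor)
qed

end

section \<open>Central extensions of finite groups\<close>

lemma min_gens_attained:
  assumes "group H" "finite (carrier H)"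
  obtains S where "S \<subseteq> carrier H" "finite S" "card S = min_gens H" "generate H S = carrier H"
proof -
  have "generate H (carrier H) = carrier H"
    using group.generate_incl[OF assms(1)] by (auto intro: generate.incl)
  then have "\<exists>S. S \<subseteq> carrier H \<and> finite S \<and> card S = card (carrier H) \<and> generate H S = carrier H"
    using assms(2) by blast
  then have "\<exists>S. S \<subseteq> carrier H \<and> finite S \<and> card S = min_gens H \<and> generate H S = carrier H"
    unfolding min_gens_def by (rule LeastI)
  then show ?thesis using that by blast
qed

text \<open>\<open>E\<close> is of arbitrary size; that terms of its lower central series are finite
  is a conclusion drawn from \<open>G\<close>.\<close>

locale central_extension = group_hom E G \<pi>
  for E :: "('e, 'f) monoid_scheme" (structure) and G :: "('a, 'b) monoid_scheme" and \<pi> +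
  assumes surj: "\<pi> ` carrier E = carrier G"
    and central: "\<lbrakk>x \<in> carrier E; \<pi> x = \<one>\<^bsub>G\<^esub>\<rbrakk> \<Longrightarrow> x \<in> grp_center E"
begin

lemma lower_central_image: "\<pi> ` lower_central E n = lower_central G n" using surj by (rule lower_central_img)

text \<open>\<open>k\<close> differs by a central element from an element \<open>k'\<close> of the
  next term of the series of \<open>E\<close>, and commutators do not see central factors. This is
  what lets the factors of \<open>G\<close> govern commutation in \<open>E\<close>.\<close>

lemma factor_commutator_trivial:
  assumes k: "k \<in> lower_central E (Suc n)" "\<pi> k \<in> lower_central G (Suc (Suc n))" and y: "y \<in> carrier E"
  shows "factor_commutator E (Suc n) k y = lower_central E (Suc (Suc (Suc n)))"
proof -
  obtain k' where k': "k' \<in> lower_central E (Suc (Suc n))" "\<pi> k = \<pi> k'"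
    using k(2) lower_central_image by blast
  have kE: "k \<in> carrier E" "k' \<in> carrier E" using k k' G.lower_central_subset by auto
  let ?a = "inv k' \<otimes> k"
  have "\<pi> ?a = \<one>\<^bsub>G\<^esub>" using kE k'(2) by simp
  then have a: "?a \<in> grp_center E" using kE by (intro central) auto
  have "k = k' \<otimes> ?a" using kE by (simp add: G.mult_inv_cancel)
  then have "commutator E k y = k' \<otimes> commutator E ?a y \<otimes> inv k' \<otimes> commutator E k' y"
    using G.commutator_mult_left[of k' ?a y] kE y by simp
  also have "\<dots> = commutator E k' y" using G.commutator_grp_center(1)[OF a y] kE y by simp
  finally have "commutator E k y \<in> lower_central E (Suc (Suc (Suc n)))"
    using G.commutator_in_lower_central[OF k'(1) y] by simp
  then show ?thesis
    unfolding factor_commutator_def using G.r_coset_lower_central_eq[of "commutator E k y"] kE y by simp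
qed

definition center_lift :: "'e set" where "center_lift = {z \<in> carrier E. \<pi> z \<in> grp_center G}"

text \<open>For \<open>z\<close> over the center of \<open>G\<close>, all [z, e] lie in the kernel
  and are central. Conjugation by \<open>z\<close> then changes \<open>e\<close> and
  \<open>f\<close> by central factors only, and so fixes [e, f].\<close>

lemma commutator_center_lift:
  assumes x: "x \<in> lower_central E (Suc (Suc n))" and z: "z \<in> center_lift"
  shows "commutator E x z = \<one>"
proof -
  have zE: "z \<in> carrier E" and zc: "\<pi> z \<in> grp_center G" using z by (auto simp: center_lift_def)
  let ?K = "{x \<in> carrier E. commutator E x z = \<one>}"
  have K: "subgroup ?K E"
  proof (rule G.subgroupI)
    show "?K \<noteq> {}" using zE by auto
    show "inv a \<in> ?K" if "a \<in> ?K" for a using that zE by (auto simp: G.commutator_inv_left)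
    show "a \<otimes> b \<in> ?K" if "a \<in> ?K" "b \<in> ?K" for a b using that zE by (auto simp: G.commutator_mult_left)
  qed auto
  have "comm_subgroup E (carrier E) (carrier E) \<subseteq> ?K"
  proof (rule G.comm_subgroup_subset[OF K])
    fix e f assume e: "e \<in> carrier E" and f: "f \<in> carrier E"
    have ce: "commutator E z g \<in> grp_center E" if g: "g \<in> carrier E" for g
      using hom_commutator[OF zE g] H.commutator_grp_center(1)[OF zc, of "\<pi> g"] zE g by (intro central) auto
    let ?a = "commutator E z e" and ?b = "commutator E z f" and ?c = "commutator E e f"
    have cl: "?a \<in> carrier E" "?b \<in> carrier E" "?c \<in> carrier E" using zE e f by auto
    have "z \<otimes> ?c \<otimes> inv z = commutator E (?a \<otimes> e) (?b \<otimes> f)"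
      using G.conj_commutator[OF e f zE] G.conj_eq_commutator_mult[OF zE e]
        G.conj_eq_commutator_mult[OF zE f] by simp
    also have "\<dots> = ?a \<otimes> commutator E e (?b \<otimes> f) \<otimes> inv ?a"
      using cl e f G.commutator_grp_center(1)[OF ce[OF e], of "?b \<otimes> f"] by (simp add: G.commutator_mult_left)
    also have "commutator E e (?b \<otimes> f) = ?b \<otimes> ?c \<otimes> inv ?b"
      using cl e f G.commutator_grp_center(2)[OF ce[OF f] e] by (simp add: G.commutator_mult_right)
    also have "\<dots> = ?c" using G.grp_centerD[OF ce[OF f] cl(3)] cl by (simp add: G.m_assoc)
    also have "?a \<otimes> ?c \<otimes> inv ?a = ?c" using G.grp_centerD[OF ce[OF e] cl(3)] cl by (simp add: G.m_assoc)
    finally have "z \<otimes> ?c = ?c \<otimes> z" using zE cl by (simp add: G.inv_solve_right')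
    then show "?c \<in> ?K" using G.commutator_eq_one_iff[OF cl(3) zE] cl by simp
  qed
  moreover have "lower_central E (Suc (Suc n)) \<subseteq> comm_subgroup E (carrier E) (carrier E)"
    using G.lower_central_antimono[of "Suc (Suc 0)" "Suc (Suc n)"] by (simp add: lower_central.simps(3))
  ultimately show ?thesis using x by blast
qed

definition factor_map :: "nat \<Rightarrow> 'e \<Rightarrow> 'a set" where
  "factor_map n x = lower_central G (Suc n) #>\<^bsub>G\<^esub> \<pi> x"

lemma factor_map_hom:
  "group_hom (E\<lparr>carrier := lower_central E (Suc n)\<rparr>) (lcs_factor G (Suc n)) (factor_map (Suc n))"
proof -
  interpret a: group_hom "E\<lparr>carrier := lower_central E (Suc n)\<rparr>" "G\<lparr>carrier := lower_central G (Suc n)\<rparr>" \<pi>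
    using induced_group_hom[OF G.subgroup_lower_central[of "Suc n"]] lower_central_image by simp
  interpret b: group_hom "G\<lparr>carrier := lower_central G (Suc n)\<rparr>" "lcs_factor G (Suc n)"
      "\<lambda>x. lower_central G (Suc (Suc n)) #>\<^bsub>G\<^esub> x" by (rule H.hom_lcs_factor)
  have "(\<lambda>x. lower_central G (Suc (Suc n)) #>\<^bsub>G\<^esub> x) \<circ> \<pi>
     \<in> hom (E\<lparr>carrier := lower_central E (Suc n)\<rparr>) (lcs_factor G (Suc n))"
    using Group.hom_compose[OF a.homh b.homh] .
  moreover have "(\<lambda>x. lower_central G (Suc (Suc n)) #>\<^bsub>G\<^esub> x) \<circ> \<pi> = factor_map (Suc n)"
    by (auto simp: factor_map_def)
  ultimately show ?thesis
    using a.group_axioms b.H.group_axioms unfolding group_hom_def group_hom_axioms_def by simp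
qed

lemma factor_map_image:
  "factor_map n ` lower_central E n = carrier (lcs_factor G n)"
  unfolding carrier_lcs_factor lower_central_image[symmetric] factor_map_def by (simp add: image_image)

lemma factor_map_eq_one:
  assumes "x \<in> carrier E"
  shows "factor_map n x = lower_central G (Suc n) \<longleftrightarrow> \<pi> x \<in> lower_central G (Suc n)"
  unfolding factor_map_def using assms H.r_coset_lower_central_eq by simp

text \<open>The source belongs to \<open>G\<close> and the target, one step further down, to
  \<open>E\<close>: by \<open>factor_commutator_trivial\<close>, commutation with \<open>y\<close>
  descends to the factor of \<open>G\<close>.\<close>

lemma obtain_commutator_map:
  assumes y: "y \<in> carrier E"
  obtains \<beta> where "\<beta> \<in> hom (lcs_factor G (Suc n)) (lcs_factor E (Suc (Suc n)))"
    "\<And>x. x \<in> lower_central E (Suc n) \<Longrightarrow> \<beta> (factor_map (Suc n) x) = factor_commutator E (Suc n) x y"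
proof -
  let ?L = "E\<lparr>carrier := lower_central E (Suc n)\<rparr>"
  have img: "factor_map (Suc n) ` carrier ?L = carrier (lcs_factor G (Suc n))" using factor_map_image by simp
  have ker: "factor_commutator E (Suc n) x y = \<one>\<^bsub>lcs_factor E (Suc (Suc n))\<^esub>"
    if x: "x \<in> carrier ?L" "factor_map (Suc n) x = \<one>\<^bsub>lcs_factor G (Suc n)\<^esub>" for x
  proof -
    have xE: "x \<in> lower_central E (Suc n)" "x \<in> carrier E" using x(1) G.lower_central_subset by auto
    have "\<pi> x \<in> lower_central G (Suc (Suc n))"
      using x(2) factor_map_eq_one[OF xE(2)] unfolding one_lcs_factor by blast
    then show ?thesis using factor_commutator_trivial[OF xE(1) _ y] by (simp add: one_lcs_factor)
  qed
  obtain \<beta> where \<beta>: "\<beta> \<in> hom (lcs_factor G (Suc n)) (lcs_factor E (Suc (Suc n)))"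
    "\<And>x. x \<in> carrier ?L \<Longrightarrow> \<beta> (factor_map (Suc n) x) = factor_commutator E (Suc n) x y"
    by (rule hom_factor_through[OF factor_map_hom img G.factor_commutator_hom_left[OF y] ker]) blast+
  show ?thesis by (rule that[OF \<beta>(1)]) (simp add: \<beta>(2))
qed

lemma obtain_center_lift_generators:
  assumes fin: "finite (carrier G)"
  obtains y where "\<And>j::nat. y j \<in> carrier E"
    "generate E (y ` {..<min_gens (G Mod grp_center G)} \<union> center_lift) = carrier E"
proof -
  let ?Q = "G Mod grp_center G" and ?d = "min_gens (G Mod grp_center G)"
  interpret Z: normal "grp_center G" G by (rule H.normal_grp_center)
  interpret Q: group ?Q by (rule Z.factorgroup_is_group)
  interpret q: group_hom G ?Q "\<lambda>x. grp_center G #>\<^bsub>G\<^esub> x" by (rule Z.group_hom_quotient)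
  have finQ: "finite (carrier ?Q)" using fin by (simp add: carrier_FactGroup)
  obtain S where S: "S \<subseteq> carrier ?Q" "finite S" "card S = ?d" "generate ?Q S = carrier ?Q"
    using min_gens_attained[OF Q.is_group finQ] by blast
  obtain f where f: "bij_betw f {..<?d} S" using S(2,3) ex_bij_betw_nat_finite[of S] by (auto simp: atLeast0LessThan)
  have "\<exists>e\<in>carrier E. grp_center G #>\<^bsub>G\<^esub> \<pi> e = f j" if "j < ?d" for j
  proof -
    have "f j \<in> carrier ?Q" using f S(1) that by (auto simp: bij_betw_def)
    then obtain g where "g \<in> carrier G" "f j = grp_center G #>\<^bsub>G\<^esub> g" by (auto simp: carrier_FactGroup)
    then show ?thesis using surj by (metis imageE)
  qed
  then obtain y0 where y0: "\<And>j. j < ?d \<Longrightarrow> y0 j \<in> carrier E \<and> grp_center G #>\<^bsub>G\<^esub> \<pi> (y0 j) = f j" by metis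
  \<comment> \<open>The unit as default beyond the range makes every \<open>y j\<close> an element
    of \<open>E\<close> without a side condition.\<close>
  define y where "y j = (if j < ?d then y0 j else \<one>)" for j
  have y: "y j \<in> carrier E" for j using y0 by (simp add: y_def)
  let ?h = "\<lambda>x. grp_center G #>\<^bsub>G\<^esub> \<pi> x"
  have "?h \<in> hom E ?Q" using Group.hom_compose[OF homh q.homh] by (simp add: comp_def)
  then interpret h: group_hom E ?Q ?h
    using G.is_group Q.is_group by (simp add: group_hom_def group_hom_axioms_def)
  let ?Y = "y ` {..<?d} \<union> center_lift"
  have Y: "?Y \<subseteq> carrier E" using y by (auto simp: center_lift_def)
  have "generate E ?Y = carrier E"
  proof (rule h.subgroup_eq_carrier)
    show "subgroup (generate E ?Y) E" using Y by (rule G.generate_is_subgroup)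
    have "kernel E ?Q ?h \<subseteq> center_lift" using Z.r_coset_eq_self_iff by (auto simp: kernel_def center_lift_def)
    then show "kernel E ?Q ?h \<subseteq> generate E ?Y" by (auto intro: generate.incl)
    have "S \<subseteq> ?h ` ?Y"
    proof
      fix s assume "s \<in> S"
      then obtain j where j: "j < ?d" "s = f j" using f by (auto simp: bij_betw_def)
      then have "s = ?h (y j)" using y0 by (simp add: y_def)
      then show "s \<in> ?h ` ?Y" using j by blast
    qed
    then have "generate ?Q S \<subseteq> generate ?Q (?h ` ?Y)" by (rule Q.mono_generate)
    also have "\<dots> = ?h ` generate E ?Y" using Y by (rule h.generate_img)
    finally show "?h ` carrier E \<subseteq> ?h ` generate E ?Y" using S(4) h.hom_closed by blast
  qed
  with y show ?thesis using that by blast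
qed

text \<open>The target is generated by commutators [x, e], which are multiplicative in
  \<open>e\<close>, so \<open>e\<close> may be restricted to the given generators. Those in
  \<open>center_lift\<close> contribute 1, because \<open>x\<close> lies in the derived subgroup;
  hence the index shift by two.\<close>

lemma obtain_generating_homs:
  assumes y: "\<And>j::nat. y j \<in> carrier E"
    and gen: "generate E (y ` {..<\<delta>} \<union> center_lift) = carrier E"
  obtains b where
    "\<And>j. j < \<delta> \<Longrightarrow> b j \<in> hom (lcs_factor G (Suc (Suc n))) (lcs_factor E (Suc (Suc (Suc n))))"
    "\<And>j x. j < \<delta> \<Longrightarrow> x \<in> lower_central E (Suc (Suc n)) \<Longrightarrow>
        b j (factor_map (Suc (Suc n)) x) = factor_commutator E (Suc (Suc n)) x (y j)"
    "generate (lcs_factor E (Suc (Suc (Suc n)))) (\<Union>j<\<delta>. b j ` carrier (lcs_factor G (Suc (Suc n))))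
       = carrier (lcs_factor E (Suc (Suc (Suc n))))"
proof -
  let ?U = "lcs_factor G (Suc (Suc n))" and ?C = "lcs_factor E (Suc (Suc (Suc n)))"
  interpret C: comm_group ?C by (rule G.comm_group_lcs_factor)
  have "\<forall>j. \<exists>\<beta>. \<beta> \<in> hom ?U ?C \<and> (\<forall>x\<in>lower_central E (Suc (Suc n)).
      \<beta> (factor_map (Suc (Suc n)) x) = factor_commutator E (Suc (Suc n)) x (y j))"
    using obtain_commutator_map[OF y] by metis
  then obtain b where b: "\<And>j. b j \<in> hom ?U ?C"
    "\<And>j x. x \<in> lower_central E (Suc (Suc n)) \<Longrightarrow>
        b j (factor_map (Suc (Suc n)) x) = factor_commutator E (Suc (Suc n)) x (y j)" by metis
  let ?V = "\<Union>j<\<delta>. b j ` carrier ?U"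
  have V: "?V \<subseteq> carrier ?C" using b(1) by (auto simp: hom_def)
  have W: "subgroup (generate ?C ?V) ?C" using V by (rule C.generate_is_subgroup)
  have Y: "y ` {..<\<delta>} \<union> center_lift \<subseteq> carrier E" using y by (auto simp: center_lift_def)
  have "{factor_commutator E (Suc (Suc n)) x e | x e. x \<in> lower_central E (Suc (Suc n)) \<and> e \<in> carrier E}
      \<subseteq> generate ?C ?V"
  proof clarify
    fix x e assume x: "x \<in> lower_central E (Suc (Suc n))" and e: "e \<in> carrier E"
    interpret f: group_hom E ?C "factor_commutator E (Suc (Suc n)) x"
      using x by (rule G.factor_commutator_hom_right)
    have "factor_commutator E (Suc (Suc n)) x ` (y ` {..<\<delta>} \<union> center_lift) \<subseteq> generate ?C ?V"
    proof clarify
      fix g assume "g \<in> y ` {..<\<delta>} \<union> center_lift"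
      then show "factor_commutator E (Suc (Suc n)) x g \<in> generate ?C ?V"
      proof
        assume "g \<in> y ` {..<\<delta>}"
        then obtain j where j: "j < \<delta>" "g = y j" by blast
        have "factor_map (Suc (Suc n)) x \<in> carrier ?U" using x factor_map_image by blast
        then have "b j (factor_map (Suc (Suc n)) x) \<in> ?V" using j by blast
        then show ?thesis using b(2)[OF x] j by (simp add: generate.incl)
      next
        assume g: "g \<in> center_lift"
        have "factor_commutator E (Suc (Suc n)) x g = \<one>\<^bsub>?C\<^esub>"
          by (rule G.factor_commutator_eq_one) (rule commutator_center_lift[OF x g])
        then show ?thesis by (simp add: generate.one)
      qed
    qed
    then have "factor_commutator E (Suc (Suc n)) x ` generate E (y ` {..<\<delta>} \<union> center_lift) \<subseteq> generate ?C ?V"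
      using Y W by (intro f.image_generate_subset)
    then show "factor_commutator E (Suc (Suc n)) x e \<in> generate ?C ?V" using gen e by blast
  qed
  then have "carrier ?C \<subseteq> generate ?C ?V"
    unfolding G.generate_factor_commutators[symmetric] using W by (rule C.generate_subgroup_incl)
  then have "generate ?C ?V = carrier ?C" using C.generate_incl[OF V] by blast
  then show ?thesis using b that by blast
qed

lemma finite_lcs_factor:
  assumes "finite (carrier G)" shows "finite (carrier (lcs_factor G n))" unfolding carrier_lcs_factor
  using finite_subset[OF H.lower_central_subset assms] by blast

text \<open>The product formula for \<open>card\<close> also holds for infinite sets, where
  \<open>card\<close> is 0. A nonzero product therefore forces finiteness.\<close>

lemma finite_lower_central_step:
  assumes "finite (carrier (lcs_factor E (Suc n)))" "finite (lower_central E (Suc (Suc n)))"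
  shows "finite (lower_central E (Suc n))"
proof (rule card_ge_0_finite)
  have "lower_central E (Suc (Suc n)) \<noteq> {}" "carrier (lcs_factor E (Suc n)) \<noteq> {}"
    using subgroup.one_closed[OF G.subgroup_lower_central] unfolding carrier_lcs_factor by blast+
  then show "0 < card (lower_central E (Suc n))"
    unfolding G.card_lcs_factor[of n] using assms by (simp add: card_gt_0_iff)
qed

text \<open>From the third term on, each factor of the series of \<open>E\<close> is bounded by the
  \<delta>-th power of the preceding factor of \<open>G\<close>, and these powers telescope. The
  downward induction starts where the series of \<open>E\<close> has become trivial.\<close>

lemma card_lower_central_le:
  assumes fin: "finite (carrier G)" and nil: "lower_central G (Suc c) = {\<one>\<^bsub>G\<^esub>}"
  shows "finite (lower_central E (Suc (Suc (Suc n)))) \<and>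
    card (lower_central E (Suc (Suc (Suc n))))
      \<le> card (lower_central G (Suc (Suc n))) ^ min_gens (G Mod grp_center G)"
proof -
  let ?d = "min_gens (G Mod grp_center G)"
  obtain y where y: "\<And>j::nat. y j \<in> carrier E" "generate E (y ` {..<?d} \<union> center_lift) = carrier E"
    using obtain_center_lift_generators[OF fin] by blast
  \<comment> \<open>Once a term of the series of \<open>G\<close> is trivial, the corresponding term
    for \<open>E\<close> is central, and the next one is trivial.\<close>
  have triv: "lower_central E (Suc (Suc m)) = {\<one>}" if m: "c \<le> m" for m
  proof
    have "lower_central G (Suc m) \<subseteq> {\<one>\<^bsub>G\<^esub>}" using H.lower_central_antimono[of "Suc c" "Suc m"] m nil by simp
    then have "x \<in> grp_center E" if "x \<in> lower_central E (Suc m)" for x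
      using that lower_central_image[of "Suc m"] G.lower_central_subset[of "Suc m"] by (intro central) auto
    then show "lower_central E (Suc (Suc m)) \<subseteq> {\<one>}"
      unfolding lower_central.simps(3) using G.commutator_grp_center(1) G.triv_subgroup
      by (intro G.comm_subgroup_subset) auto
    show "{\<one>} \<subseteq> lower_central E (Suc (Suc m))" using subgroup.one_closed[OF G.subgroup_lower_central] by blast
  qed
  have pos: "0 < card (lower_central G m)" for m
    using subgroup.one_closed[OF H.subgroup_lower_central] finite_subset[OF H.lower_central_subset fin]
    by (metis card_gt_0_iff empty_iff)
  have "n \<le> n + c" by simp
  then show ?thesis
  proof (induction rule: inc_induct)
    case base
    have "lower_central E (Suc (Suc (Suc (n + c)))) = {\<one>}" by (rule triv) simp
    then show ?case using pos[of "Suc (Suc (n + c))"] by (simp add: Suc_le_eq)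
  next
    case (step m)
    let ?U = "lcs_factor G (Suc (Suc m))" and ?C = "lcs_factor E (Suc (Suc (Suc m)))"
    obtain b where b: "\<And>j. j < ?d \<Longrightarrow> b j \<in> hom ?U ?C"
      "\<And>j x. j < ?d \<Longrightarrow> x \<in> lower_central E (Suc (Suc m)) \<Longrightarrow>
        b j (factor_map (Suc (Suc m)) x) = factor_commutator E (Suc (Suc m)) x (y j)"
      "generate ?C (\<Union>j<?d. b j ` carrier ?U) = carrier ?C" using obtain_generating_homs[OF y, of m] by metis
    have C: "finite (carrier ?C)" "card (carrier ?C) \<le> card (carrier ?U) ^ ?d"
      using card_generated_by_homs_le[OF H.comm_group_lcs_factor finite_lcs_factor[OF fin]
          G.comm_group_lcs_factor b(1,3)] by blast+
    have "card (lower_central E (Suc (Suc (Suc m)))) = card (carrier ?C) * card (lower_central E (Suc (Suc (Suc (Suc m)))))"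
      by (rule G.card_lcs_factor)
    also have "\<dots> \<le> card (carrier ?U) ^ ?d * card (lower_central G (Suc (Suc (Suc m)))) ^ ?d"
      using C(2) step.IH by (intro mult_le_mono) auto
    also have "\<dots> = card (lower_central G (Suc (Suc m))) ^ ?d"
      unfolding H.card_lcs_factor[of "Suc m"] by (simp add: power_mult_distrib)
    finally show ?case using finite_lower_central_step[OF C(1)] step.IH by blast
  qed
qed

text \<open>Commutators modulo \<gamma>3 E depend only on classes in G/\<gamma>2 G, so choosing
  preimages in \<open>E\<close> gives an alternating map on a finite abelian group. Its values on
  the image of a minimal generating set of \<open>G\<close> generate the target.\<close>

lemma card_second_factor_le:
  assumes fin: "finite (carrier G)"
  shows "finite (carrier (lcs_factor E (Suc (Suc 0)))) \<and>
    card (carrier (lcs_factor E (Suc (Suc 0)))) ^ 2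
      \<le> card (carrier (lcs_factor G (Suc 0))) ^ (min_gens G - 1)"
proof -
  let ?B = "lcs_factor G (Suc 0)" and ?C = "lcs_factor E (Suc (Suc 0))"
  let ?f = "factor_commutator E (Suc 0)" and ?\<rho> = "factor_map (Suc 0)"
  have lc1: "lower_central E (Suc 0) = carrier E" by simp
  interpret B: comm_group ?B by (rule H.comm_group_lcs_factor)
  interpret C: comm_group ?C by (rule G.comm_group_lcs_factor)
  have finB: "finite (carrier ?B)" using fin by (rule finite_lcs_factor)
  have left: "group_hom E ?C (\<lambda>x. ?f x y)" if "y \<in> carrier E" for y
    using G.factor_commutator_hom_left[OF that, of 0] by simp
  have right: "group_hom E ?C (?f x)" if "x \<in> carrier E" for x
    using G.factor_commutator_hom_right[of x 0] that by simp
  have \<rho>: "group_hom E ?B ?\<rho>" using factor_map_hom[of 0] by simp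
  interpret \<rho>: group_hom E ?B ?\<rho> by (rule \<rho>)
  have \<rho>_img: "?\<rho> ` carrier E = carrier ?B" using factor_map_image[of "Suc 0"] by simp
  have fcl: "?f x y \<in> carrier ?C" if "x \<in> carrier E" "y \<in> carrier E" for x y
    using G.factor_commutator_closed[of x 0 y] that by simp
  have skew: "inv\<^bsub>?C\<^esub> (?f x y) = ?f y x" if "x \<in> carrier E" "y \<in> carrier E" for x y
    using that by (rule G.inv_factor_commutator)
  have wdl: "?f x y = ?f x' y" if x: "x \<in> carrier E" "x' \<in> carrier E" "?\<rho> x = ?\<rho> x'" and y: "y \<in> carrier E" for x x' y
  proof -
    interpret l: group_hom E ?C "\<lambda>x. ?f x y" using y by (rule left)
    let ?k = "x \<otimes> inv x'"
    have k: "?k \<in> carrier E" using x by simp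
    have "?\<rho> ?k = \<one>\<^bsub>?B\<^esub>" using x(1,2) by (simp add: x(3))
    then have "\<pi> ?k \<in> lower_central G (Suc (Suc 0))"
      using factor_map_eq_one[OF k] unfolding one_lcs_factor by blast
    then have "?f ?k y = \<one>\<^bsub>?C\<^esub>" using factor_commutator_trivial[of ?k 0 y] k y by (simp add: one_lcs_factor)
    then have "?f x y \<otimes>\<^bsub>?C\<^esub> inv\<^bsub>?C\<^esub> (?f x' y) = \<one>\<^bsub>?C\<^esub>" using x(1,2) by simp
    then show ?thesis using C.inv_solve_right'[of "\<one>\<^bsub>?C\<^esub>" "?f x y" "?f x' y"] fcl x y by simp
  qed
  have wdr: "?f y x = ?f y x'" if x: "x \<in> carrier E" "x' \<in> carrier E" "?\<rho> x = ?\<rho> x'" and y: "y \<in> carrier E" for x x' y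
    using wdl[OF x y] skew x y by metis
  define s where "s = inv_into (carrier E) ?\<rho>"
  have s: "s b \<in> carrier E" "?\<rho> (s b) = b" if "b \<in> carrier ?B" for b
    using that unfolding s_def \<rho>_img[symmetric] by (rule inv_into_into f_inv_into_f)+
  define \<beta> where "\<beta> a b = ?f (s a) (s b)" for a b
  have \<beta>cl: "\<beta> a b \<in> carrier ?C" if "a \<in> carrier ?B" "b \<in> carrier ?B" for a b
    unfolding \<beta>_def using fcl s that by simp
  have \<beta>skew: "\<beta> b a = inv\<^bsub>?C\<^esub> (\<beta> a b)" if "a \<in> carrier ?B" "b \<in> carrier ?B" for a b
    unfolding \<beta>_def using skew s that by simp
  have \<beta>lin: "\<beta> c (a \<otimes>\<^bsub>?B\<^esub> b) = \<beta> c a \<otimes>\<^bsub>?C\<^esub> \<beta> c b"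
    if "a \<in> carrier ?B" "b \<in> carrier ?B" "c \<in> carrier ?B" for a b c
  proof -
    interpret r: group_hom E ?C "?f (s c)" using s that by (intro right) auto
    have "?\<rho> (s (a \<otimes>\<^bsub>?B\<^esub> b)) = ?\<rho> (s a \<otimes> s b)"
      using s that \<rho>.hom_mult[OF s(1)[OF that(1)] s(1)[OF that(2)]] by simp
    then have "\<beta> c (a \<otimes>\<^bsub>?B\<^esub> b) = ?f (s c) (s a \<otimes> s b)" unfolding \<beta>_def using s that by (intro wdr) auto
    then show ?thesis using r.hom_mult[OF s(1)[OF that(1)] s(1)[OF that(2)]] by (simp add: \<beta>_def)
  qed
  have \<beta>alt: "\<beta> a a = \<one>\<^bsub>?C\<^esub>" if "a \<in> carrier ?B" for a
    unfolding \<beta>_def by (rule G.factor_commutator_eq_one) (simp add: s[OF that])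
  obtain S0 where S0: "S0 \<subseteq> carrier G" "finite S0" "card S0 = min_gens G" "generate G S0 = carrier G"
    using min_gens_attained[OF H.is_group fin] by blast
  let ?q = "\<lambda>x. lower_central G (Suc (Suc 0)) #>\<^bsub>G\<^esub> x"
  define S where "S = ?q ` S0"
  have qhom: "group_hom G ?B ?q" using H.hom_lcs_factor[of 0] by simp
  have cB: "carrier ?B = ?q ` carrier G" by (simp add: carrier_lcs_factor)
  have S: "finite S" "S \<subseteq> carrier ?B" "card S \<le> min_gens G"
    using S0 card_image_le[of S0 ?q] by (auto simp: S_def cB)
  have genS: "generate ?B S = carrier ?B" unfolding S_def group_hom.generate_img[OF qhom S0(1)] S0(4) cB ..
  let ?T = "{\<beta> x y | x y. x \<in> S \<and> y \<in> S}"
  have bound: "finite (generate ?C ?T) \<and> card (generate ?C ?T) ^ 2 \<le> card (generate ?B S) ^ (card S - 1)"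
    using \<beta>cl \<beta>lin \<beta>alt \<beta>skew S(1,2)
    by (intro alternating_map_bound[OF B.comm_group_axioms finB C.comm_group_axioms])
  have Tsub: "?T \<subseteq> carrier ?C" using \<beta>cl S(2) by blast
  have W: "subgroup (generate ?C ?T) ?C" using Tsub by (rule C.generate_is_subgroup)
  have \<beta>hom: "group_hom ?B ?C (\<beta> a)" if "a \<in> carrier ?B" for a
  proof -
    have "\<beta> a \<in> hom ?B ?C" using that \<beta>cl \<beta>lin by (auto intro!: homI)
    then show ?thesis using B.is_group C.is_group by (simp add: group_hom_def group_hom_axioms_def)
  qed
  have span: "\<beta> a b \<in> generate ?C ?T" if "a \<in> carrier ?B" "b \<in> carrier ?B" for a b
    by (rule skew_map_in_subgroup[OF B.is_group \<beta>hom \<beta>skew S(2) genS W _ that]) (blast intro: generate.incl)+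
  have "{?f x y | x y. x \<in> lower_central E (Suc 0) \<and> y \<in> carrier E} \<subseteq> generate ?C ?T"
  proof clarify
    fix x y assume "x \<in> lower_central E (Suc 0)" and y: "y \<in> carrier E"
    then have x: "x \<in> carrier E" by simp
    have *: "?\<rho> x \<in> carrier ?B" "?\<rho> y \<in> carrier ?B" using x y by auto
    have "?f x y = ?f (s (?\<rho> x)) y" using x y s[OF *(1)] by (intro wdl) auto
    also have "\<dots> = \<beta> (?\<rho> x) (?\<rho> y)" unfolding \<beta>_def using x y s[OF *(1)] s[OF *(2)] by (intro wdr) auto
    finally show "?f x y \<in> generate ?C ?T" using span[OF *] by simp
  qed
  then have "carrier ?C \<subseteq> generate ?C ?T"
    unfolding G.generate_factor_commutators[of 0, symmetric] using W by (rule C.generate_subgroup_incl)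
  then have "generate ?C ?T = carrier ?C" using C.generate_incl[OF Tsub] by blast
  then have "finite (carrier ?C) \<and> card (carrier ?C) ^ 2 \<le> card (carrier ?B) ^ (card S - 1)"
    using bound genS by simp
  moreover have "card (carrier ?B) ^ (card S - 1) \<le> card (carrier ?B) ^ (min_gens G - 1)"
    using S(3) finB B.one_closed by (intro power_increasing diff_le_mono) (auto simp: Suc_le_eq card_gt_0_iff)
  ultimately show ?thesis by linarith
qed

text \<open>This is \<open>jacobi_bound\<close> for \<gamma>2 G/\<gamma>3 G and \<gamma>3
  E/\<gamma>4 E, with commutators of lifted generators of G/Z(G) as edge values. They generate
  \<gamma>2 G/\<gamma>3 G because a commutator with a central element of \<open>G\<close> is 1 and
  swapping the entries only inverts.\<close>

lemma jacobi_factor_bound: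
  assumes p: "Factorial_Ring.prime p" and ord: "card (carrier G) = p ^ m"
    and rt: "min_gens (G Mod grp_center G) choose 2
        \<le> min_gens (lcs_factor G (Suc (Suc 0))) + (r choose 2) + t" "t < r"
  shows "finite (carrier (lcs_factor E (Suc (Suc (Suc 0))))) \<and>
    card (carrier (lcs_factor E (Suc (Suc (Suc 0))))) * p ^ (min_gens (G Mod grp_center G) choose 3)
    \<le> card (carrier (lcs_factor G (Suc (Suc 0)))) ^ min_gens (G Mod grp_center G)
        * p ^ ((r choose 3) + (t choose 2))"
proof -
  let ?d = "min_gens (G Mod grp_center G)"
  let ?U = "lcs_factor G (Suc (Suc 0))" and ?C = "lcs_factor E (Suc (Suc (Suc 0)))"
  let ?N = "lower_central E (Suc (Suc (Suc (Suc 0))))"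
  have fin: "finite (carrier G)" using finite_of_card_prime_power[OF p ord] .
  obtain y where y: "\<And>j::nat. y j \<in> carrier E" and gen: "generate E (y ` {..<?d} \<union> center_lift) = carrier E"
    using obtain_center_lift_generators[OF fin] by blast
  obtain b where b: "\<And>j. j < ?d \<Longrightarrow> b j \<in> hom ?U ?C"
      "\<And>j x. j < ?d \<Longrightarrow> x \<in> lower_central E (Suc (Suc 0)) \<Longrightarrow>
        b j (factor_map (Suc (Suc 0)) x) = factor_commutator E (Suc (Suc 0)) x (y j)"
      "generate ?C (\<Union>j<?d. b j ` carrier ?U) = carrier ?C"
    using obtain_generating_homs[OF y gen, of 0] by metis
  interpret U: comm_group ?U by (rule H.comm_group_lcs_factor)
  interpret C: comm_group ?C by (rule G.comm_group_lcs_factor)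
  interpret q: group_hom E "E Mod ?N" "\<lambda>x. ?N #> x" by (rule G.quotient_lower_central)
  let ?c = "\<lambda>i j. commutator E (y i) (y j)"
  have c: "commutator E e f \<in> lower_central E (Suc (Suc 0))" if "e \<in> carrier E" "f \<in> carrier E" for e f
    using G.commutator_in_lower_central[of e 0 f] that by simp
  \<comment> \<open>\<open>Min\<close> and \<open>Max\<close> orient the unordered pair; the
    opposite orientation would give the inverse value.\<close>
  define u where "u e = factor_map (Suc (Suc 0)) (?c (Min e) (Max e))" for e :: "nat set"
  have u2: "u {i,j} = factor_map (Suc (Suc 0)) (?c i j)" if "i < j" for i j using that by (simp add: u_def)
  have ucl: "u e \<in> carrier ?U" for e unfolding u_def using factor_map_image[of "Suc (Suc 0)"] c y by blast
  let ?P = "u ` {e. e \<subseteq> {..<?d} \<and> card e = 2}"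
  have W: "subgroup (generate ?U ?P) ?U" using ucl by (intro U.generate_is_subgroup) auto
  let ?g = "factor_commutator G (Suc 0)"
  have fm: "factor_map (Suc (Suc 0)) (commutator E e f) = ?g (\<pi> e) (\<pi> f)"
    if "e \<in> carrier E" "f \<in> carrier E" for e f
    using that by (simp add: factor_map_def factor_commutator_def hom_commutator)
  have one_in: "?g z x \<in> generate ?U ?P" if "commutator G z x = \<one>\<^bsub>G\<^esub>" for z x
    using H.factor_commutator_eq_one[OF that] by (simp add: generate.one)
  have ylt: "?g (\<pi> (y i)) (\<pi> (y j)) \<in> generate ?U ?P" if "i < j" "j < ?d" for i j
  proof -
    have "u {i,j} \<in> ?P" using that by (intro imageI) auto
    then show ?thesis using u2[OF that(1)] fm y by (simp add: generate.incl)
  qed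
  let ?S = "\<pi> ` (y ` {..<?d} \<union> center_lift)"
  have Y: "y ` {..<?d} \<union> center_lift \<subseteq> carrier E" using y by (auto simp: center_lift_def)
  then have S: "?S \<subseteq> carrier G" by auto
  have genS: "generate G ?S = carrier G" using generate_img[OF Y] gen surj by simp
  have right: "group_hom G ?U (?g x)" if "x \<in> carrier G" for x
    using H.factor_commutator_hom_right[of x 0] that by simp
  have base: "?g x h \<in> generate ?U ?P" if x: "x \<in> ?S" and h: "h \<in> ?S" for x h
  proof -
    have xh: "x \<in> carrier G" "h \<in> carrier G" using x h S by auto
    show ?thesis
    proof (cases "x \<in> grp_center G \<or> h \<in> grp_center G")
      case True
      then have "commutator G x h = \<one>\<^bsub>G\<^esub>" using H.commutator_grp_center xh by blast
      then show ?thesis by (rule one_in)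
    next
      case False
      then obtain i j where ij: "i < ?d" "x = \<pi> (y i)" "j < ?d" "h = \<pi> (y j)"
        using x h by (auto simp: center_lift_def)
      consider "i < j" | "i = j" | "j < i" by linarith
      then show ?thesis
      proof cases
        case 1 then show ?thesis using ylt ij by simp
      next
        case 2 then show ?thesis using ij y by (intro one_in) simp
      next
        case 3
        then have "?g h x \<in> generate ?U ?P" using ylt ij by simp
        then have "inv\<^bsub>?U\<^esub> (?g h x) \<in> generate ?U ?P" by (rule subgroup.m_inv_closed[OF W])
        then show ?thesis using H.inv_factor_commutator[OF xh(2,1)] by simp
      qed
    qed
  qed
  have span: "?g x h \<in> generate ?U ?P" if "x \<in> carrier G" "h \<in> carrier G" for x h
    using H.is_group right H.inv_factor_commutator[symmetric] S genS W base that by (rule skew_map_in_subgroup)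
  have genU: "generate ?U ?P = carrier ?U"
  proof
    show "generate ?U ?P \<subseteq> carrier ?U" using ucl by (intro U.generate_incl) auto
    have "{?g x h | x h. x \<in> lower_central G (Suc 0) \<and> h \<in> carrier G} \<subseteq> generate ?U ?P" using span by auto
    then show "carrier ?U \<subseteq> generate ?U ?P"
      unfolding H.generate_factor_commutators[of 0, symmetric] using W by (rule U.generate_subgroup_incl)
  qed
  \<comment> \<open>E/\<gamma>4 E has class at most three, which is what
    \<open>jacobi_class_three\<close> asks for.\<close>
  have cent: "commutator (E Mod ?N) (commutator (E Mod ?N) A B) D \<in> grp_center (E Mod ?N)"
    if ABD: "A \<in> carrier (E Mod ?N)" "B \<in> carrier (E Mod ?N)" "D \<in> carrier (E Mod ?N)" for A B D
  proof -
    obtain a b d where abd: "a \<in> carrier E" "A = ?N #> a" "b \<in> carrier E" "B = ?N #> b"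
      "d \<in> carrier E" "D = ?N #> d" using ABD unfolding carrier_FactGroup by blast
    have "commutator (E Mod ?N) (commutator (E Mod ?N) A B) D = factor_commutator E (Suc (Suc 0)) (commutator E a b) d"
      using abd q.hom_commutator[of a b] G.factor_commutator_eq_commutator[of "commutator E a b" d "Suc (Suc 0)"] by simp
    then show ?thesis using G.factor_commutator_central[OF c] abd by simp
  qed
  have jac: "b k (u {i,j}) \<otimes>\<^bsub>?C\<^esub> b i (u {j,k}) \<otimes>\<^bsub>?C\<^esub> inv\<^bsub>?C\<^esub> (b j (u {i,k})) = \<one>\<^bsub>?C\<^esub>"
    if ijk: "i < j" "j < k" "k < ?d" for i j k
  proof -
    let ?q = "\<lambda>i. ?N #> y i"
    have val: "b l (u {i',j'}) = commutator (E Mod ?N) (commutator (E Mod ?N) (?q i') (?q j')) (?q l)"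
      if "l < ?d" "i' < j'" for l i' j' using that b(2)[OF _ c[OF y y]] y q.hom_commutator[OF y y]
      by (simp add: u2 G.factor_commutator_eq_commutator)
    have inC: "b j (u {i,k}) \<in> carrier ?C" using b(1)[of j] ucl ijk by (auto simp: hom_def)
    have "inv\<^bsub>?C\<^esub> (b j (u {i,k})) = inv\<^bsub>E Mod ?N\<^esub> (b j (u {i,k}))"
      using q.H.m_inv_consistent[OF G.subgroup_factor[of "Suc (Suc (Suc (Suc 0)))" "Suc (Suc (Suc 0))"]] inC
      unfolding carrier_lcs_factor by (simp add: lcs_factor_def)
    then show ?thesis unfolding mult_lcs_factor one_lcs_factor
      using q.H.jacobi_class_three[OF cent, of "?q i" "?q j" "?q k"] q.hom_closed y ijk by (simp add: val)
  qed
  obtain a' where "card (lower_central G (Suc (Suc 0))) = p ^ a'"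
    using H.card_subgroup_prime_power[OF p ord H.subgroup_lower_central] .
  then have "card (carrier ?U) dvd p ^ a'" using H.card_lcs_factor[of "Suc 0"] by (metis dvd_triv_left)
  then obtain a where a: "card (carrier ?U) = p ^ a" using divides_primepow_nat[OF p] by blast
  show ?thesis
    using U.comm_group_axioms finite_lcs_factor[OF fin] a p C.comm_group_axioms b(1,3) ucl genU jac rt
    by (rule jacobi_bound)
qed

text \<open>Three bounds are multiplied: the alternating one for \<gamma>2 E/\<gamma>3 E, the Jacobi
  one for \<gamma>3 E/\<gamma>4 E and the plain one for \<gamma>4 E. The last two combine because
  |\<gamma>2 G/\<gamma>3 G| |\<gamma>3 G| = |\<gamma>2 G|.\<close>

lemma card_derived_bound:
  assumes p: "Factorial_Ring.prime p" and ord: "card (carrier G) = p ^ m"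
    and rt: "min_gens (G Mod grp_center G) choose 2
        \<le> min_gens (lcs_factor G (Suc (Suc 0))) + (r choose 2) + t" "t < r"
  defines "\<delta> \<equiv> min_gens (G Mod grp_center G)"
  shows "finite (lower_central E (Suc (Suc 0))) \<and>
    card (lower_central E (Suc (Suc 0))) ^ 2 * p ^ (2 * (\<delta> choose 3))
    \<le> card (carrier (lcs_factor G (Suc 0))) ^ (min_gens G - 1)
       * card (lower_central G (Suc (Suc 0))) ^ (2 * \<delta>) * p ^ (2 * ((r choose 3) + (t choose 2)))"
proof -
  have fin: "finite (carrier G)" using finite_of_card_prime_power[OF p ord] .
  obtain c where nil: "lower_central G (Suc c) = {\<one>\<^bsub>G\<^esub>}" using H.p_group_nilpotent[OF p ord] .
  let ?C2 = "carrier (lcs_factor E (Suc (Suc 0)))"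
  let ?C3 = "carrier (lcs_factor E (Suc (Suc (Suc 0))))"
  let ?U = "carrier (lcs_factor G (Suc (Suc 0)))"
  let ?L2 = "lower_central E (Suc (Suc 0))" and ?L3 = "lower_central E (Suc (Suc (Suc 0)))"
    and ?L4 = "lower_central E (Suc (Suc (Suc (Suc 0))))"
  let ?G2 = "lower_central G (Suc (Suc 0))" and ?G3 = "lower_central G (Suc (Suc (Suc 0)))"
  let ?B = "card (carrier (lcs_factor G (Suc 0))) ^ (min_gens G - 1)"
  let ?e = "\<delta> choose 3" and ?f = "(r choose 3) + (t choose 2)"
  have C2: "finite ?C2" "card ?C2 ^ 2 \<le> ?B" using card_second_factor_le[OF fin] by auto
  have C3: "finite ?C3" "card ?C3 * p ^ ?e \<le> card ?U ^ \<delta> * p ^ ?f"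
    using jacobi_factor_bound[OF p ord rt] unfolding \<delta>_def by auto
  have L4: "finite ?L4" "card ?L4 \<le> card ?G3 ^ \<delta>"
    using card_lower_central_le[OF fin nil, of "Suc 0"] unfolding \<delta>_def by auto
  have L3: "finite ?L3" using C3(1) L4(1) by (rule finite_lower_central_step)
  have "card ?L3 * p ^ ?e = (card ?C3 * p ^ ?e) * card ?L4"
    using G.card_lcs_factor[of "Suc (Suc 0)"] by (simp add: mult_ac)
  also have "\<dots> \<le> (card ?U ^ \<delta> * p ^ ?f) * card ?G3 ^ \<delta>" using C3(2) L4(2) by (rule mult_le_mono)
  also have "\<dots> = card ?G2 ^ \<delta> * p ^ ?f" using H.card_lcs_factor[of "Suc 0"] by (simp add: power_mult_distrib)
  finally have "card ?L3 * p ^ ?e \<le> card ?G2 ^ \<delta> * p ^ ?f" .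
  then have "(card ?L3 * p ^ ?e) ^ 2 \<le> (card ?G2 ^ \<delta> * p ^ ?f) ^ 2" by (rule power_mono) simp
  then have "card ?C2 ^ 2 * (card ?L3 * p ^ ?e) ^ 2 \<le> ?B * (card ?G2 ^ \<delta> * p ^ ?f) ^ 2"
    using C2(2) by (rule mult_le_mono[rotated])
  moreover have "card ?C2 ^ 2 * (card ?L3 * p ^ ?e) ^ 2 = card ?L2 ^ 2 * p ^ (2 * ?e)"
    using G.card_lcs_factor[of "Suc 0"] by (simp add: power_mult_distrib power_mult[symmetric] mult_ac)
  moreover have "?B * (card ?G2 ^ \<delta> * p ^ ?f) ^ 2 = ?B * card ?G2 ^ (2 * \<delta>) * p ^ (2 * ?f)"
    by (simp add: power_mult_distrib power_mult[symmetric] mult_ac)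
  ultimately show ?thesis using finite_lower_central_step[OF C2(1) L3] by linarith
qed

end

section \<open>Characters and the cocycle extension\<close>

lemma exists_nth_root_complex:
  assumes "0 < n" obtains w :: complex where "w ^ n = c"
proof -
  have "rcis (root n (cmod c)) (Arg c / real n) ^ n = rcis (root n (cmod c) ^ n) (real n * (Arg c / real n))"
    by (rule DeMoivre2)
  also have "\<dots> = c" using assms by (simp add: rcis_cmod_Arg)
  finally show ?thesis using that by blast
qed

text \<open>With \<open>q\<close> the order of \<open>x\<close> modulo \<open>H\<close>, any
  \<open>q\<close>-th root \<open>w\<close> of the value at \<open>x [^] q\<close> is an admissible
  value at \<open>x\<close>. The form \<open>h \<otimes> x [^] i\<close> with i < q is unique; when
  exponents add up to \<open>q\<close> or more, \<open>x [^] q\<close> is moved into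
  \<open>H\<close>.\<close>

lemma (in comm_group) extend_character_insert:
  fixes \<chi> :: "'a \<Rightarrow> complex"
  assumes H: "subgroup H G" and x: "x \<in> carrier G" and n: "0 < n" "x [^] (n::nat) \<in> H"
    and nz: "\<And>h. h \<in> H \<Longrightarrow> \<chi> h \<noteq> 0"
    and mult: "\<And>h k. \<lbrakk>h \<in> H; k \<in> H\<rbrakk> \<Longrightarrow> \<chi> (h \<otimes> k) = \<chi> h * \<chi> k"
  obtains \<psi> where "\<And>h. h \<in> H \<Longrightarrow> \<psi> h = \<chi> h"
    "\<And>h. h \<in> generate G (insert x H) \<Longrightarrow> \<psi> h \<noteq> 0"
    "\<And>h k. \<lbrakk>h \<in> generate G (insert x H); k \<in> generate G (insert x H)\<rbrakk> \<Longrightarrow> \<psi> (h \<otimes> k) = \<psi> h * \<psi> k"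
proof -
  interpret H: subgroup H G by fact
  define q where "q = relative_order G H x"
  have q: "0 < q" "x [^] q \<in> H" unfolding q_def using relative_order[OF H x n] by auto
  let ?f = "\<lambda>(h,i). h \<otimes> x [^] (i::nat)"
  have inj: "inj_on ?f (H \<times> {..<q})" unfolding q_def by (rule inj_on_mult_powers[OF H x n])
  have gen: "generate G (insert x H) = ?f ` (H \<times> {..<q})" by (rule generate_insert_powers[OF H x q])
  obtain w where w: "w ^ q = \<chi> (x [^] q)" using exists_nth_root_complex[OF q(1)] .
  have wnz: "w \<noteq> 0" using w nz[OF q(2)] q(1) by (metis power_0_left not_gr_zero)
  define \<psi> where "\<psi> y = (case the_inv_into (H \<times> {..<q}) ?f y of (h,i) \<Rightarrow> \<chi> h * w ^ i)" for y
  have val: "\<psi> (h \<otimes> x [^] i) = \<chi> h * w ^ i" if "h \<in> H" "i < q" for h i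
    using the_inv_into_f_f[OF inj, of "(h,i)"] that by (simp add: \<psi>_def)
  have ext: "\<psi> h = \<chi> h" if "h \<in> H" for h using val[OF that q(1)] that by simp
  have nzero: "\<psi> h \<noteq> 0" if "h \<in> generate G (insert x H)" for h
    using that wnz nz unfolding gen by (auto simp: val)
  have "\<psi> (a \<otimes> b) = \<psi> a * \<psi> b"
    if a: "a \<in> generate G (insert x H)" and b: "b \<in> generate G (insert x H)" for a b
  proof -
    obtain h i where h: "h \<in> H" "i < q" "a = h \<otimes> x [^] i" using a unfolding gen by auto
    obtain k j where k: "k \<in> H" "j < q" "b = k \<otimes> x [^] j" using b unfolding gen by auto
    have ab: "a \<otimes> b = (h \<otimes> k) \<otimes> x [^] (i + j)"
      using h(1,3) k(1,3) x by (simp add: nat_pow_mult[symmetric] m_ac)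
    show ?thesis
    proof (cases "i + j < q")
      case True
      then have "\<psi> (a \<otimes> b) = \<chi> (h \<otimes> k) * w ^ (i + j)" unfolding ab using h(1) k(1) by (intro val) auto
      then show ?thesis using h k by (simp add: mult val power_add)
    next
      case False
      have "x [^] (i + j) = x [^] q \<otimes> x [^] (i + j - q)" using False x by (simp add: nat_pow_mult)
      then have "a \<otimes> b = ((h \<otimes> k) \<otimes> x [^] q) \<otimes> x [^] (i + j - q)"
        unfolding ab using h(1) k(1) x by (simp add: m_assoc)
      moreover have "\<psi> (((h \<otimes> k) \<otimes> x [^] q) \<otimes> x [^] (i + j - q)) = \<chi> ((h \<otimes> k) \<otimes> x [^] q) * w ^ (i + j - q)"
        using h(1,2) k(1,2) q(2) False by (intro val) auto
      moreover have "\<chi> ((h \<otimes> k) \<otimes> x [^] q) = \<chi> h * \<chi> k * w ^ q" using h(1) k(1) q(2) by (simp add: mult w)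
      moreover have "w ^ q * w ^ (i + j - q) = w ^ i * w ^ j" using False by (simp add: power_add[symmetric])
      ultimately show ?thesis using h k by (simp add: val mult_ac)
    qed
  qed
  with ext nzero show ?thesis using that by blast
qed

text \<open>The group may be infinite: finitely many elements, each with a power in
  \<open>H\<close>, are adjoined one by one.\<close>

lemma (in comm_group) extend_character:
  fixes \<chi> :: "'a \<Rightarrow> complex"
  assumes H: "subgroup H G" and F: "finite F" "F \<subseteq> carrier G"
    and tors: "\<And>x. x \<in> F \<Longrightarrow> \<exists>n>0. x [^] (n::nat) \<in> H"
    and nz: "\<And>h. h \<in> H \<Longrightarrow> \<chi> h \<noteq> 0"
    and mult: "\<And>h k. \<lbrakk>h \<in> H; k \<in> H\<rbrakk> \<Longrightarrow> \<chi> (h \<otimes> k) = \<chi> h * \<chi> k"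
  shows "\<exists>\<psi>. (\<forall>h\<in>H. \<psi> h = \<chi> h) \<and> (\<forall>h\<in>generate G (H \<union> F). \<psi> h \<noteq> 0) \<and>
    (\<forall>h\<in>generate G (H \<union> F). \<forall>k\<in>generate G (H \<union> F). \<psi> (h \<otimes> k) = \<psi> h * \<psi> k)" using F tors
proof (induction F rule: finite_induct)
  case empty
  have "generate G H = H" using generate_subgroup_incl[OF subset_refl H] by (auto intro: generate.incl)
  then show ?case using nz mult by auto
next
  case (insert x F)
  let ?K = "generate G (H \<union> F)"
  have HF: "H \<union> F \<subseteq> carrier G" using insert.prems(1) subgroup.subset[OF H] by blast
  have K: "subgroup ?K G" using HF by (rule generate_is_subgroup)
  obtain \<psi> where \<psi>: "\<forall>h\<in>H. \<psi> h = \<chi> h" "\<forall>h\<in>?K. \<psi> h \<noteq> 0"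
    "\<forall>h\<in>?K. \<forall>k\<in>?K. \<psi> (h \<otimes> k) = \<psi> h * \<psi> k" using insert.IH insert.prems by auto
  obtain n where n: "0 < n" "x [^] (n::nat) \<in> H" using insert.prems(2) by blast
  have x: "x \<in> carrier G" using insert.prems by blast
  have nK: "x [^] n \<in> ?K" using n(2) by (intro generate.incl) blast
  obtain \<phi> where \<phi>: "\<And>h. h \<in> ?K \<Longrightarrow> \<phi> h = \<psi> h"
    "\<And>h. h \<in> generate G (insert x ?K) \<Longrightarrow> \<phi> h \<noteq> 0"
    "\<And>h k. h \<in> generate G (insert x ?K) \<Longrightarrow> k \<in> generate G (insert x ?K) \<Longrightarrow> \<phi> (h \<otimes> k) = \<phi> h * \<phi> k"
    by (rule extend_character_insert[OF K x n(1) nK, of \<psi>]) (use \<psi> in blast)+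
  have "generate G (insert x ?K) = generate G (H \<union> insert x F)"
    using generate_Un_generate[OF HF, of "{x}"] x by simp
  moreover have "\<phi> h = \<chi> h" if "h \<in> H" for h using \<phi>(1)[of h] \<psi>(1) that by (simp add: generate.incl)
  ultimately show ?case using \<phi>(2,3) by (intro exI[of _ \<phi>]) auto
qed

text \<open>Orthogonality of characters: the square norm of the sum of all \<open>\<chi> \<in> A\<close> is \<open>|A| |G|\<close>,
  and its value at \<open>\<one>\<close> alone contributes \<open>|A|\<^sup>2\<close>.\<close>
lemma (in group) card_characters_le:
  fixes A :: "('a \<Rightarrow> complex) set"
  assumes fin: "finite (carrier G)" and finA: "finite A"
    and nz: "\<And>\<chi> x. \<lbrakk>\<chi> \<in> A; x \<in> carrier G\<rbrakk> \<Longrightarrow> \<chi> x \<noteq> 0"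
    and mult: "\<And>\<chi> x y. \<lbrakk>\<chi> \<in> A; x \<in> carrier G; y \<in> carrier G\<rbrakk> \<Longrightarrow> \<chi> (x \<otimes> y) = \<chi> x * \<chi> y"
    and dist: "\<And>\<chi> \<psi>. \<lbrakk>\<chi> \<in> A; \<psi> \<in> A; \<And>x. x \<in> carrier G \<Longrightarrow> \<chi> x = \<psi> x\<rbrakk> \<Longrightarrow> \<chi> = \<psi>"
  shows "card A \<le> card (carrier G)"
proof -
  have one: "\<chi> \<one> = 1" if "\<chi> \<in> A" for \<chi> using mult[OF that, of \<one> \<one>] nz[OF that, of \<one>] by simp
  have unit: "\<chi> x * cnj (\<chi> x) = 1" if \<chi>: "\<chi> \<in> A" and x: "x \<in> carrier G" for \<chi> x
  proof -
    have pow: "\<chi> (x [^] (n::nat)) = \<chi> x ^ n" for n by (induction n) (use one[OF \<chi>] mult[OF \<chi>] x in auto)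
    have "\<chi> x ^ order G = 1" using pow[of "order G"] pow_order_eq_1[OF x] one[OF \<chi>] by simp
    then have "cmod (\<chi> x) ^ order G = 1 ^ order G" by (metis norm_one norm_power power_one)
    then have "cmod (\<chi> x) = 1" using fin order_gt_0_iff_finite by (subst (asm) power_eq_iff_eq_base) auto
    then show ?thesis using complex_norm_square[of "\<chi> x"] by simp
  qed
  have orth: "(\<Sum>x\<in>carrier G. \<chi> x * cnj (\<psi> x)) = (if \<chi> = \<psi> then of_nat (card (carrier G)) else 0)"
    if \<chi>: "\<chi> \<in> A" and \<psi>: "\<psi> \<in> A" for \<chi> \<psi>
  proof (cases "\<chi> = \<psi>")
    case True
    then show ?thesis using unit[OF \<chi>] by simp
  next
    case False
    then obtain a where a: "a \<in> carrier G" "\<chi> a \<noteq> \<psi> a" using dist[OF \<chi> \<psi>] by blast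
    let ?S = "\<Sum>x\<in>carrier G. \<chi> x * cnj (\<psi> x)"
    have "?S = (\<Sum>x\<in>carrier G. \<chi> (a \<otimes> x) * cnj (\<psi> (a \<otimes> x)))"
      by (rule sum.reindex_bij_witness[of _ "\<lambda>x. a \<otimes> x" "\<lambda>x. inv a \<otimes> x"])
        (use a(1) in \<open>auto simp: m_assoc[symmetric]\<close>)
    also have "\<dots> = (\<Sum>x\<in>carrier G. (\<chi> a * cnj (\<psi> a)) * (\<chi> x * cnj (\<psi> x)))"
      using a(1) mult[OF \<chi>] mult[OF \<psi>] by (intro sum.cong refl) simp
    also have "\<dots> = (\<chi> a * cnj (\<psi> a)) * ?S" by (simp add: sum_distrib_left)
    finally have "?S = (\<chi> a * cnj (\<psi> a)) * ?S" .
    moreover have "\<chi> a * cnj (\<psi> a) \<noteq> 1"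
    proof
      assume "\<chi> a * cnj (\<psi> a) = 1"
      then have "\<chi> a * (\<psi> a * cnj (\<psi> a)) = \<psi> a" by (simp add: mult_ac)
      then show False using unit[OF \<psi> a(1)] a(2) by simp
    qed
    ultimately show ?thesis using False by simp
  qed
  define \<Theta> where "\<Theta> x = (\<Sum>\<chi>\<in>A. \<chi> x)" for x
  have "complex_of_real (\<Sum>x\<in>carrier G. (cmod (\<Theta> x))\<^sup>2) = (\<Sum>x\<in>carrier G. \<Theta> x * cnj (\<Theta> x))"
    unfolding of_real_sum complex_norm_square ..
  also have "\<dots> = (\<Sum>x\<in>carrier G. \<Sum>\<chi>\<in>A. \<Sum>\<psi>\<in>A. \<chi> x * cnj (\<psi> x))" by (simp add: \<Theta>_def sum_product)
  also have "\<dots> = (\<Sum>\<chi>\<in>A. \<Sum>\<psi>\<in>A. \<Sum>x\<in>carrier G. \<chi> x * cnj (\<psi> x))"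
    by (subst sum.swap) (intro sum.cong refl sum.swap)
  also have "\<dots> = (\<Sum>\<chi>\<in>A. \<Sum>\<psi>\<in>A. if \<chi> = \<psi> then of_nat (card (carrier G)) else 0)"
    by (intro sum.cong refl) (simp add: orth)
  also have "\<dots> = complex_of_real (real (card A) * real (card (carrier G)))" using finA by simp
  finally have eq: "(\<Sum>x\<in>carrier G. (cmod (\<Theta> x))\<^sup>2) = real (card A) * real (card (carrier G))"
    using of_real_eq_iff by blast
  have "\<Theta> \<one> = of_nat (card A)" by (simp add: \<Theta>_def one)
  then have "(real (card A))\<^sup>2 = (cmod (\<Theta> \<one>))\<^sup>2" by simp
  also have "\<dots> \<le> (\<Sum>x\<in>carrier G. (cmod (\<Theta> x))\<^sup>2)" using fin by (intro member_le_sum) auto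
  finally have "real (card A) * real (card A) \<le> real (card A) * real (card (carrier G))"
    unfolding eq by (simp add: power2_eq_square)
  then show ?thesis by (cases "card A = 0") auto
qed

section \<open>The extension twisted by all cocycles\<close>

definition cocycle_value :: "('a, 'b) monoid_scheme \<Rightarrow> ('a \<times> 'a \<Rightarrow> complex) \<Rightarrow> 'a \<Rightarrow> 'a \<Rightarrow> complex" where
  "cocycle_value G f x y = (if f \<in> schur_cocycles G then f (x, y) else 1)"

text \<open>The extension of \<open>G\<close> by a product of copies of the nonzero complex numbers, one for each
  cocycle, twisted by all cocycles simultaneously; coordinates that are not cocycles are untwisted.\<close>
definition cocycle_extension :: "('a, 'b) monoid_scheme \<Rightarrow> ((('a \<times> 'a \<Rightarrow> complex) \<Rightarrow> complex) \<times> 'a) monoid" where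
  "cocycle_extension G = \<lparr>carrier = {a. \<forall>f. a f \<noteq> 0} \<times> carrier G,
     monoid.mult = (\<lambda>(a, x) (b, y). (\<lambda>f. a f * b f * cocycle_value G f x y, x \<otimes>\<^bsub>G\<^esub> y)),
     one = (\<lambda>f. inverse (cocycle_value G f \<one>\<^bsub>G\<^esub> \<one>\<^bsub>G\<^esub>), \<one>\<^bsub>G\<^esub>)\<rparr>"

context group
begin

lemma cocycle_value_nonzero: "\<lbrakk>x \<in> carrier G; y \<in> carrier G\<rbrakk> \<Longrightarrow> cocycle_value G f x y \<noteq> 0"
  by (auto simp: cocycle_value_def schur_cocycles_def)

lemma cocycle_value_assoc:
  "\<lbrakk>x \<in> carrier G; y \<in> carrier G; z \<in> carrier G\<rbrakk> \<Longrightarrow>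
    cocycle_value G f x y * cocycle_value G f (x \<otimes> y) z = cocycle_value G f x (y \<otimes> z) * cocycle_value G f y z"
  by (auto simp: cocycle_value_def schur_cocycles_def)

text \<open>Cocycles are not normalized: the cocycle identity only makes the values at (1, x), and
  likewise at (x, 1), equal to the value at (1, 1). This is why the unit of the extension carries
  the inverse of that value.\<close>

lemma cocycle_value_one_left: "x \<in> carrier G \<Longrightarrow> cocycle_value G f \<one> x = cocycle_value G f \<one> \<one>"
  using cocycle_value_assoc[of \<one> \<one> x f] cocycle_value_nonzero[of \<one> x f] by simp

lemma cocycle_value_one_right: "x \<in> carrier G \<Longrightarrow> cocycle_value G f x \<one> = cocycle_value G f \<one> \<one>"
  using cocycle_value_assoc[of x \<one> \<one> f] cocycle_value_nonzero[of x \<one> f] by simp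

lemma carrier_cocycle_extension: "carrier (cocycle_extension G) = {a. \<forall>f. a f \<noteq> 0} \<times> carrier G"
  by (simp add: cocycle_extension_def)

lemma mult_cocycle_extension:
  "(a, x) \<otimes>\<^bsub>cocycle_extension G\<^esub> (b, y) = (\<lambda>f. a f * b f * cocycle_value G f x y, x \<otimes> y)"
  by (simp add: cocycle_extension_def)

lemma one_cocycle_extension:
  "\<one>\<^bsub>cocycle_extension G\<^esub> = (\<lambda>f. inverse (cocycle_value G f \<one> \<one>), \<one>)" by (simp add: cocycle_extension_def)

lemma group_cocycle_extension: "group (cocycle_extension G)" (is "group ?E")
proof (rule groupI)
  fix u v w
  assume "u \<in> carrier ?E" "v \<in> carrier ?E" "w \<in> carrier ?E"
  then obtain a x b y c z where uvw: "u = (a, x)" "v = (b, y)" "w = (c, z)"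
    and G: "x \<in> carrier G" "y \<in> carrier G" "z \<in> carrier G" by (auto simp: carrier_cocycle_extension)
  have e: "a f * b f * cocycle_value G f x y * c f * cocycle_value G f (x \<otimes> y) z
      = a f * (b f * c f * cocycle_value G f y z) * cocycle_value G f x (y \<otimes> z)" for f
  proof -
    have "a f * b f * cocycle_value G f x y * c f * cocycle_value G f (x \<otimes> y) z
        = a f * b f * c f * (cocycle_value G f x y * cocycle_value G f (x \<otimes> y) z)" by (simp only: mult_ac)
    also have "\<dots> = a f * (b f * c f * cocycle_value G f y z) * cocycle_value G f x (y \<otimes> z)"
      unfolding cocycle_value_assoc[OF G] by (simp only: mult_ac)
    finally show ?thesis .
  qed
  show "u \<otimes>\<^bsub>?E\<^esub> v \<otimes>\<^bsub>?E\<^esub> w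
      = u \<otimes>\<^bsub>?E\<^esub> (v \<otimes>\<^bsub>?E\<^esub> w)" unfolding uvw mult_cocycle_extension e m_assoc[OF G] ..
next
  fix u v assume "u \<in> carrier ?E" "v \<in> carrier ?E"
  then show "u \<otimes>\<^bsub>?E\<^esub> v \<in> carrier ?E"
    using cocycle_value_nonzero by (auto simp: carrier_cocycle_extension mult_cocycle_extension)
next
  show "\<one>\<^bsub>?E\<^esub> \<in> carrier ?E"
    using cocycle_value_nonzero by (auto simp: carrier_cocycle_extension one_cocycle_extension)
next
  fix u assume "u \<in> carrier ?E"
  then obtain a x where u: "u = (a, x)" "\<And>f. a f \<noteq> 0" "x \<in> carrier G"
    by (auto simp: carrier_cocycle_extension)
  show "\<one>\<^bsub>?E\<^esub> \<otimes>\<^bsub>?E\<^esub> u = u" using u cocycle_value_nonzero[of \<one> \<one>]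
    by (simp add: one_cocycle_extension mult_cocycle_extension cocycle_value_one_left[OF u(3)] field_simps)
  let ?v = "(\<lambda>f. inverse (a f * cocycle_value G f \<one> \<one> * cocycle_value G f (inv x) x), inv x)"
  have "?v \<in> carrier ?E" using u cocycle_value_nonzero by (auto simp: carrier_cocycle_extension)
  moreover have "?v \<otimes>\<^bsub>?E\<^esub> u = \<one>\<^bsub>?E\<^esub>" using u cocycle_value_nonzero[of "inv x" x]
    by (simp add: one_cocycle_extension mult_cocycle_extension field_simps)
  ultimately show "\<exists>v\<in>carrier ?E. v \<otimes>\<^bsub>?E\<^esub> u = \<one>\<^bsub>?E\<^esub>" by blast
qed

lemma central_extension_cocycle_extension: "central_extension (cocycle_extension G) G snd" (is "central_extension ?E G snd")
proof -
  interpret E: group ?E by (rule group_cocycle_extension)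
  have "snd \<in> hom ?E G" by (rule homI) (auto simp: carrier_cocycle_extension mult_cocycle_extension)
  then have hom: "group_hom ?E G snd"
    using E.is_group is_group by (simp add: group_hom_def group_hom_axioms_def)
  show ?thesis
  proof (rule central_extension.intro[OF hom], unfold_locales)
    have "(\<lambda>_. 1, x) \<in> carrier ?E" if "x \<in> carrier G" for x
      using that by (simp add: carrier_cocycle_extension)
    then have "x \<in> snd ` carrier ?E" if "x \<in> carrier G" for x
      using that by (intro image_eqI[of _ _ "(\<lambda>_. 1, x)"]) auto
    then show "snd ` carrier ?E = carrier G" by (auto simp: carrier_cocycle_extension)
    fix u assume u: "u \<in> carrier ?E" "snd u = \<one>"
    show "u \<in> grp_center ?E" unfolding grp_center_def
    proof (clarsimp simp: u(1))
      fix b y assume "(b, y) \<in> carrier ?E"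
      then have y: "y \<in> carrier G" by (simp add: carrier_cocycle_extension)
      obtain a where "u = (a, \<one>)" using u(2) by (cases u) simp
      then show "u \<otimes>\<^bsub>?E\<^esub> (b, y) = (b, y) \<otimes>\<^bsub>?E\<^esub> u"
        using y by (simp add: mult_cocycle_extension cocycle_value_one_left[OF y]
            cocycle_value_one_right[OF y] mult_ac)
    qed
  qed
qed

end

section \<open>The Schur multiplier and the cocycle extension\<close>

text \<open>The target of characters in the form of a group, so that
  \<open>hom_factor_through\<close> applies to them.\<close>

definition complex_units :: "complex monoid" where
  "complex_units = \<lparr>carrier = - {0}, monoid.mult = (*), one = 1\<rparr>"

lemma complex_units_simps [simp]:
  "carrier complex_units = - {0}" "x \<otimes>\<^bsub>complex_units\<^esub> y = x * y" "\<one>\<^bsub>complex_units\<^esub> = 1"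
  by (simp_all add: complex_units_def)

lemma group_complex_units: "group complex_units"
proof (rule groupI)
  fix x assume "x \<in> carrier complex_units"
  then show "\<exists>y\<in>carrier complex_units. y \<otimes>\<^bsub>complex_units\<^esub> x = \<one>\<^bsub>complex_units\<^esub>"
    by (intro bexI[of _ "inverse x"]) auto
qed (auto simp: mult.assoc)

text \<open>One preimage is chosen for every value of \<open>\<phi>\<close>; since equal values mean
  equivalence, each class is the class of a chosen element.\<close>

lemma card_quotient_le:
  assumes R: "equiv Z R" and fin: "finite (\<phi> ` Z)"
    and sep: "\<And>f h. \<lbrakk>f \<in> Z; h \<in> Z; \<phi> f = \<phi> h\<rbrakk> \<Longrightarrow> (f, h) \<in> R"
  shows "finite (Z // R) \<and> card (Z // R) \<le> card (\<phi> ` Z)"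
proof -
  define s where "s v = (SOME f. f \<in> Z \<and> \<phi> f = v)" for v
  have s: "s (\<phi> f) \<in> Z \<and> \<phi> (s (\<phi> f)) = \<phi> f" if "f \<in> Z" for f
    unfolding s_def using that by (intro someI_ex[of "\<lambda>g. g \<in> Z \<and> \<phi> g = \<phi> f"]) blast
  have "Z // R \<subseteq> (\<lambda>v. R `` {s v}) ` \<phi> ` Z"
  proof
    fix c assume "c \<in> Z // R"
    then obtain f where f: "f \<in> Z" "c = R `` {f}" by (auto simp: quotient_def)
    have "(s (\<phi> f), f) \<in> R" using s[OF f(1)] f(1) by (intro sep) auto
    then have "R `` {s (\<phi> f)} = c" using equiv_class_eq[OF R] f(2) by blast
    then show "c \<in> (\<lambda>v. R `` {s v}) ` \<phi> ` Z" using f(1) by blast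
  qed
  then show ?thesis using fin by (meson finite_imageI finite_subset surj_card_le)
qed

section \<open>Coboundaries and the equivalence relation of the multiplier\<close>

lemma schur_coboundaries_mult:
  assumes "f \<in> schur_coboundaries G" "h \<in> schur_coboundaries G"
  shows "(\<lambda>q. f q * h q) \<in> schur_coboundaries G"
proof -
  obtain g k where "\<forall>x\<in>carrier G. g x \<noteq> 0" "\<forall>x\<in>carrier G. \<forall>y\<in>carrier G. f (x, y) = g x * g y / g (x \<otimes>\<^bsub>G\<^esub> y)"
    "\<forall>q. q \<notin> carrier G \<times> carrier G \<longrightarrow> f q = 1"
    "\<forall>x\<in>carrier G. k x \<noteq> 0" "\<forall>x\<in>carrier G. \<forall>y\<in>carrier G. h (x, y) = k x * k y / k (x \<otimes>\<^bsub>G\<^esub> y)"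
    "\<forall>q. q \<notin> carrier G \<times> carrier G \<longrightarrow> h q = 1" using assms unfolding schur_coboundaries_def by blast
  then show ?thesis unfolding schur_coboundaries_def by (intro CollectI exI[of _ "\<lambda>x. g x * k x"]) simp
qed

lemma schur_coboundaries_inverse:
  assumes "f \<in> schur_coboundaries G"
  shows "(\<lambda>q. inverse (f q)) \<in> schur_coboundaries G"
proof -
  obtain g where "\<forall>x\<in>carrier G. g x \<noteq> 0" "\<forall>x\<in>carrier G. \<forall>y\<in>carrier G. f (x, y) = g x * g y / g (x \<otimes>\<^bsub>G\<^esub> y)"
    "\<forall>q. q \<notin> carrier G \<times> carrier G \<longrightarrow> f q = 1" using assms unfolding schur_coboundaries_def by blast
  then show ?thesis unfolding schur_coboundaries_def
    by (intro CollectI exI[of _ "\<lambda>x. inverse (g x)"]) (simp add: divide_inverse)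
qed

lemma schur_coboundaries_one: "(\<lambda>_. 1) \<in> schur_coboundaries G"
  unfolding schur_coboundaries_def by (intro CollectI exI[of _ "\<lambda>_. 1"]) simp

lemma schur_cocycles_nonzero:
  assumes "f \<in> schur_cocycles G" shows "f q \<noteq> 0"
proof -
  obtain x y where q: "q = (x, y)" by (cases q)
  show ?thesis
  proof (cases "x \<in> carrier G \<and> y \<in> carrier G")
    case True then show ?thesis using assms by (simp add: schur_cocycles_def q)
  next
    case False then show ?thesis using assms by (simp add: schur_cocycles_def q)
  qed
qed

lemma equiv_schur_rel: "equiv (schur_cocycles G) (schur_rel G)"
proof (rule equivI)
  show "schur_rel G \<subseteq> schur_cocycles G \<times> schur_cocycles G" by (auto simp: schur_rel_def)
  show "refl_on (schur_cocycles G) (schur_rel G)"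
  proof (rule refl_onI)
    fix f assume f: "f \<in> schur_cocycles G"
    have "(\<lambda>q. f q / f q) = (\<lambda>_. 1)" using schur_cocycles_nonzero[OF f] by (intro ext) (rule divide_self)
    then show "(f, f) \<in> schur_rel G" using f schur_coboundaries_one by (simp add: schur_rel_def)
  qed
  show "sym (schur_rel G)"
  proof (rule symI)
    fix f h assume "(f, h) \<in> schur_rel G"
    then show "(h, f) \<in> schur_rel G"
      using schur_coboundaries_inverse[of "\<lambda>q. f q / h q" G] by (auto simp: schur_rel_def)
  qed
  show "trans (schur_rel G)"
  proof (rule transI)
    fix f h k assume fh: "(f, h) \<in> schur_rel G" and hk: "(h, k) \<in> schur_rel G"
    have h: "h \<in> schur_cocycles G" using fh by (simp add: schur_rel_def)
    have "(\<lambda>q. (f q / h q) * (h q / k q)) = (\<lambda>q. f q / k q)"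
      using schur_cocycles_nonzero[OF h] by (intro ext) simp
    then show "(f, k) \<in> schur_rel G" using schur_coboundaries_mult[of "\<lambda>q. f q / h q" G "\<lambda>q. h q / k q"] fh hk
      by (auto simp: schur_rel_def)
  qed
qed

context group
begin

text \<open>A cocycle \<open>f\<close> induces a character of the kernel of the cocycle extension. If the characters of
  \<open>f\<close> and \<open>h\<close> agree on the derived subgroup, then their quotient extends to the whole extension,
  and its values on the canonical section exhibit \<open>f / h\<close> as a coboundary.\<close>
lemma schur_rel_of_eq_on_derived:
  assumes fin: "finite (carrier G)" and f: "f \<in> schur_cocycles G" and h: "h \<in> schur_cocycles G"
    and eq: "\<And>a. (a, \<one>) \<in> lower_central (cocycle_extension G) (Suc (Suc 0)) \<Longrightarrow>
        a f * f (\<one>, \<one>) = a h * h (\<one>, \<one>)"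
  shows "(f, h) \<in> schur_rel G"
proof -
  let ?E = "cocycle_extension G"
  interpret ext: central_extension ?E G snd by (rule central_extension_cocycle_extension)
  let ?Q = "lcs_factor ?E (Suc 0)" and ?L = "lower_central ?E (Suc (Suc 0))"
  let ?q = "\<lambda>u. ?L #>\<^bsub>?E\<^esub> u"
  interpret Q: comm_group ?Q by (rule ext.G.comm_group_lcs_factor)
  have q: "group_hom ?E ?Q ?q" using ext.G.hom_lcs_factor[of 0] by simp
  interpret q: group_hom ?E ?Q ?q by (rule q)
  have cQ: "carrier ?Q = ?q ` carrier ?E" by (simp add: carrier_lcs_factor)
  have nzf: "f p \<noteq> 0" "h p \<noteq> 0" for p by (rule schur_cocycles_nonzero[OF f] schur_cocycles_nonzero[OF h])+
  define K where "K = kernel ?E G snd"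
  have K: "subgroup K ?E" unfolding K_def by (rule ext.subgroup_kernel)
  have Kmem: "(a, x) \<in> K \<longleftrightarrow> (\<forall>k. a k \<noteq> 0) \<and> x = \<one>" for a x
    by (auto simp: K_def kernel_def carrier_cocycle_extension)
  \<comment> \<open>Multiplying kernel elements introduces a factor f(1, 1) in coordinate
    \<open>f\<close>; the extra \<open>f (\<one>, \<one>)\<close> here, and likewise for
    \<open>h\<close>, makes the map multiplicative.\<close>
  define \<chi>0 where "\<chi>0 u = (fst u f * f (\<one>, \<one>)) / (fst u h * h (\<one>, \<one>))" for u :: "(('a \<times> 'a \<Rightarrow> complex) \<Rightarrow> complex) \<times> 'a"
  have \<chi>0: "group_hom (?E\<lparr>carrier := K\<rparr>) complex_units \<chi>0"
  proof -
    have "\<chi>0 \<in> hom (?E\<lparr>carrier := K\<rparr>) complex_units"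
    proof (rule homI)
      fix u v assume "u \<in> carrier (?E\<lparr>carrier := K\<rparr>)" "v \<in> carrier (?E\<lparr>carrier := K\<rparr>)"
      then obtain a b where ab: "u = (a, \<one>)" "v = (b, \<one>)" "\<And>k. a k \<noteq> 0" "\<And>k. b k \<noteq> 0"
        using Kmem by (metis partial_object.simps(1) partial_object.surjective partial_object.update_convs(1) prod.exhaust)
      show "\<chi>0 u \<in> carrier complex_units" using ab nzf by (simp add: \<chi>0_def)
      show "\<chi>0 (u \<otimes>\<^bsub>?E\<lparr>carrier := K\<rparr>\<^esub> v) = \<chi>0 u \<otimes>\<^bsub>complex_units\<^esub> \<chi>0 v"
        using f h by (simp add: ab(1,2) mult_cocycle_extension \<chi>0_def cocycle_value_def mult_ac)
    qed
    then show ?thesis using ext.G.subgroup_imp_group[OF K] group_complex_units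
      unfolding group_hom_def group_hom_axioms_def by blast
  qed
  define H where "H = ?q ` K"
  have \<rho>: "group_hom (?E\<lparr>carrier := K\<rparr>) (?Q\<lparr>carrier := H\<rparr>) ?q"
    unfolding H_def by (rule q.induced_group_hom[OF K])
  have H: "subgroup H ?Q" unfolding H_def using K by (rule q.subgroup_img_is_subgroup)
  have ker: "\<chi>0 u = \<one>\<^bsub>complex_units\<^esub>"
    if u: "u \<in> carrier (?E\<lparr>carrier := K\<rparr>)" "?q u = \<one>\<^bsub>?Q\<lparr>carrier := H\<rparr>\<^esub>" for u
  proof -
    obtain a where a: "u = (a, \<one>)" "\<And>k. a k \<noteq> 0" using u(1) Kmem by (cases u) auto
    have uE: "u \<in> carrier ?E" using u(1) subgroup.subset[OF K] by auto
    have "u \<in> ?L" using u(2) ext.G.r_coset_lower_central_eq[OF uE] by (simp add: one_lcs_factor)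
    then have "a f * f (\<one>, \<one>) = a h * h (\<one>, \<one>)" using eq a(1) by simp
    then show ?thesis using a(2) nzf by (simp add: \<chi>0_def a(1))
  qed
  \<comment> \<open>By \<open>eq\<close> the character is trivial on the part of the kernel inside
    the derived subgroup, so it passes to the image of the kernel in the abelianization.\<close>
  obtain \<chi> where \<chi>: "\<chi> \<in> hom (?Q\<lparr>carrier := H\<rparr>) complex_units"
    "\<And>u. u \<in> carrier (?E\<lparr>carrier := K\<rparr>) \<Longrightarrow> \<chi> (?q u) = \<chi>0 u"
    using hom_factor_through[OF \<rho> _ \<chi>0 ker] by (auto simp: H_def)
  define \<sigma> where "\<sigma> x = ((\<lambda>_. 1) :: ('a \<times> 'a \<Rightarrow> complex) \<Rightarrow> complex, x)" for x :: 'a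
  have \<sigma>: "\<sigma> x \<in> carrier ?E" "snd (\<sigma> x) = x" if "x \<in> carrier G" for x
    using that by (auto simp: \<sigma>_def carrier_cocycle_extension)
  define F where "F = (\<lambda>x. ?q (\<sigma> x)) ` carrier G"
  have F: "finite F" "F \<subseteq> carrier ?Q" using fin \<sigma> cQ by (auto simp: F_def)
  \<comment> \<open>The power with exponent |G| of an element of the extension lies over 1, hence in
    the kernel.\<close>
  have tors: "\<exists>n>0. Y [^]\<^bsub>?Q\<^esub> (n::nat) \<in> H" if Y: "Y \<in> F" for Y
  proof -
    obtain x where x: "x \<in> carrier G" "Y = ?q (\<sigma> x)" using Y unfolding F_def by blast
    have "snd (\<sigma> x [^]\<^bsub>?E\<^esub> order G) = \<one>"
      using ext.hom_nat_pow[OF \<sigma>(1)[OF x(1)], of "order G"] \<sigma>(2)[OF x(1)] pow_order_eq_1[OF x(1)] by simp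
    then have "\<sigma> x [^]\<^bsub>?E\<^esub> order G \<in> K" using \<sigma>(1)[OF x(1)] by (simp add: K_def kernel_def)
    then have "Y [^]\<^bsub>?Q\<^esub> order G \<in> H"
      using q.hom_nat_pow[OF \<sigma>(1)[OF x(1)], of "order G"] x(2) unfolding H_def by (metis imageI)
    then show ?thesis using fin order_gt_0_iff_finite by blast
  qed
  have gen: "Y \<in> generate ?Q (H \<union> F)" if "Y \<in> carrier ?Q" for Y
  proof -
    obtain u where u: "u \<in> carrier ?E" "Y = ?q u" using \<open>Y \<in> carrier ?Q\<close> unfolding cQ by blast
    have x: "snd u \<in> carrier G" using u(1) by simp
    let ?k = "u \<otimes>\<^bsub>?E\<^esub> inv\<^bsub>?E\<^esub> (\<sigma> (snd u))"
    have s: "\<sigma> (snd u) \<in> carrier ?E" "snd (\<sigma> (snd u)) = snd u" using \<sigma>[OF x] by auto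
    have kE: "?k \<in> carrier ?E" using u(1) s(1) by simp
    have "snd ?k = \<one>" using u(1) s x by simp
    then have "?k \<in> K" using kE by (simp add: K_def kernel_def)
    then have "?q ?k \<in> generate ?Q (H \<union> F)" by (auto simp: H_def intro: generate.incl)
    moreover have "?q (\<sigma> (snd u)) \<in> generate ?Q (H \<union> F)" using x by (auto simp: F_def intro: generate.incl)
    ultimately have "?q ?k \<otimes>\<^bsub>?Q\<^esub> ?q (\<sigma> (snd u)) \<in> generate ?Q (H \<union> F)" by (rule generate.eng)
    moreover have "?q ?k \<otimes>\<^bsub>?Q\<^esub> ?q (\<sigma> (snd u)) = ?q (?k \<otimes>\<^bsub>?E\<^esub> \<sigma> (snd u))" using q.hom_mult[OF kE s(1)] by simp
    moreover have "?k \<otimes>\<^bsub>?E\<^esub> \<sigma> (snd u) = u" using u(1) s(1) by (simp add: ext.G.m_assoc)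
    ultimately show ?thesis using u(2) by simp
  qed
  have \<chi>nz: "\<chi> Y \<noteq> 0" if "Y \<in> H" for Y using hom_in_carrier[OF \<chi>(1), of Y] that by simp
  have \<chi>mult: "\<chi> (Y \<otimes>\<^bsub>?Q\<^esub> W) = \<chi> Y * \<chi> W" if "Y \<in> H" "W \<in> H" for Y W
    using hom_mult[OF \<chi>(1), of Y W] that by simp
  obtain \<psi> where \<psi>: "\<forall>Y\<in>H. \<psi> Y = \<chi> Y" "\<forall>Y\<in>generate ?Q (H \<union> F). \<psi> Y \<noteq> 0"
    "\<forall>Y\<in>generate ?Q (H \<union> F). \<forall>W\<in>generate ?Q (H \<union> F). \<psi> (Y \<otimes>\<^bsub>?Q\<^esub> W) = \<psi> Y * \<psi> W"
    using Q.extend_character[where \<chi> = \<chi>, OF H F tors \<chi>nz \<chi>mult] by auto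
  define \<theta> where "\<theta> u = \<psi> (?q u)" for u
  have \<theta>nz: "\<theta> u \<noteq> 0" if "u \<in> carrier ?E" for u using \<psi>(2) gen[of "?q u"] that cQ by (auto simp: \<theta>_def)
  have \<theta>mult: "\<theta> (u \<otimes>\<^bsub>?E\<^esub> v) = \<theta> u * \<theta> v" if u: "u \<in> carrier ?E" and v: "v \<in> carrier ?E" for u v
    using \<psi>(3) gen[of "?q u"] gen[of "?q v"] q.hom_mult[OF u v] q.hom_closed[OF u] q.hom_closed[OF v]
    by (simp add: \<theta>_def)
  have \<theta>K: "\<theta> u = \<chi>0 u" if "u \<in> K" for u using \<psi>(1) \<chi>(2)[of u] that by (simp add: \<theta>_def H_def)
  have cob: "f (x, y) / h (x, y) = \<theta> (\<sigma> x) * \<theta> (\<sigma> y) / \<theta> (\<sigma> (x \<otimes> y))"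
    if x: "x \<in> carrier G" and y: "y \<in> carrier G" for x y
  proof -
    \<comment> \<open>The kernel element by which the section fails to be multiplicative. Dividing
      by the value at (1, 1) compensates the value at (1, x y) that arises on multiplying by
      \<open>\<sigma> (x \<otimes> y)\<close>.\<close>
    let ?k = "(\<lambda>k. cocycle_value G k x y / cocycle_value G k \<one> \<one>, \<one>)"
    have nz: "cocycle_value G k x y \<noteq> 0" "cocycle_value G k \<one> \<one> \<noteq> 0" for k
      using cocycle_value_nonzero x y by auto
    have k: "?k \<in> K" using nz by (simp add: Kmem)
    have "\<sigma> x \<otimes>\<^bsub>?E\<^esub> \<sigma> y = ?k \<otimes>\<^bsub>?E\<^esub> \<sigma> (x \<otimes> y)"
      using x y nz cocycle_value_one_left[of "x \<otimes> y"] by (simp add: \<sigma>_def mult_cocycle_extension)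
    then have "\<theta> (\<sigma> x) * \<theta> (\<sigma> y) = \<theta> ?k * \<theta> (\<sigma> (x \<otimes> y))" using \<theta>mult[OF \<sigma>(1)[OF x] \<sigma>(1)[OF y]]
        \<theta>mult[OF subgroup.mem_carrier[OF K k] \<sigma>(1)[OF m_closed[OF x y]]] by simp
    also have "\<theta> ?k = \<chi>0 ?k" using k by (rule \<theta>K)
    also have "\<chi>0 ?k = f (x, y) / h (x, y)" using f h nzf by (simp add: \<chi>0_def cocycle_value_def)
    finally show ?thesis using \<theta>nz[OF \<sigma>(1)[of "x \<otimes> y"]] x y by simp
  qed
  have "(\<lambda>p. f p / h p) \<in> schur_coboundaries G" unfolding schur_coboundaries_def
  proof (intro CollectI exI[of _ "\<lambda>x. \<theta> (\<sigma> x)"] conjI ballI allI impI)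
    show "\<theta> (\<sigma> x) \<noteq> 0" if "x \<in> carrier G" for x using \<theta>nz \<sigma>(1) that by blast
    show "f p / h p = 1" if "p \<notin> carrier G \<times> carrier G" for p
    proof -
      have "f p = 1" "h p = 1" using f h that unfolding schur_cocycles_def by blast+
      then show ?thesis by simp
    qed
  qed (rule cob)
  then show ?thesis using f h by (simp add: schur_rel_def)
qed

lemma schur_multiplier_order_le:
  assumes fin: "finite (carrier G)" and finE: "finite (lower_central (cocycle_extension G) (Suc (Suc 0)))"
  shows "finite (schur_cocycles G // schur_rel G) \<and>
    schur_multiplier_order G * card (lower_central G (Suc (Suc 0)))
      \<le> card (lower_central (cocycle_extension G) (Suc (Suc 0)))"
proof -
  let ?E = "cocycle_extension G" and ?L = "lower_central (cocycle_extension G) (Suc (Suc 0))"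
  interpret ext: central_extension ?E G snd by (rule central_extension_cocycle_extension)
  have L: "subgroup ?L ?E" by (rule ext.G.subgroup_lower_central)
  have LE: "?L \<subseteq> carrier ?E" by (rule ext.G.lower_central_subset)
  let ?EL = "?E\<lparr>carrier := ?L\<rparr>"
  have "snd \<in> hom ?EL G"
  proof (rule homI)
    fix u v assume "u \<in> carrier ?EL" "v \<in> carrier ?EL"
    then have "u \<in> carrier ?E" "v \<in> carrier ?E" using LE by auto
    then show "snd u \<in> carrier G" "snd (u \<otimes>\<^bsub>?EL\<^esub> v) = snd u \<otimes> snd v" using ext.hom_closed ext.hom_mult by auto
  qed
  then have r: "group_hom ?EL G snd"
    using ext.G.subgroup_imp_group[OF L] is_group unfolding group_hom_def group_hom_axioms_def by blast
  define B where "B = kernel ?EL G snd"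
  have BL: "B \<subseteq> ?L" by (auto simp: B_def kernel_def)
  have "subgroup B ?EL" unfolding B_def using r by (rule group_hom.subgroup_kernel)
  then have "group (?EL\<lparr>carrier := B\<rparr>)" using group.subgroup_imp_group ext.G.subgroup_imp_group[OF L] by blast
  then have groupB: "group (?E\<lparr>carrier := B\<rparr>)" by simp
  have finB: "finite B" using BL finE finite_subset by blast
  have cardL: "card ?L = card (lower_central G (Suc (Suc 0))) * card B"
    using group_hom.card_eq_image_times_kernel[OF r] ext.lower_central_image[of "Suc (Suc 0)"]
    by (simp add: B_def)
  \<comment> \<open>The value 0 outside \<open>B\<close> makes agreement on \<open>B\<close> amount
    to equality of functions.\<close>
  define \<phi> where "\<phi> f = (\<lambda>u. if u \<in> B then fst u f * f (\<one>, \<one>) else 0)"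
    for f :: "'a \<times> 'a \<Rightarrow> complex"
  have Bmem: "\<exists>a. u = (a, \<one>) \<and> (\<forall>k. a k \<noteq> 0)" if "u \<in> B" for u
    using that LE by (cases u) (auto simp: B_def kernel_def carrier_cocycle_extension)
  \<comment> \<open>The set of characters is not known to be finite beforehand; its finite subsets
    are bounded by |B|, and finiteness of the whole set follows.\<close>
  have le: "card A \<le> card B" if A: "A \<subseteq> \<phi> ` schur_cocycles G" "finite A" for A
  proof -
    have "card A \<le> card (carrier (?E\<lparr>carrier := B\<rparr>))"
    proof (rule group.card_characters_le[OF groupB])
      show "\<chi> u \<noteq> 0" if \<chi>: "\<chi> \<in> A" and u: "u \<in> carrier (?E\<lparr>carrier := B\<rparr>)" for \<chi> u
      proof -
        obtain f where f: "f \<in> schur_cocycles G" "\<chi> = \<phi> f" using A \<chi> by blast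
        show ?thesis using u Bmem[of u] schur_cocycles_nonzero[OF f(1)] by (auto simp: f(2) \<phi>_def)
      qed
      show "\<chi> (u \<otimes>\<^bsub>?E\<lparr>carrier := B\<rparr>\<^esub> v) = \<chi> u * \<chi> v"
        if \<chi>: "\<chi> \<in> A" and u: "u \<in> carrier (?E\<lparr>carrier := B\<rparr>)" and v: "v \<in> carrier (?E\<lparr>carrier := B\<rparr>)" for \<chi> u v
      proof -
        obtain f where f: "f \<in> schur_cocycles G" "\<chi> = \<phi> f" using A \<chi> by blast
        have uB: "u \<in> B" "v \<in> B" using u v by simp_all
        obtain a where a: "u = (a, \<one>)" using Bmem[OF uB(1)] by blast
        obtain b where b: "v = (b, \<one>)" using Bmem[OF uB(2)] by blast
        note ab = a b
        have "u \<otimes>\<^bsub>?E\<^esub> v \<in> B" using monoid.m_closed[OF group.is_monoid[OF groupB] u v] by simp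
        then have "\<phi> f (u \<otimes>\<^bsub>?E\<^esub> v) = fst (u \<otimes>\<^bsub>?E\<^esub> v) f * f (\<one>, \<one>)" by (simp add: \<phi>_def)
        also have "fst (u \<otimes>\<^bsub>?E\<^esub> v) f = a f * b f * f (\<one>, \<one>)"
          using f(1) by (simp add: ab mult_cocycle_extension cocycle_value_def)
        finally show ?thesis using u v by (simp add: f(2) \<phi>_def) (simp add: ab)
      qed
      show "\<chi> = \<psi>" if \<chi>\<psi>: "\<chi> \<in> A" "\<psi> \<in> A" and same: "\<And>u. u \<in> carrier (?E\<lparr>carrier := B\<rparr>) \<Longrightarrow> \<chi> u = \<psi> u" for \<chi> \<psi>
      proof
        fix u
        show "\<chi> u = \<psi> u"
        proof (cases "u \<in> B")
          case False
          obtain f h where "\<chi> = \<phi> f" "\<psi> = \<phi> h" using A \<chi>\<psi> by blast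
          then show ?thesis using False by (simp add: \<phi>_def)
        qed (simp add: same)
      qed
    qed (use finB A in auto)
    then show ?thesis by simp
  qed
  have finA: "finite (\<phi> ` schur_cocycles G) \<and> card (\<phi> ` schur_cocycles G) \<le> card B"
    by (rule finite_if_finite_subsets_card_bdd) (use le in blast)
  have sep: "(f, h) \<in> schur_rel G"
    if "f \<in> schur_cocycles G" "h \<in> schur_cocycles G" "\<phi> f = \<phi> h" for f h
  proof (rule schur_rel_of_eq_on_derived[OF fin that(1,2)])
    fix a assume "(a, \<one>) \<in> ?L"
    then have "(a, \<one>) \<in> B" by (simp add: B_def kernel_def)
    then show "a f * f (\<one>, \<one>) = a h * h (\<one>, \<one>)" using fun_cong[OF that(3), of "(a, \<one>)"] by (simp add: \<phi>_def)
  qed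
  have "finite (schur_cocycles G // schur_rel G) \<and> card (schur_cocycles G // schur_rel G) \<le> card B"
    using card_quotient_le[OF equiv_schur_rel conjunct1[OF finA] sep] finA by (meson le_trans)
  then show ?thesis unfolding schur_multiplier_order_def cardL by (simp add: mult.commute mult_le_mono2)
qed

end

section \<open>Reduction to Sylow subgroups\<close>

definition cocycle_restrict :: "'a set \<Rightarrow> ('a \<times> 'a \<Rightarrow> complex) \<Rightarrow> 'a \<times> 'a \<Rightarrow> complex" where
  "cocycle_restrict H f = (\<lambda>q. if q \<in> H \<times> H then f q else 1)"

lemma cocycle_restrict_in_schur_cocycles:
  assumes "group G" "subgroup H G" "f \<in> schur_cocycles G"
  shows "cocycle_restrict H f \<in> schur_cocycles (G\<lparr>carrier := H\<rparr>)"
proof -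
  have "x \<in> carrier G" if "x \<in> H" for x using subgroup.mem_carrier[OF assms(2)] that .
  then show ?thesis using assms(3) subgroup.m_closed[OF assms(2)]
    unfolding schur_cocycles_def cocycle_restrict_def by auto
qed

lemma schur_coboundaries_power:
  assumes "f \<in> schur_coboundaries G" shows "(\<lambda>q. f q ^ n) \<in> schur_coboundaries G"
proof (induction n)
  case 0 show ?case using schur_coboundaries_one by simp
next
  case (Suc n) then show ?case using schur_coboundaries_mult[OF assms] by simp
qed

text \<open>Bezout's identity writes the gcd as a difference of multiples of \<open>a\<close> and
  \<open>b\<close>.\<close>

lemma schur_coboundaries_power_gcd:
  assumes nz: "\<And>q. f q \<noteq> 0" and a: "0 < a" "(\<lambda>q. f q ^ a) \<in> schur_coboundaries G"
    and b: "(\<lambda>q. f q ^ b) \<in> schur_coboundaries G"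
  shows "(\<lambda>q. f q ^ gcd a b) \<in> schur_coboundaries G"
proof -
  obtain x y where xy: "a * x = b * y + gcd a b" using bezout_nat[of a b] a(1) by auto
  have "f q ^ gcd a b = (f q ^ a) ^ x * inverse ((f q ^ b) ^ y)" for q
    using nz[of q] by (simp add: power_mult[symmetric] xy power_add)
  then show ?thesis using schur_coboundaries_mult[OF schur_coboundaries_power[OF a(2), of x]
        schur_coboundaries_inverse[OF schur_coboundaries_power[OF b, of y]]] by simp
qed

context group
begin

text \<open>The transfer argument. If \<open>g\<close> trivializes \<open>f\<close> on \<open>H\<close>, then \<open>g\<close> extends to a function \<open>u\<close> on \<open>G\<close>
  with \<open>u (h y) = g h u y / f (h, y)\<close>, which makes \<open>v (x, y) = f (x, y) u (x y) / u x\<close> depend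
  only on the coset \<open>H x\<close>. The product of \<open>v (x, y)\<close> over these cosets trivializes the power of \<open>f\<close>.\<close>
lemma schur_coboundary_transfer:
  assumes fin: "finite (carrier G)" and H: "subgroup H G" and f: "f \<in> schur_cocycles G"
    and res: "cocycle_restrict H f \<in> schur_coboundaries (G\<lparr>carrier := H\<rparr>)"
  shows "(\<lambda>q. f q ^ card (rcosets H)) \<in> schur_coboundaries G"
proof -
  interpret H: subgroup H G by fact
  have nz: "f q \<noteq> 0" for q using f by (rule schur_cocycles_nonzero)
  have coc: "f (x, y) * f (x \<otimes> y, z) = f (x, y \<otimes> z) * f (y, z)"
    if "x \<in> carrier G" "y \<in> carrier G" "z \<in> carrier G" for x y z
    using f that by (simp add: schur_cocycles_def)
  obtain g where g: "\<forall>x\<in>H. g x \<noteq> 0" "\<forall>x\<in>H. \<forall>y\<in>H. f (x, y) = g x * g y / g (x \<otimes> y)"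
    using res by (auto simp: schur_coboundaries_def cocycle_restrict_def)
  define r where "r c = (SOME x. x \<in> c)" for c :: "'a set"
  have r: "r c \<in> carrier G" "H #> r c = c" if c: "c \<in> rcosets H" for c
  proof -
    obtain x where x: "x \<in> carrier G" "c = H #> x" using c by (auto simp: RCOSETS_def)
    have "x \<in> c" using rcos_self[OF x(1) H] x(2) by simp
    then have "r c \<in> c" unfolding r_def by (rule someI)
    then have rc: "r c \<in> H #> x" using x(2) by simp
    then show "r c \<in> carrier G" using r_coset_subset_G[OF H.subset x(1)] by blast
    show "H #> r c = c" using repr_independence[OF rc x(1) H] x(2) by simp
  qed
  define t where "t x = r (H #> x)" for x
  define k where "k x = x \<otimes> inv (t x)" for x
  have t: "t x \<in> carrier G" "H #> t x = H #> x" if "x \<in> carrier G" for x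
    using r[OF rcosetsI[OF H.subset that]] by (auto simp: t_def)
  have coset: "H #> (h \<otimes> x) = H #> x" if "h \<in> H" "x \<in> carrier G" for h x
    using coset_mult_assoc[OF H.subset, of h x] that H.rcos_const[OF is_group, of h] by simp
  have k: "k x \<in> H" "k x \<otimes> t x = x" if x: "x \<in> carrier G" for x
  proof -
    have "x \<in> H #> t x" using rcos_self[OF x H] t[OF x] by simp
    then obtain h where h: "h \<in> H" "x = h \<otimes> t x" by (auto simp: r_coset_def)
    have "k x = h \<otimes> t x \<otimes> inv (t x)"
      unfolding k_def using h(2) by (rule arg_cong[where f = "\<lambda>z. z \<otimes> inv (t x)"])
    then have "k x = h" using h(1) t(1)[OF x] by (simp add: m_assoc)
    then show "k x \<in> H" "k x \<otimes> t x = x" using h by auto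
  qed
  \<comment> \<open>The values are forced: 1 on the chosen representatives, after which the rule for
    left multiplication by \<open>k x\<close> gives the value at \<open>k x \<otimes> t x\<close>,
    which is \<open>x\<close>.\<close>
  define u where "u x = g (k x) / f (k x, t x)" for x
  have unz: "u x \<noteq> 0" if "x \<in> carrier G" for x using g(1) k(1)[OF that] nz by (simp add: u_def)
  have u: "u (h \<otimes> x) * f (h, x) = g h * u x" if h: "h \<in> H" and x: "x \<in> carrier G" for h x
  proof -
    have tx: "t (h \<otimes> x) = t x" using coset[OF h x] by (simp add: t_def)
    then have kx: "k (h \<otimes> x) = h \<otimes> k x" using h x t(1)[OF x] by (simp add: k_def m_assoc)
    have 1: "f (h, k x) * f (h \<otimes> k x, t x) = f (h, x) * f (k x, t x)"
      using coc[of h "k x" "t x"] h k[OF x] t(1)[OF x] by simp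
    have 2: "g (h \<otimes> k x) * f (h, k x) = g h * g (k x)" using g h k(1)[OF x] by simp
    have "u (h \<otimes> x) * f (h, x) = g (h \<otimes> k x) * f (h, x) * f (k x, t x) / (f (h \<otimes> k x, t x) * f (k x, t x))"
      using nz by (simp add: u_def tx kx)
    also have "\<dots> = g (h \<otimes> k x) * f (h, k x) * f (h \<otimes> k x, t x) / (f (h \<otimes> k x, t x) * f (k x, t x))"
      using 1 by (simp add: mult.assoc)
    also have "\<dots> = g h * u x" unfolding 2 using nz by (simp add: u_def)
    finally show ?thesis .
  qed
  define v where "v x y = f (x, y) * u (x \<otimes> y) / u x" for x y
  have v_inv: "v (h \<otimes> x) y = v x y" if h: "h \<in> H" and x: "x \<in> carrier G" and y: "y \<in> carrier G" for h x y
  proof -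
    have hG: "h \<in> carrier G" using h by simp
    have gh: "g h \<noteq> 0" using g(1) h by blast
    have "v (h \<otimes> x) y = f (h \<otimes> x, y) * (u (h \<otimes> (x \<otimes> y)) * f (h, x \<otimes> y)) * f (h, x)
        / (f (h, x \<otimes> y) * (u (h \<otimes> x) * f (h, x)))" using hG x y nz by (simp add: v_def m_assoc)
    also have "\<dots> = (f (h, x) * f (h \<otimes> x, y)) * u (x \<otimes> y) / (f (h, x \<otimes> y) * u x)"
      unfolding u[OF h x] u[OF h m_closed[OF x y]] using gh by (simp add: mult_ac)
    also have "\<dots> = v x y" unfolding coc[OF hG x y] using nz by (simp add: v_def)
    finally show ?thesis .
  qed
  have v_coset: "v x y = v x' y" if x: "x \<in> carrier G" "x' \<in> carrier G" "H #> x = H #> x'" and y: "y \<in> carrier G" for x x' y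
  proof -
    have "x \<in> H #> x'" using rcos_self[OF x(1) H] x(3) by simp
    then obtain h where "h \<in> H" "x = h \<otimes> x'" by (auto simp: r_coset_def)
    then show ?thesis using v_inv x(2) y by simp
  qed
  have v_coc: "v x y * v (x \<otimes> y) z = v x (y \<otimes> z) * f (y, z)"
    if x: "x \<in> carrier G" and y: "y \<in> carrier G" and z: "z \<in> carrier G" for x y z
  proof -
    have "v x y * v (x \<otimes> y) z = (f (x, y) * f (x \<otimes> y, z)) * u (x \<otimes> (y \<otimes> z)) / u x"
      using x y z unz[OF m_closed[OF x y]] by (simp add: v_def m_assoc)
    also have "\<dots> = v x (y \<otimes> z) * f (y, z)" unfolding coc[OF x y z] by (simp add: v_def)
    finally show ?thesis .
  qed
  define w where "w y = (\<Prod>c\<in>rcosets H. v (r c) y)" for y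
  have finc: "finite (rcosets H)" using fin by (simp add: RCOSETS_def)
  have w: "w y * w z = w (y \<otimes> z) * f (y, z) ^ card (rcosets H)"
    if y: "y \<in> carrier G" and z: "z \<in> carrier G" for y z
  proof -
    have shift: "c #> y \<in> rcosets H" "H #> (r c \<otimes> y) = c #> y" if c: "c \<in> rcosets H" for c
    proof -
      show "H #> (r c \<otimes> y) = c #> y" using coset_mult_assoc[OF H.subset r(1)[OF c] y] r(2)[OF c] by simp
      then show "c #> y \<in> rcosets H" using rcosetsI[OF H.subset m_closed[OF r(1)[OF c] y]] by simp
    qed
    have unshift: "c #> inv y \<in> rcosets H" "c #> inv y #> y = c" "c #> y #> inv y = c" if c: "c \<in> rcosets H" for c
    proof -
      have cG: "c \<subseteq> carrier G" using H.rcosets_carrier[OF is_group c] .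
      have "c #> inv y = H #> (r c \<otimes> inv y)"
        using coset_mult_assoc[OF H.subset r(1)[OF c] inv_closed[OF y]] r(2)[OF c] by simp
      then show "c #> inv y \<in> rcosets H"
        using rcosetsI[OF H.subset m_closed[OF r(1)[OF c] inv_closed[OF y]]] by simp
      show "c #> inv y #> y = c" "c #> y #> inv y = c"
        using coset_mult_assoc[OF cG, of "inv y" y] coset_mult_assoc[OF cG, of y "inv y"] y cG by auto
    qed
    \<comment> \<open>Right multiplication by \<open>y\<close> permutes the cosets and
      \<open>v\<close> does not depend on the representative, so the product may be taken at the
      translates \<open>r c \<otimes> y\<close>.\<close>
    have "w z = (\<Prod>c\<in>rcosets H. v (r (c #> y)) z)" unfolding w_def
      by (rule prod.reindex_bij_witness[of _ "\<lambda>c. c #> y" "\<lambda>c. c #> inv y"]) (use shift unshift in auto)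
    also have "\<dots> = (\<Prod>c\<in>rcosets H. v (r c \<otimes> y) z)"
    proof (intro prod.cong refl)
      fix c assume c: "c \<in> rcosets H"
      show "v (r (c #> y)) z = v (r c \<otimes> y) z"
        using r[OF shift(1)[OF c]] shift(2)[OF c] m_closed[OF r(1)[OF c] y] z by (intro v_coset) auto
    qed
    finally have "w y * w z = (\<Prod>c\<in>rcosets H. v (r c) y * v (r c \<otimes> y) z)" by (simp add: w_def prod.distrib)
    also have "\<dots> = (\<Prod>c\<in>rcosets H. v (r c) (y \<otimes> z) * f (y, z))"
      using r(1) y z by (intro prod.cong refl v_coc) auto
    also have "\<dots> = w (y \<otimes> z) * f (y, z) ^ card (rcosets H)" using finc by (simp add: w_def prod.distrib)
    finally show ?thesis .
  qed
  have wnz: "w y \<noteq> 0" if "y \<in> carrier G" for y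
    unfolding w_def using finc r(1) that nz unz by (auto simp: v_def)
  show ?thesis unfolding schur_coboundaries_def
  proof (intro CollectI exI[of _ w] conjI ballI allI impI)
    show "w x \<noteq> 0" if "x \<in> carrier G" for x using wnz that .
    show "f (x, y) ^ card (rcosets H) = w x * w y / w (x \<otimes> y)"
      if "x \<in> carrier G" "y \<in> carrier G" for x y using w[OF that] wnz[OF m_closed[OF that]] by simp
    show "f q ^ card (rcosets H) = 1" if "q \<notin> carrier G \<times> carrier G" for q
    proof -
      have "f q = 1" using f that unfolding schur_cocycles_def by blast
      then show ?thesis by simp
    qed
  qed
qed

text \<open>The least positive exponent \<open>d\<close> for which the power of \<open>f\<close> is
  a coboundary divides all such exponents. Transfer from the trivial subgroup puts the group order
  among them, and transfer from \<open>Syl p\<close> its index, which is prime to \<open>p\<close>.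
  So no prime divides \<open>d\<close>.\<close>

lemma schur_coboundary_of_sylow:
  assumes fin: "finite (carrier G)" and f: "f \<in> schur_cocycles G"
    and syl: "\<And>p. \<lbrakk>Factorial_Ring.prime p; p dvd order G\<rbrakk> \<Longrightarrow>
        subgroup (Syl p) G \<and> card (Syl p) = p ^ multiplicity p (order G)"
    and res: "\<And>p. \<lbrakk>Factorial_Ring.prime p; p dvd order G\<rbrakk> \<Longrightarrow>
        cocycle_restrict (Syl p) f \<in> schur_coboundaries (G\<lparr>carrier := Syl p\<rparr>)"
  shows "f \<in> schur_coboundaries G"
proof -
  let ?P = "\<lambda>m. (\<lambda>q. f q ^ m) \<in> schur_coboundaries G"
  have nz: "f q \<noteq> 0" for q using f by (rule schur_cocycles_nonzero)
  have n: "0 < order G" using fin order_gt_0_iff_finite by simp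
  have triv: "subgroup {\<one>} G" by (rule triv_subgroup)
  \<comment> \<open>On the trivial group a cocycle is the single number c = f(1, 1), and c = c c /
    c.\<close>
  have "cocycle_restrict {\<one>} f \<in> schur_coboundaries (G\<lparr>carrier := {\<one>}\<rparr>)" unfolding schur_coboundaries_def
    by (intro CollectI exI[of _ "\<lambda>x. f (x, x)"]) (use nz in \<open>auto simp: cocycle_restrict_def\<close>)
  then have "?P (card (rcosets {\<one>}))" using schur_coboundary_transfer[OF fin triv f] by blast
  then have Pn: "?P (order G)" using lagrange[OF triv] by simp
  define d where "d = (LEAST m. 0 < m \<and> ?P m)"
  have "0 < d \<and> ?P d" unfolding d_def by (rule LeastI[of _ "order G"]) (use n Pn in blast)
  then have d: "0 < d" "?P d" by auto
  have ddvd: "d dvd m" if m: "?P m" for m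
  proof -
    have "?P (gcd d m)" using nz d m by (rule schur_coboundaries_power_gcd)
    then have "d \<le> gcd d m" unfolding d_def using d(1) by (intro Least_le) (simp add: d_def)
    then have "gcd d m = d" using d(1) by (intro antisym) (auto intro: gcd_le1_nat)
    then show ?thesis by (metis gcd_dvd2)
  qed
  have "d = 1"
  proof (rule ccontr)
    assume "d \<noteq> 1"
    then obtain p where p: "Factorial_Ring.prime p" "p dvd d" using prime_factor_nat by blast
    have pn: "p dvd order G" using p(2) ddvd[OF Pn] by (rule dvd_trans)
    note S = syl[OF p(1) pn]
    have "?P (card (rcosets (Syl p)))"
      using schur_coboundary_transfer[OF fin conjunct1[OF S] f res[OF p(1) pn]] .
    then have "p dvd card (rcosets (Syl p))" using p(2) ddvd dvd_trans by blast
    then have "p * p ^ multiplicity p (order G) dvd card (rcosets (Syl p)) * card (Syl p)"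
      using S by (intro mult_dvd_mono) auto
    then have "p ^ Suc (multiplicity p (order G)) dvd order G" using lagrange[OF conjunct1[OF S]] by simp
    then show False
      using n prime_gt_1_nat[OF p(1)] multiplicity_geI[of "order G" p "Suc (multiplicity p (order G))"] by simp
  qed
  then show ?thesis using d(2) by simp
qed

text \<open>If \<open>f\<close> and \<open>h\<close> have equivalent restrictions to all Sylow
  subgroups, their quotient is a coboundary on each, hence on \<open>G\<close>. Finiteness of the
  local quotients matters, because \<open>card\<close> would count an infinite one as 0.\<close>

lemma schur_multiplier_order_le_prod_sylow:
  assumes fin: "finite (carrier G)"
    and syl: "\<And>p. \<lbrakk>Factorial_Ring.prime p; p dvd order G\<rbrakk> \<Longrightarrow>
        subgroup (Syl p) G \<and> card (Syl p) = p ^ multiplicity p (order G)"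
    and finM: "\<And>p. \<lbrakk>Factorial_Ring.prime p; p dvd order G\<rbrakk> \<Longrightarrow>
        finite (schur_cocycles (G\<lparr>carrier := Syl p\<rparr>) // schur_rel (G\<lparr>carrier := Syl p\<rparr>))"
  shows "schur_multiplier_order G
    \<le> (\<Prod>p\<in>{p. Factorial_Ring.prime p \<and> p dvd order G}. schur_multiplier_order (G\<lparr>carrier := Syl p\<rparr>))"
proof -
  let ?S = "{p. Factorial_Ring.prime p \<and> p dvd order G}"
  let ?H = "\<lambda>p. G\<lparr>carrier := Syl p\<rparr>"
  let ?M = "\<lambda>p. schur_cocycles (?H p) // schur_rel (?H p)"
  have "0 < order G" using fin order_gt_0_iff_finite by simp
  then have finS: "finite ?S" by (intro finite_subset[of ?S "{..order G}"]) (auto dest: dvd_imp_le)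
  define \<phi> where "\<phi> f = (\<lambda>p\<in>?S. schur_rel (?H p) `` {cocycle_restrict (Syl p) f})" for f
  have rcl: "cocycle_restrict (Syl p) f \<in> schur_cocycles (?H p)"
    if "p \<in> ?S" "f \<in> schur_cocycles G" for p f
    using cocycle_restrict_in_schur_cocycles[OF is_group _ that(2)] syl that(1) by blast
  have img: "\<phi> ` schur_cocycles G \<subseteq> PiE ?S ?M"
  proof
    fix c assume "c \<in> \<phi> ` schur_cocycles G"
    then obtain f where "f \<in> schur_cocycles G" "c = \<phi> f" by blast
    then show "c \<in> PiE ?S ?M" using rcl by (simp add: \<phi>_def restrict_PiE_iff quotientI)
  qed
  have finP: "finite (PiE ?S ?M)" using finS finM by (intro finite_PiE) auto
  have sep: "(f, h) \<in> schur_rel G"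
    if f: "f \<in> schur_cocycles G" and h: "h \<in> schur_cocycles G" and eq: "\<phi> f = \<phi> h" for f h
  proof -
    let ?k = "\<lambda>q. f q / h q"
    have nzf: "f q \<noteq> 0" for q using f by (rule schur_cocycles_nonzero)
    have nzh: "h q \<noteq> 0" for q using h by (rule schur_cocycles_nonzero)
    have k: "?k \<in> schur_cocycles G" unfolding schur_cocycles_def
    proof (intro CollectI conjI ballI allI impI)
      fix x y z assume xyz: "x \<in> carrier G" "y \<in> carrier G" "z \<in> carrier G"
      have "f (x, y) * f (x \<otimes> y, z) = f (x, y \<otimes> z) * f (y, z)" "h (x, y) * h (x \<otimes> y, z) = h (x, y \<otimes> z) * h (y, z)"
        using f h xyz unfolding schur_cocycles_def by blast+
      then show "?k (x, y) * ?k (x \<otimes> y, z) = ?k (x, y \<otimes> z) * ?k (y, z)" by simp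
    next
      fix q assume "q \<notin> carrier G \<times> carrier G"
      then have "f q = 1" "h q = 1" using f h unfolding schur_cocycles_def by blast+
      then show "?k q = 1" by simp
    qed (use nzf nzh in auto)
    have "?k \<in> schur_coboundaries G"
    proof (rule schur_coboundary_of_sylow[OF fin k syl])
      fix p assume p: "Factorial_Ring.prime p" "p dvd order G"
      have "schur_rel (?H p) `` {cocycle_restrict (Syl p) f} = schur_rel (?H p) `` {cocycle_restrict (Syl p) h}"
        using fun_cong[OF eq, of p] p by (simp add: \<phi>_def)
      then have "(cocycle_restrict (Syl p) f, cocycle_restrict (Syl p) h) \<in> schur_rel (?H p)"
        using eq_equiv_class[OF _ equiv_schur_rel] rcl h p by blast
      moreover have "(\<lambda>q. cocycle_restrict (Syl p) f q / cocycle_restrict (Syl p) h q) = cocycle_restrict (Syl p) ?k"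
        by (auto simp: cocycle_restrict_def)
      ultimately show "cocycle_restrict (Syl p) ?k \<in> schur_coboundaries (?H p)" by (simp add: schur_rel_def)
    qed
    then show ?thesis using f h by (simp add: schur_rel_def)
  qed
  have "card (schur_cocycles G // schur_rel G) \<le> card (\<phi> ` schur_cocycles G)"
    using card_quotient_le[OF equiv_schur_rel finite_subset[OF img finP] sep] by blast
  also have "\<dots> \<le> card (PiE ?S ?M)" using finP img by (rule card_mono)
  also have "\<dots> = (\<Prod>p\<in>?S. card (?M p))" using finS by (rule card_PiE)
  finally show ?thesis by (simp add: schur_multiplier_order_def)
qed

end

section \<open>The exponent for a single p-group\<close>

lemma p_group_schur_multiplier_bound:
  fixes P :: "('a, 'b) monoid_scheme"
  assumes grp: "group P" and p: "Factorial_Ring.prime p" and ord: "card (carrier P) = p ^ n" and n: "0 < n"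
    and rt: "int (min_gens (P Mod grp_center P) choose 2)
        - int (min_gens (P\<lparr>carrier := lower_central P 2\<rparr> Mod lower_central P 3)) = int (r choose 2) + int t" "t < r"
  defines "d \<equiv> min_gens P" and "\<delta> \<equiv> min_gens (P Mod grp_center P)"
    and "k \<equiv> multiplicity p (card (lower_central P 2))"
  shows "finite (schur_cocycles P // schur_rel P) \<and>
    real (schur_multiplier_order P) \<le> real p powr ((real d - 1) * real (n + k) / 2 - real k * (real d - real \<delta>)
       - real (\<delta> choose 3) + real (r choose 3) + real (t choose 2))"
proof -
  interpret P: group P by fact
  let ?E = "cocycle_extension P"
  interpret ext: central_extension ?E P snd by (rule P.central_extension_cocycle_extension)
  have factor: "P\<lparr>carrier := lower_central P 2\<rparr> Mod lower_central P 3 = lcs_factor P (Suc (Suc 0))"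
    by (simp only: numeral_2_eq_2 numeral_3_eq_3 lcs_factor_eq_Mod)
  have p0: "0 < p" using prime_gt_0_nat[OF p] .
  have fin: "finite (carrier P)" using ord p0 by (intro card_ge_0_finite) simp
  let ?D = "lower_central P (Suc (Suc 0))" and ?L = "lower_central ?E (Suc (Suc 0))"
  let ?B = "card (carrier (lcs_factor P (Suc 0)))"
  let ?M = "schur_multiplier_order P"
  let ?f = "(r choose 3) + (t choose 2)"
  have rt': "\<delta> choose 2 \<le> min_gens (lcs_factor P (Suc (Suc 0))) + (r choose 2) + t"
    using rt(1) unfolding factor \<delta>_def by linarith
  have bound: "finite ?L" "card ?L ^ 2 * p ^ (2 * (\<delta> choose 3)) \<le> ?B ^ (d - 1) * card ?D ^ (2 * \<delta>) * p ^ (2 * ?f)"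
    using ext.card_derived_bound[OF p ord rt'[unfolded \<delta>_def] rt(2)] unfolding \<delta>_def d_def by auto
  have M: "finite (schur_cocycles P // schur_rel P)" "?M * card ?D \<le> card ?L"
    using P.schur_multiplier_order_le[OF fin bound(1)] by auto
  obtain k' where k': "card ?D = p ^ k'" using P.card_subgroup_prime_power[OF p ord P.subgroup_lower_central] .
  then have kk: "k' = k" unfolding k_def numeral_2_eq_2
    using prime_gt_1_nat[OF p] by (simp add: multiplicity_same_power)
  have D: "card ?D = p ^ k" using k' kk by simp
  have BD: "p ^ n = ?B * p ^ k" using P.card_lcs_factor[of 0] ord D by simp
  then have "?B dvd p ^ n" by simp
  then obtain b where b: "?B = p ^ b" using divides_primepow_nat[OF p] by blast
  have "p ^ n = p ^ (b + k)" using BD b by (simp add: power_add)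
  then have nb: "n = b + k" using prime_gt_1_nat[OF p] power_inject_exp by blast
  \<comment> \<open>A nontrivial group needs a generator, so the natural number \<open>d - 1\<close>
    is a genuine difference.\<close>
  have d1: "1 \<le> d"
  proof (rule ccontr)
    assume "\<not> 1 \<le> d"
    then have d0: "min_gens P = 0" by (simp add: d_def)
    obtain S where "S \<subseteq> carrier P" "finite S" "card S = min_gens P" "generate P S = carrier P"
      using min_gens_attained[OF grp fin] by blast
    then have "carrier P = {\<one>\<^bsub>P\<^esub>}" using d0 P.generate_empty by simp
    then have "p ^ n = 1" using ord by simp
    then show False using n prime_gt_1_nat[OF p] by simp
  qed
  have "(?M * p ^ k) ^ 2 * p ^ (2 * (\<delta> choose 3)) \<le> card ?L ^ 2 * p ^ (2 * (\<delta> choose 3))"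
    using M(2) D by (intro mult_le_mono1 power_mono) auto
  also have "\<dots> \<le> (p ^ b) ^ (d - 1) * (p ^ k) ^ (2 * \<delta>) * p ^ (2 * ?f)" using bound(2) by (simp only: b D)
  also have "\<dots> = p ^ (b * (d - 1) + k * (2 * \<delta>) + 2 * ?f)" by (simp add: power_add power_mult)
  also have "(?M * p ^ k) ^ 2 * p ^ (2 * (\<delta> choose 3)) = ?M ^ 2 * p ^ (2 * k + 2 * (\<delta> choose 3))"
    by (simp add: power_mult_distrib power_add power_mult[symmetric] mult_ac)
  finally have nat_le: "?M ^ 2 * p ^ (2 * k + 2 * (\<delta> choose 3)) \<le> p ^ (b * (d - 1) + k * (2 * \<delta>) + 2 * ?f)" .
  let ?x = "(real d - 1) * real (n + k) / 2 - real k * (real d - real \<delta>)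
       - real (\<delta> choose 3) + real (r choose 3) + real (t choose 2)"
  let ?u = "2 * k + 2 * (\<delta> choose 3)" and ?v = "b * (d - 1) + k * (2 * \<delta>) + 2 * ?f"
  have rp: "0 < real p" using p0 by simp
  have "real (?M ^ 2 * p ^ ?u) \<le> real (p ^ ?v)" using nat_le by (rule of_nat_mono)
  then have "real ?M ^ 2 * real p powr real ?u \<le> real p powr real ?v"
    unfolding powr_realpow[OF rp] of_nat_mult of_nat_power .
  \<comment> \<open>With n = b + k one has b (d - 1) + 2 k \<delta> - 2 k = (d - 1) (n + k) - 2 k (d
    - \<delta>), which turns the collected powers into the stated exponent.\<close>
  also have "real ?v = 2 * ?x + real ?u"
  proof -
    have "real (b * (d - 1)) = real b * (real d - 1)" using d1 by simp
    then have "real ?v = real b * (real d - 1) + real k * (2 * real \<delta>) + 2 * real ?f"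
      unfolding of_nat_add by simp
    then show ?thesis unfolding nb by (simp add: field_simps)
  qed
  also have "real p powr (2 * ?x + real ?u) = (real p powr ?x) ^ 2 * real p powr real ?u"
    unfolding mult_2 powr_add power2_eq_square ..
  finally have "real ?M ^ 2 \<le> (real p powr ?x) ^ 2" by (rule mult_right_le_imp_le) (use rp in simp)
  then have "real ?M \<le> real p powr ?x" by (rule power2_le_imp_le) simp
  then show ?thesis using M(1) by blast
qed

theorem theorem3p5:
  fixes G :: "('a, 'b) monoid_scheme"
    and Syl :: "nat \<Rightarrow> 'a set"
    and r t :: "nat \<Rightarrow> nat"
  assumes grp: "group G"
    and fin: "finite (carrier G)"
    and syl: "\<And>p. Factorial_Ring.prime p \<Longrightarrow> p dvd order G \<Longrightarrow>
               subgroup (Syl p) G \<and> card (Syl p) = p ^ multiplicity p (order G)"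
    and rt: "\<And>p. Factorial_Ring.prime p \<Longrightarrow> p dvd order G \<Longrightarrow>
               int (min_gens (G\<lparr>carrier := Syl p\<rparr> Mod grp_center (G\<lparr>carrier := Syl p\<rparr>)) choose 2)
                 - int (min_gens ((G\<lparr>carrier := lower_central (G\<lparr>carrier := Syl p\<rparr>) 2\<rparr>)
                                   Mod lower_central (G\<lparr>carrier := Syl p\<rparr>) 3))
               = int (r p choose 2) + int (t p) \<and> t p < r p"
  shows "real (schur_multiplier_order G) \<le>
    (\<Prod>p\<in>{p. Factorial_Ring.prime p \<and> p dvd order G}.
       let Gp = G\<lparr>carrier := Syl p\<rparr>;
           np = multiplicity p (order G);
           dp = min_gens Gp;
           \<delta>p = min_gens (Gp Mod grp_center Gp);
           kp = multiplicity p (card (lower_central Gp 2))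
       in real p powr ((real dp - 1) * real (np + kp) / 2 - real kp * (real dp - real \<delta>p)
                        - real (\<delta>p choose 3) + real (r p choose 3) + real (t p choose 2)))"
proof -
  interpret G: group G by fact
  have n: "0 < order G" using fin G.order_gt_0_iff_finite by simp
  let ?b = "\<lambda>p. let Gp = G\<lparr>carrier := Syl p\<rparr>;
           np = multiplicity p (order G);
           dp = min_gens Gp;
           \<delta>p = min_gens (Gp Mod grp_center Gp);
           kp = multiplicity p (card (lower_central Gp 2))
       in real p powr ((real dp - 1) * real (np + kp) / 2 - real kp * (real dp - real \<delta>p)
                        - real (\<delta>p choose 3) + real (r p choose 3) + real (t p choose 2))"
  let ?S = "{p. Factorial_Ring.prime p \<and> p dvd order G}" and ?M = "\<lambda>p. schur_multiplier_order (G\<lparr>carrier := Syl p\<rparr>)"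
  have sylow: "finite (schur_cocycles (G\<lparr>carrier := Syl p\<rparr>) // schur_rel (G\<lparr>carrier := Syl p\<rparr>)) \<and> real (?M p) \<le> ?b p"
    if p: "Factorial_Ring.prime p" "p dvd order G" for p
  proof -
    have "group (G\<lparr>carrier := Syl p\<rparr>)" using syl[OF p] by (intro G.subgroup_imp_group) blast
    moreover have "card (carrier (G\<lparr>carrier := Syl p\<rparr>)) = p ^ multiplicity p (order G)" using syl[OF p] by simp
    moreover have "0 < multiplicity p (order G)" using p n by (simp add: prime_multiplicity_gt_zero_iff)
    ultimately show ?thesis
      using p_group_schur_multiplier_bound[of "G\<lparr>carrier := Syl p\<rparr>" p "multiplicity p (order G)" "r p" "t p"] rt[OF p] p(1)
      unfolding Let_def by simp
  qed
  have "schur_multiplier_order G \<le> (\<Prod>p\<in>?S. ?M p)"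
    using fin syl conjunct1[OF sylow] by (rule G.schur_multiplier_order_le_prod_sylow)
  then have "real (schur_multiplier_order G) \<le> real (\<Prod>p\<in>?S. ?M p)" by (rule of_nat_mono)
  also have "\<dots> = (\<Prod>p\<in>?S. real (?M p))" by simp
  also have "\<dots> \<le> (\<Prod>p\<in>?S. ?b p)" using sylow by (intro prod_mono) auto
  finally show ?thesis .
qed

end
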